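(* Let $A$ be a $2\times2$ integer matrix with $\det A=\pm1$ and no eigenvalue on the unit circle, and let $f_A:\mathbb T^2\to\mathbb T^2$, $f_A(x)=Ax$ mod $1$. Fix a mean-zero $b\in C^\infty(\mathbb T^2)$ with $\|b\|_{L^2}=1$. Let $p>0$. Then there exist $\epsilon,C,\kappa_0>0$ such that for all $\kappa\in(0,\kappa_0]$, all $C^\infty$ volume-preserving diffeomorphisms $f:\mathbb T^2\to\mathbb T^2$ with $d_{C^\infty}(f,f_A)<\epsilon$, and all $k\in(\mathbb Z^2\setminus\{0\})\cap\mathcal C_u$, $$\mathbb E\,|\hat g_{f,\kappa}(k)|^2<\frac{C}{|k|^{2p}},$$ where $g_{f,\kappa}$ is the statistically stationary scalar of the pulsed diffusion process driven by $f$, $\kappa$ and $b$.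
   Context: $\mathcal L_f[\varphi]=\varphi\circ f^{-1}$; $e^{t\Delta}$ is the heat semigroup on $\mathbb T^2=\mathbb R^2/\mathbb Z^2$, and $\mathcal L_{f,\kappa}=e^{\kappa\Delta}\circ\mathcal L_f$. Pulsed diffusion: the Markov chain $g_{n+1}=\mathcal L_{f,\kappa}g_n+\omega_{n+1}b$ on mean-zero functions in $L^2(\mathbb T^2)$, with $(\omega_n)$ IID, square-integrable, mean $0$, variance $1$. Its unique stationary law is the law of $g_{f,\kappa}=\sum_{n=0}^\infty\eta_n\mathcal L_{f,\kappa}^nb$, with $(\eta_n)$ IID with the same law as $\omega_n$. $\hat h(k)$ denotes the Fourier coefficient of $h$ with respect to $e_k(x)=e^{2\pi ik\cdot x}$. Let $v^u_T,v^s_T$ be unit eigenvectors of $A^T$ for the eigenvalues outside and inside the unit circle respectively, and $\mathcal C_u=\{a^uv^u_T+a^sv^s_T:\ |a^s|\le|a^u|\}\subset\mathbb R^2$. $d_{C^\infty}(f,g)=\sum_{k\ge0}2^{-k}\frac{d_{C^k}(f,g)}{1+d_{C^k}(f,g)}$, where $d_{C^0}$ is the uniform distance and $d_{C^k}(f,g)=\max\{d_{C^{k-1}}(f,g),\sup_x\|D^kf(x)-D^kg(x)\|\}$. *)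

theory Defs
  imports "HOL-Probability.Probability"
begin

definition int_vec :: "int^2 \<Rightarrow> real^2" where
  "int_vec k = (\<chi> i. real_of_int (k $ i))"

quotient_type torus = "real^2" / "\<lambda>x y. \<exists>n. x - y = int_vec n"
  morphisms rep_torus proj_torus
proof (rule equivpI)
  show "reflp (\<lambda>x y. \<exists>n. x - y = int_vec n)"
    by (rule reflpI, rule exI[of _ 0]) (simp add: int_vec_def vec_eq_iff)
  show "symp (\<lambda>x y. \<exists>n. x - y = int_vec n)"
  proof (rule sympI)
    fix x y :: "real^2" assume "\<exists>n. x - y = int_vec n"
    then obtain n where "x - y = int_vec n" ..
    then have "y - x = int_vec (- n)"
      by (simp add: int_vec_def vec_eq_iff algebra_simps)
    then show "\<exists>n. y - x = int_vec n" ..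
  qed
  show "transp (\<lambda>x y. \<exists>n. x - y = int_vec n)"
  proof (rule transpI)
    fix x y z :: "real^2"
    assume "\<exists>n. x - y = int_vec n" "\<exists>n. y - z = int_vec n"
    then obtain m n where "x - y = int_vec m" "y - z = int_vec n" by blast
    then have "x - z = int_vec (m + n)"
      by (simp add: int_vec_def vec_eq_iff algebra_simps)
    then show "\<exists>n. x - z = int_vec n" ..
  qed
qed

instantiation torus :: topological_space
begin

definition open_torus :: "torus set \<Rightarrow> bool" where
  "open_torus U \<longleftrightarrow> open (proj_torus -` U)"

instance
  by standard (auto simp: open_torus_def vimage_Union)

end

lemma continuous_proj_torus: "continuous_on UNIV proj_torus"
  by (auto simp: continuous_on_open_vimage open_torus_def)

definition torus_measure :: "torus measure" where
  "torus_measure =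
     distr (restrict_space lborel {x :: real^2. \<forall>i. 0 \<le> x $ i \<and> x $ i < 1}) borel proj_torus"

lift_definition torus_char :: "int^2 \<Rightarrow> torus \<Rightarrow> complex" is
  "\<lambda>k x. cis (2 * pi * (int_vec k \<bullet> x))"
proof -
  fix k :: "int^2" and x y :: "real^2"
  assume "\<exists>n. x - y = int_vec n"
  then obtain n where "x - y = int_vec n" ..
  then have "x = y + int_vec n"
    by (simp add: algebra_simps)
  moreover have "int_vec k \<bullet> int_vec n = real_of_int (\<Sum>i\<in>UNIV. k $ i * n $ i)"
    by (simp add: int_vec_def inner_vec_def)
  ultimately have "cis (2 * pi * (int_vec k \<bullet> x)) =
      cis (2 * pi * (int_vec k \<bullet> y)) * cis (2 * pi * real_of_int (\<Sum>i\<in>UNIV. k $ i * n $ i))"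
    by (simp add: inner_add_right cis_mult algebra_simps)
  also have "cis (2 * pi * real_of_int (\<Sum>i\<in>UNIV. k $ i * n $ i)) = 1"
    by (rule cis_multiple_2pi) (rule Ints_of_int)
  finally show "cis (2 * pi * (int_vec k \<bullet> x)) = cis (2 * pi * (int_vec k \<bullet> y))"
    by simp
qed

definition fourier_coeff :: "(torus \<Rightarrow> complex) \<Rightarrow> int^2 \<Rightarrow> complex" where
  "fourier_coeff h k = (LINT x|torus_measure. h x * cnj (torus_char k x))"

definition in_L2 :: "(torus \<Rightarrow> complex) \<Rightarrow> bool" where
  "in_L2 h \<longleftrightarrow> h \<in> borel_measurable torus_measure \<and>
     integrable torus_measure (\<lambda>x. (cmod (h x))\<^sup>2)"

definition L2_norm :: "(torus \<Rightarrow> complex) \<Rightarrow> real" where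
  "L2_norm h = sqrt (LINT x|torus_measure. (cmod (h x))\<^sup>2)"

text \<open>Sums of series in \<open>L\<^sup>2\<close>, in the style of \<^const>\<open>sums\<close> and \<^const>\<open>suminf\<close>. Elements of
  \<open>L\<^sup>2\<close> are represented by functions, so the sum is determined up to null sets.\<close>

definition L2_sums :: "(nat \<Rightarrow> torus \<Rightarrow> complex) \<Rightarrow> (torus \<Rightarrow> complex) \<Rightarrow> bool" where
  "L2_sums u h \<longleftrightarrow> (\<forall>n. in_L2 (u n)) \<and> in_L2 h \<and>
     (\<lambda>N. L2_norm (\<lambda>x. (\<Sum>n<N. u n x) - h x)) \<longlonglongrightarrow> 0"

definition L2_suminf :: "(nat \<Rightarrow> torus \<Rightarrow> complex) \<Rightarrow> torus \<Rightarrow> complex" where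
  "L2_suminf u = (SOME h. L2_sums u h)"

text \<open>The iterated Frechet derivative
  \<open>D\<^sup>k F(x)[v\<^sub>1, \<dots>, v\<^sub>k]\<close>, where \<open>[v\<^sub>1, \<dots>, v\<^sub>k]\<close> is the list argument.\<close>

fun iter_deriv :: "('a::real_normed_vector \<Rightarrow> 'b::real_normed_vector) \<Rightarrow> 'a list \<Rightarrow> 'a \<Rightarrow> 'b" where
  "iter_deriv F [] x = F x"
| "iter_deriv F (v # vs) x = frechet_derivative (iter_deriv F vs) (at x) v"

definition smooth :: "('a::euclidean_space \<Rightarrow> 'b::real_normed_vector) \<Rightarrow> bool" where
  "smooth F \<longleftrightarrow> (\<forall>vs x. iter_deriv F vs differentiable at x)"

definition smooth_scalar :: "(torus \<Rightarrow> complex) \<Rightarrow> bool" where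
  "smooth_scalar h \<longleftrightarrow> smooth (h \<circ> proj_torus)"

text \<open>Two smooth lifts of the same torus map differ by a constant integer vector, so their
  derivatives of order at least one coincide.\<close>

definition smooth_lift :: "(torus \<Rightarrow> torus) \<Rightarrow> (real^2 \<Rightarrow> real^2) \<Rightarrow> bool" where
  "smooth_lift f F \<longleftrightarrow> smooth F \<and> proj_torus \<circ> F = f \<circ> proj_torus"

definition the_lift :: "(torus \<Rightarrow> torus) \<Rightarrow> real^2 \<Rightarrow> real^2" where
  "the_lift f = (SOME F. smooth_lift f F)"

definition smooth_torus_map :: "(torus \<Rightarrow> torus) \<Rightarrow> bool" where
  "smooth_torus_map f \<longleftrightarrow> (\<exists>F. smooth_lift f F)"

definition torus_diffeo :: "(torus \<Rightarrow> torus) \<Rightarrow> bool" where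
  "torus_diffeo f \<longleftrightarrow> bij f \<and> smooth_torus_map f \<and> smooth_torus_map (inv f)"

definition volume_preserving :: "(torus \<Rightarrow> torus) \<Rightarrow> bool" where
  "volume_preserving f \<longleftrightarrow> f \<in> torus_measure \<rightarrow>\<^sub>M torus_measure \<and>
     distr torus_measure torus_measure f = torus_measure"

definition torus_dist :: "torus \<Rightarrow> torus \<Rightarrow> real" where
  "torus_dist s t = Inf {dist x y | x y. proj_torus x = s \<and> proj_torus y = t}"

text \<open>The operator norm of the \<open>k\<close>-linear map \<open>D\<^sup>k F(x) - D\<^sup>k G(x)\<close>.\<close>

definition deriv_dist_at ::
    "nat \<Rightarrow> (real^2 \<Rightarrow> real^2) \<Rightarrow> (real^2 \<Rightarrow> real^2) \<Rightarrow> real^2 \<Rightarrow> real" where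
  "deriv_dist_at k F G x =
     (SUP vs\<in>{vs. length vs = k \<and> (\<forall>v\<in>set vs. norm v \<le> 1)}.
        norm (iter_deriv F vs x - iter_deriv G vs x))"

primrec dist_C :: "nat \<Rightarrow> (torus \<Rightarrow> torus) \<Rightarrow> (torus \<Rightarrow> torus) \<Rightarrow> real" where
  "dist_C 0 f g = (SUP x. torus_dist (f x) (g x))"
| "dist_C (Suc k) f g =
     max (dist_C k f g) (SUP x. deriv_dist_at (Suc k) (the_lift f) (the_lift g) x)"

definition dist_C_inf :: "(torus \<Rightarrow> torus) \<Rightarrow> (torus \<Rightarrow> torus) \<Rightarrow> real" where
  "dist_C_inf f g = (\<Sum>k. (1 / 2) ^ k * (dist_C k f g / (1 + dist_C k f g)))"

definition is_eigenvector :: "'a::field^'n^'n \<Rightarrow> 'a \<Rightarrow> 'a^'n \<Rightarrow> bool" where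
  "is_eigenvector B l v \<longleftrightarrow> v \<noteq> 0 \<and> B *v v = l *s v"

definition is_eigenvalue :: "'a::field^'n^'n \<Rightarrow> 'a \<Rightarrow> bool" where
  "is_eigenvalue B l \<longleftrightarrow> (\<exists>v. is_eigenvector B l v)"

lift_definition linear_torus_map :: "int^2^2 \<Rightarrow> torus \<Rightarrow> torus" is
  "\<lambda>A x. map_matrix of_int A *v x"
proof -
  fix A :: "int^2^2" and x y :: "real^2"
  assume "\<exists>n. x - y = int_vec n"
  then obtain n where "x - y = int_vec n" ..
  then have "map_matrix of_int A *v x - map_matrix of_int A *v y = map_matrix of_int A *v int_vec n"
    by (metis matrix_vector_mult_diff_distrib)
  also have "\<dots> = int_vec (A *v n)"
    by (simp add: int_vec_def map_matrix_def matrix_vector_mult_def vec_eq_iff)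
  finally show "\<exists>n. map_matrix of_int A *v x - map_matrix of_int A *v y = int_vec n" ..
qed

definition unstable_cone :: "real^2 \<Rightarrow> real^2 \<Rightarrow> (real^2) set" where
  "unstable_cone vu vs = {au *\<^sub>R vu + as *\<^sub>R vs | au as. \<bar>as\<bar> \<le> \<bar>au\<bar>}"

definition transfer_op :: "(torus \<Rightarrow> torus) \<Rightarrow> (torus \<Rightarrow> complex) \<Rightarrow> torus \<Rightarrow> complex" where
  "transfer_op f h = h \<circ> inv f"

text \<open>The heat semigroup as a Fourier multiplier. For \<open>t > 0\<close> and integrable \<open>h\<close> the series
  converges absolutely, so that it defines a function pointwise.\<close>

definition heat :: "real \<Rightarrow> (torus \<Rightarrow> complex) \<Rightarrow> torus \<Rightarrow> complex" where
  "heat t h x = (\<Sum>\<^sub>\<infinity>k\<in>UNIV.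
     complex_of_real (exp (- (4 * pi\<^sup>2 * (norm (int_vec k))\<^sup>2 * t))) *
       fourier_coeff h k * torus_char k x)"

definition pulsed_op ::
    "(torus \<Rightarrow> torus) \<Rightarrow> real \<Rightarrow> (torus \<Rightarrow> complex) \<Rightarrow> torus \<Rightarrow> complex" where
  "pulsed_op f \<kappa> h = heat \<kappa> (transfer_op f h)"

text \<open>The stationary scalar for the realisation \<open>a\<close> of the noise sequence.\<close>

definition stationary_scalar ::
    "(torus \<Rightarrow> torus) \<Rightarrow> real \<Rightarrow> (torus \<Rightarrow> complex) \<Rightarrow> (nat \<Rightarrow> real) \<Rightarrow> torus \<Rightarrow> complex" where
  "stationary_scalar f \<kappa> b a =
     L2_suminf (\<lambda>n x. complex_of_real (a n) * (pulsed_op f \<kappa> ^^ n) b x)"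

definition normalized_iid :: "'w measure \<Rightarrow> (nat \<Rightarrow> 'w \<Rightarrow> real) \<Rightarrow> bool" where
  "normalized_iid M \<eta> \<longleftrightarrow>
     prob_space M \<and>
     prob_space.indep_vars M (\<lambda>_. borel) \<eta> UNIV \<and>
     (\<forall>n. distr M borel (\<eta> n) = distr M borel (\<eta> 0)) \<and>
     integrable M (\<lambda>w. (\<eta> 0 w)\<^sup>2) \<and>
     prob_space.expectation M (\<eta> 0) = 0 \<and>
     prob_space.variance M (\<eta> 0) = 1"

end

theory Submission
  imports Defs
begin

text \<open>The coefficient of \<open>e\<^sub>j \<circ> f\<^sup>-\<^sup>1\<close> at \<open>k\<close> is an integral of \<open>exp (2 \<pi> i (j x - k F x))\<close>, where the lift
  \<open>F\<close> is a small smooth perturbation of \<open>A\<close>. By nonstationary phase it decays rapidly outside the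
  region \<open>|A\<^sup>T k - j| \<le> c |k|\<close>, and it is small there if \<open>F\<close> is close to \<open>A\<close>. Inside the region no
  estimate is needed beyond Bessel's inequality, because \<open>A\<^sup>T\<close> increases a weight on the frequencies
  which is a large power of \<open>|k|\<close> in the unstable cone and a large negative power outside it. Hence
  the transfer operator of \<open>f\<close> contracts the weighted \<open>\<ell>\<^sup>2\<close> norm of the Fourier coefficients by a
  factor \<open>1 / 2\<close>, and so does the pulsed operator for every \<open>\<kappa>\<close>, since the heat semigroup is a
  Fourier multiplier with values in \<open>[0, 1]\<close>. The second moment of a coefficient of the stationary
  scalar is at most the sum of the squared coefficients of the iterates, which is therefore a
  geometric series divided by the weight.

  The contraction is started at the first iterate instead of \<open>b\<close>: its Fourier series converges
  absolutely by definition of the heat semigroup, so that no Fourier inversion theorem is needed.\<close>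

subsection \<open>Oscillatory integrals over the circle\<close>

text \<open>Near pairs \<open>(k, j)\<close> have no decay, and Bessel's inequality does not see a
  weight. They are reconciled by the gain 64 of weight from \<open>k\<close> to a near
  \<open>j\<close>: Bessel is applied once to all rows of weight about 2^s, with the columns
  restricted to weight at least 64 * 2^s. A column of weight w meets only layers whose levels sum to
  at most w / 32. Splitting a row sum in two costs a factor 2 and the width of a layer another 2, so
  near pairs contribute 4 / 32 = 1/8; far pairs are made to contribute at most 1/8, and 1/4 is the
  square of the announced 1/2.

  A far entry must be small and rapidly decaying at once. Only its square enters, so one factor is
  bounded by a first-order estimate proportional to the closeness \<delta>, the other by repeated
  integration by parts. The constant of the latter asks only for the fixed closeness c / 4, hence
  \<delta> can be chosen after it.

  The constants of the final bound come from \<open>A\<close>, \<open>b\<close> and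
  \<open>p\<close>. Bounds that exploit the smoothing by heat depend on \<kappa> and serve only for
  convergence of series.\<close>

definition uniformly_bounded :: "'i set \<Rightarrow> ('i \<Rightarrow> real \<Rightarrow> complex) \<Rightarrow> bool" where
  "uniformly_bounded I u \<longleftrightarrow> (\<exists>B. \<forall>i\<in>I. \<forall>t. cmod (u i t) \<le> B) \<and>
     (\<forall>i\<in>I. continuous_on UNIV (u i) \<and> (\<forall>t. u i (t + 1) = u i t))"

text \<open>Boundedness in C^n of the circle of length 1, with one bound for the whole family. Later
  the index runs over all maps, frequencies and lines at once, and uniformity is what leaves a
  single constant. The derivative is merely asked to exist as a family, so that closure properties
  follow by induction on the order.\<close>

primrec Ck_bounded :: "'i set \<Rightarrow> nat \<Rightarrow> ('i \<Rightarrow> real \<Rightarrow> complex) \<Rightarrow> bool" where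
  "Ck_bounded I 0 u \<longleftrightarrow> uniformly_bounded I u"
| "Ck_bounded I (Suc n) u \<longleftrightarrow> uniformly_bounded I u \<and>
     (\<exists>u'. (\<forall>i\<in>I. \<forall>t. (u i has_vector_derivative u' i t) (at t)) \<and> Ck_bounded I n u')"

lemma continuous_on_vector_derivative:
  "(\<And>t. (f has_vector_derivative f' t) (at t)) \<Longrightarrow> continuous_on S f"
  by (meson continuous_at_imp_continuous_on has_vector_derivative_continuous)

lemma Ck_bounded_imp_uniformly_bounded: "Ck_bounded I n u \<Longrightarrow> uniformly_bounded I u"
  by (cases n) auto

lemma Ck_bounded_SucD: "Ck_bounded I (Suc n) u \<Longrightarrow> Ck_bounded I n u"
  by (induction n arbitrary: u) (auto intro: Ck_bounded_imp_uniformly_bounded)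

lemma uniformly_bounded_mult:
  assumes "uniformly_bounded I u" "uniformly_bounded I v"
  shows "uniformly_bounded I (\<lambda>i t. u i t * v i t)"
proof -
  obtain B C where B: "\<And>i t. i \<in> I \<Longrightarrow> cmod (u i t) \<le> B" and C: "\<And>i t. i \<in> I \<Longrightarrow> cmod (v i t) \<le> C"
    using assms unfolding uniformly_bounded_def by metis
  have "cmod (u i t * v i t) \<le> B * C" if "i \<in> I" for i t
    unfolding norm_mult using B[OF that, of t] C[OF that, of t]
    by (intro mult_mono) (auto intro: order_trans[OF norm_ge_zero])
  then show ?thesis
    using assms unfolding uniformly_bounded_def by (auto intro!: continuous_intros)
qed

lemma uniformly_bounded_add:
  assumes "uniformly_bounded I u" "uniformly_bounded I v"
  shows "uniformly_bounded I (\<lambda>i t. u i t + v i t)"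
proof -
  obtain B C where "\<And>i t. i \<in> I \<Longrightarrow> cmod (u i t) \<le> B" "\<And>i t. i \<in> I \<Longrightarrow> cmod (v i t) \<le> C"
    using assms unfolding uniformly_bounded_def by metis
  then have "cmod (u i t + v i t) \<le> B + C" if "i \<in> I" for i t
    using that by (meson norm_triangle_mono)
  then show ?thesis
    using assms unfolding uniformly_bounded_def by (auto intro!: continuous_intros)
qed

lemma Ck_bounded_add:
  "Ck_bounded I n u \<Longrightarrow> Ck_bounded I n v \<Longrightarrow> Ck_bounded I n (\<lambda>i t. u i t + v i t)"
proof (induction n arbitrary: u v)
  case 0
  then show ?case by (simp add: uniformly_bounded_add)
next
  case (Suc n)
  from Suc.prems obtain u' v' where
    u: "uniformly_bounded I u" "\<forall>i\<in>I. \<forall>t. (u i has_vector_derivative u' i t) (at t)" "Ck_bounded I n u'" and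
    v: "uniformly_bounded I v" "\<forall>i\<in>I. \<forall>t. (v i has_vector_derivative v' i t) (at t)" "Ck_bounded I n v'"
    by auto
  show ?case unfolding Ck_bounded.simps
    using u v Suc.IH[OF u(3) v(3)]
    by (intro conjI uniformly_bounded_add exI[of _ "\<lambda>i t. u' i t + v' i t"])
      (simp_all add: has_vector_derivative_add)
qed

lemma Ck_bounded_mult:
  "Ck_bounded I n u \<Longrightarrow> Ck_bounded I n v \<Longrightarrow> Ck_bounded I n (\<lambda>i t. u i t * v i t)"
proof (induction n arbitrary: u v)
  case 0
  then show ?case by (simp add: uniformly_bounded_mult)
next
  case (Suc n)
  from Suc.prems obtain u' v' where
    u: "uniformly_bounded I u" "\<forall>i\<in>I. \<forall>t. (u i has_vector_derivative u' i t) (at t)" "Ck_bounded I n u'" and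
    v: "uniformly_bounded I v" "\<forall>i\<in>I. \<forall>t. (v i has_vector_derivative v' i t) (at t)" "Ck_bounded I n v'"
    by auto
  have "Ck_bounded I n (\<lambda>i t. u i t * v' i t + u' i t * v i t)"
    using Suc.prems[THEN Ck_bounded_SucD] u(3) v(3) by (intro Ck_bounded_add Suc.IH)
  then show ?case unfolding Ck_bounded.simps
    using u v
    by (intro conjI uniformly_bounded_mult exI[of _ "\<lambda>i t. u i t * v' i t + u' i t * v i t"])
      (simp_all add: has_vector_derivative_mult)
qed

lemma Ck_bounded_const: "Ck_bounded I n (\<lambda>i t. c)"
proof (induction n arbitrary: c)
  case (Suc n)
  then show ?case
    by (auto simp: uniformly_bounded_def intro!: exI[of _ "\<lambda>i t. 0"])
qed (auto simp: uniformly_bounded_def)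

lemma has_vector_derivative_inverse_complex:
  fixes u :: "real \<Rightarrow> complex"
  assumes "(u has_vector_derivative u') (at t)" "u t \<noteq> 0"
  shows "((\<lambda>t. inverse (u t)) has_vector_derivative (- u' * (inverse (u t) * inverse (u t)))) (at t)"
proof -
  have "((inverse \<circ> u) has_vector_derivative (u' * - (inverse (u t) * inverse (u t)))) (at t)"
    using assms by (intro field_vector_diff_chain_at) (auto intro!: derivative_eq_intros simp: power2_eq_square)
  then show ?thesis by (simp add: o_def)
qed

text \<open>The derivative -u' / u^2 contains the inverse at one order lower, where the induction
  hypothesis and closure under products apply. The lower bound \<open>c\<close> bounds the inverse
  at order 0 and excludes zeros.\<close>

lemma Ck_bounded_inverse:
  assumes "\<And>i t. i \<in> I \<Longrightarrow> cmod (u i t) \<ge> c" "c > 0"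
  shows "Ck_bounded I n u \<Longrightarrow> Ck_bounded I n (\<lambda>i t. inverse (u i t))"
proof (induction n)
  case 0
  have "cmod (inverse (u i t)) \<le> inverse c" if "i \<in> I" for i t
    using assms(1)[OF that, of t] assms(2) by (simp add: norm_inverse le_imp_inverse_le)
  moreover have "u i t \<noteq> 0" if "i \<in> I" for i t
    using assms(1)[OF that, of t] assms(2) by auto
  ultimately show ?case using 0 by (auto simp: uniformly_bounded_def intro!: continuous_intros)
next
  case (Suc n)
  from Suc.prems obtain u' where
    u: "uniformly_bounded I u" "\<forall>i\<in>I. \<forall>t. (u i has_vector_derivative u' i t) (at t)" "Ck_bounded I n u'"
    by auto
  have nz: "u i t \<noteq> 0" if "i \<in> I" for i t
    using assms(1)[OF that, of t] assms(2) by auto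
  have I: "Ck_bounded I n (\<lambda>i t. inverse (u i t))"
    using Suc.prems by (intro Suc.IH Ck_bounded_SucD[of I n u])
  then have "Ck_bounded I n (\<lambda>i t. (- 1) * (u' i t * (inverse (u i t) * inverse (u i t))))"
    using u by (intro Ck_bounded_mult Ck_bounded_const)
  then show ?case unfolding Ck_bounded.simps
    using u nz Ck_bounded_imp_uniformly_bounded[OF I]
    by (intro conjI exI[of _ "\<lambda>i t. (- 1) * (u' i t * (inverse (u i t) * inverse (u i t)))"])
      (auto simp: intro!: has_vector_derivative_inverse_complex[THEN has_vector_derivative_eq_rhs])
qed

text \<open>Repeated integration by parts; \<open>E\<close> is the oscillating factor with phase velocity \<open>L \<omega>\<close>.\<close>

lemma nonstationary_phase:
  fixes E \<omega> v :: "'i \<Rightarrow> real \<Rightarrow> complex" and L :: "'i \<Rightarrow> real"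
  assumes E: "\<And>i t. i \<in> I \<Longrightarrow> (E i has_vector_derivative (L i * \<omega> i t * E i t)) (at t)"
    and E1: "\<And>i t. i \<in> I \<Longrightarrow> cmod (E i t) \<le> 1"
    and Ep: "\<And>i t. i \<in> I \<Longrightarrow> E i (t + 1) = E i t"
    and L: "\<And>i. i \<in> I \<Longrightarrow> L i > 0"
    and \<omega>: "Ck_bounded I n \<omega>" "\<And>i t. i \<in> I \<Longrightarrow> cmod (\<omega> i t) \<ge> c" "c > 0"
  shows "Ck_bounded I n v \<Longrightarrow> \<exists>B. \<forall>i\<in>I. cmod (integral {0..1} (\<lambda>t. E i t * v i t)) \<le> B / L i ^ n"
  using \<omega>(1)
proof (induction n arbitrary: v)
  case 0
  then obtain B where B: "\<And>i t. i \<in> I \<Longrightarrow> cmod (v i t) \<le> B"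
      and cv: "\<And>i. i \<in> I \<Longrightarrow> continuous_on UNIV (v i)"
    unfolding Ck_bounded.simps uniformly_bounded_def by metis
  have "cmod (integral {0..1} (\<lambda>t. E i t * v i t)) \<le> B" if i: "i \<in> I" for i
  proof -
    have "norm (integral {0..1} (\<lambda>t. E i t * v i t)) \<le> B * (1 - 0)"
    proof (rule integral_bound)
      show "continuous_on {0..1} (\<lambda>t. E i t * v i t)"
        by (intro continuous_on_mult continuous_on_vector_derivative[OF E[OF i]]
            continuous_on_subset[OF cv[OF i]]) auto
      show "norm (E i t * v i t) \<le> B" for t
        unfolding norm_mult using mult_mono[OF E1[OF i, of t] B[OF i, of t]] by simp
    qed simp
    then show ?thesis by simp
  qed
  then show ?case by auto
next
  case (Suc n)
  have nz: "\<omega> i t \<noteq> 0" if "i \<in> I" for i t using \<omega>(2)[OF that, of t] \<omega>(3) by auto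
  \<comment> \<open>Since E' = L \<omega> E, the integrand E v is E' V / L with V = v / \<omega>.
    One integration by parts replaces v by the derivative of V and gains 1 / L; periodicity cancels
    the boundary terms.\<close>
  have V: "Ck_bounded I (Suc n) (\<lambda>i t. v i t * inverse (\<omega> i t))"
    using Suc.prems \<omega> by (intro Ck_bounded_mult Ck_bounded_inverse[where c = c])
  then obtain w where w: "\<And>i t. i \<in> I \<Longrightarrow> ((\<lambda>t. v i t * inverse (\<omega> i t)) has_vector_derivative w i t) (at t)"
      and wn: "Ck_bounded I n w"
    by auto
  from V have per: "\<And>i t. i \<in> I \<Longrightarrow> v i (t + 1) * inverse (\<omega> i (t + 1)) = v i t * inverse (\<omega> i t)"
    by (simp add: uniformly_bounded_def)
  from Suc.IH[OF wn] Suc.prems obtain B where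
    B: "\<And>i. i \<in> I \<Longrightarrow> cmod (integral {0..1} (\<lambda>t. E i t * w i t)) \<le> B / L i ^ n"
    using Ck_bounded_SucD by blast
  have "cmod (integral {0..1} (\<lambda>t. E i t * v i t)) \<le> B / L i ^ Suc n" if i: "i \<in> I" for i
  proof -
    let ?V = "\<lambda>t. v i t * inverse (\<omega> i t)"
    have cont: "continuous_on {0..1} (w i)" "continuous_on {0..1} (E i)" "continuous_on {0..1} (v i)"
      using continuous_on_vector_derivative[OF E[OF i]] Ck_bounded_imp_uniformly_bounded[OF wn] 
        Ck_bounded_imp_uniformly_bounded[OF Suc.prems(1)] i
      by (auto simp: uniformly_bounded_def intro: continuous_on_subset)
    have D: "((\<lambda>t. E i t * ?V t) has_vector_derivative (E i t * w i t + L i * (E i t * v i t))) (at t)" for t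
      using has_vector_derivative_mult[OF E[OF i, of t] w[OF i, of t]] nz[OF i, of t]
      by (simp add: field_simps)
    have "((\<lambda>t. E i t * w i t + L i * (E i t * v i t)) has_integral (E i 1 * ?V 1 - E i 0 * ?V 0)) {0..1}"
      by (rule fundamental_theorem_of_calculus) (auto intro!: has_vector_derivative_at_within D)
    also have "E i 1 * ?V 1 - E i 0 * ?V 0 = 0"
      using Ep[OF i, of 0] per[OF i, of 0] by simp
    finally have "integral {0..1} (\<lambda>t. E i t * w i t + L i * (E i t * v i t)) = 0"
      by (rule integral_unique)
    moreover have "integral {0..1} (\<lambda>t. E i t * w i t + L i * (E i t * v i t)) =
        integral {0..1} (\<lambda>t. E i t * w i t) + L i * integral {0..1} (\<lambda>t. E i t * v i t)"
      using cont by (subst Henstock_Kurzweil_Integration.integral_add)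
        (auto intro!: integrable_continuous_interval continuous_intros)
    ultimately have "L i * integral {0..1} (\<lambda>t. E i t * v i t) = - integral {0..1} (\<lambda>t. E i t * w i t)"
      by (simp add: eq_neg_iff_add_eq_0 add.commute)
    then have "cmod (L i * integral {0..1} (\<lambda>t. E i t * v i t)) = cmod (integral {0..1} (\<lambda>t. E i t * w i t))"
      by simp
    then have "L i * cmod (integral {0..1} (\<lambda>t. E i t * v i t)) \<le> B / L i ^ n"
      using B[OF i] L[OF i] by (simp add: norm_mult)
    then show ?thesis using L[OF i] by (simp add: field_simps)
  qed
  then show ?case by blast
qed

text \<open>By periodicity the integral of E' = a (1 + \<rho>) E over a period vanishes, hence the
  integral of E is minus that of \<rho> E. Nothing about derivatives of \<rho> is involved, and the
  bound is the size of \<rho> itself.\<close>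

lemma nonstationary_phase_first_order:
  fixes E \<rho> :: "real \<Rightarrow> complex" and a :: complex
  assumes E: "\<And>t. (E has_vector_derivative (a * (1 + \<rho> t) * E t)) (at t)"
    and E1: "\<And>t. cmod (E t) \<le> 1" and Ep: "E 1 = E 0"
    and a: "a \<noteq> 0" and \<rho>: "\<And>t. cmod (\<rho> t) \<le> r" "continuous_on UNIV \<rho>"
  shows "cmod (integral {0..1} E) \<le> r"
proof -
  have cont: "continuous_on {0..1} E" "continuous_on {0..1} \<rho>"
    using continuous_on_vector_derivative[OF E] continuous_on_subset[OF \<rho>(2)] by auto
  have "((\<lambda>t. a * (1 + \<rho> t) * E t) has_integral (E 1 - E 0)) {0..1}"
    by (rule fundamental_theorem_of_calculus) (auto intro!: has_vector_derivative_at_within E)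
  then have "integral {0..1} (\<lambda>t. a * (E t + E t * \<rho> t)) = 0"
    using Ep by (simp add: integral_unique algebra_simps)
  then have "integral {0..1} (\<lambda>t. E t + E t * \<rho> t) = 0"
    using a by simp
  then have "integral {0..1} E = - integral {0..1} (\<lambda>t. E t * \<rho> t)"
    using cont by (subst (asm) Henstock_Kurzweil_Integration.integral_add)
        (auto intro!: integrable_continuous_interval continuous_intros simp: eq_neg_iff_add_eq_0)
  moreover have "norm (integral {0..1} (\<lambda>t. E t * \<rho> t)) \<le> r * (1 - 0)"
  proof (rule integral_bound)
    show "norm (E t * \<rho> t) \<le> r" for t
        unfolding norm_mult using mult_mono[OF E1[of t] \<rho>(1)[of t]] by simp
  qed (use cont in \<open>auto intro!: continuous_intros\<close>)
  ultimately show ?thesis by simp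
qed

subsection \<open>Lebesgue measure on the torus\<close>

abbreviation (input) shift :: "real^2 \<Rightarrow> 2 \<Rightarrow> real \<Rightarrow> real^2" where
  "shift x i t \<equiv> x + t *\<^sub>R axis i 1"

abbreviation (input) freq :: "int^2 \<Rightarrow> real" where
  "freq k \<equiv> norm (int_vec k)"

lemma proj_torus_eq_iff: "proj_torus x = proj_torus y \<longleftrightarrow> (\<exists>n. x - y = int_vec n)"
  by (rule torus.abs_eq_iff)

lemma proj_torus_surj: "\<exists>x. proj_torus x = s"
  by (rule torus.abs_induct) blast

lemma proj_torus_add_int: "proj_torus (x + int_vec n) = proj_torus x"
  by (auto simp: proj_torus_eq_iff)

lemma proj_torus_add_axis: "proj_torus (x + (t + 1) *\<^sub>R axis i 1) = proj_torus (shift x i t)"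
proof -
  have "x + (t + 1) *\<^sub>R axis i 1 - (shift x i t) = int_vec (axis i 1)"
    by (simp add: int_vec_def vec_eq_iff axis_def algebra_simps)
  then show ?thesis by (auto simp: proj_torus_eq_iff)
qed

lemma continuous_on_torus_iff:
  fixes h :: "torus \<Rightarrow> 'b::topological_space"
  shows "continuous_on UNIV h \<longleftrightarrow> continuous_on UNIV (h \<circ> proj_torus)"
  by (simp add: continuous_on_open_vimage open_torus_def vimage_comp o_def)

lemma proj_torus_cbox: "\<exists>x. proj_torus x = s \<and> (\<forall>i. 0 \<le> x $ i \<and> x $ i < 1)"
proof -
  obtain y where y: "proj_torus y = s" using proj_torus_surj by blast
  let ?x = "\<chi> i. frac (y $ i)"
  have "y - ?x = int_vec (\<chi> i. \<lfloor>y $ i\<rfloor>)" by (simp add: vec_eq_iff int_vec_def frac_def)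
  then have "proj_torus y = proj_torus ?x" unfolding proj_torus_eq_iff by blast
  then have "proj_torus ?x = s" using y by simp
  then show ?thesis by (intro exI[of _ ?x]) (simp add: frac_lt_1)
qed

lemma torus_continuous_bounded:
  fixes h :: "torus \<Rightarrow> 'b::real_normed_vector"
  assumes "continuous_on UNIV h"
  shows "\<exists>B. \<forall>x. norm (h x) \<le> B"
proof -
  have "continuous_on (cbox 0 1) (h \<circ> proj_torus)"
    using assms continuous_on_torus_iff continuous_on_subset by blast
  then have "bounded ((h \<circ> proj_torus) ` cbox 0 1)"
    by (intro compact_imp_bounded compact_continuous_image) auto
  then obtain B where B: "\<And>x. x \<in> cbox 0 1 \<Longrightarrow> norm (h (proj_torus x)) \<le> B"
    unfolding bounded_iff by auto
  have "norm (h s) \<le> B" for s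
  proof -
    obtain x where "proj_torus x = s" "\<forall>i. 0 \<le> x $ i \<and> x $ i < 1" using proj_torus_cbox by blast
    then show ?thesis using B[of x] by (auto simp: mem_box_cart less_imp_le)
  qed
  then show ?thesis by blast
qed

lemma sets_torus_measure [simp, measurable_cong]: "sets torus_measure = sets borel"
  by (simp add: torus_measure_def)

lemma space_torus_measure [simp]: "space torus_measure = UNIV"
  by (simp add: torus_measure_def)

lemma borel_measurable_torus: 
  fixes h :: "torus \<Rightarrow> 'b::topological_space"
  shows "continuous_on UNIV h \<Longrightarrow> h \<in> borel_measurable torus_measure"
  by (subst measurable_cong_sets[OF sets_torus_measure refl]) (rule borel_measurable_continuous_onI)

section \<open>The torus measure as an image of a product measure, and Fubini along coordinate
  lines\<close>

definition vec2 :: "real \<times> real \<Rightarrow> real^2" where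
  "vec2 p = (\<chi> i. if i = 1 then fst p else snd p)"

lemma vec2_nth: "vec2 p $ 1 = fst p" "vec2 p $ 2 = snd p"
  by (simp_all add: vec2_def)

lemma continuous_vec2: "continuous_on UNIV vec2"
proof -
  have "continuous_on UNIV (\<lambda>p::real \<times> real. if i = (1::2) then fst p else snd p)" for i
    by (cases "i = 1") (auto intro!: continuous_intros)
  then show ?thesis unfolding vec2_def by (intro continuous_on_vec_lambda)
qed

lemma distr_vec2: "distr (lborel \<Otimes>\<^sub>M lborel) borel vec2 = lborel"
proof (rule lborel_eqI[symmetric])
  fix l u :: "real^2" assume lu: "\<And>b. b \<in> Basis \<Longrightarrow> l \<bullet> b \<le> u \<bullet> b"
  have le: "l $ i \<le> u $ i" for i using lu[of "axis i 1"] by (auto simp: inner_axis)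
  have m: "vec2 \<in> borel_measurable (lborel \<Otimes>\<^sub>M lborel)"
    unfolding lborel_prod using borel_measurable_continuous_onI[OF continuous_vec2] by simp
  have v: "vec2 -` box l u = box (l $ 1) (u $ 1) \<times> box (l $ 2) (u $ 2)"
    by (auto simp: mem_box_cart vec2_nth forall_2 box_real)
  have "emeasure (distr (lborel \<Otimes>\<^sub>M lborel) borel vec2) (box l u) = emeasure (lborel \<Otimes>\<^sub>M lborel) (box (l $ 1) (u $ 1) \<times> box (l $ 2) (u $ 2))"
    using m by (subst emeasure_distr) (auto simp: v space_pair_measure)
  also have "\<dots> = ennreal ((u $ 1 - l $ 1) * (u $ 2 - l $ 2))"
    using le by (subst lborel.emeasure_pair_measure_Times) (auto simp: ennreal_mult box_real)
  also have "(u $ 1 - l $ 1) * (u $ 2 - l $ 2) = (\<Prod>b\<in>Basis. (u - l) \<bullet> b)"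
  proof -
    have B: "(Basis :: (real^2) set) = (\<lambda>i. axis i 1) ` UNIV" by (auto simp: Basis_vec_def)
    have "inj (\<lambda>i. axis i 1 :: real^2)" by (auto simp: inj_def axis_eq_axis)
    then have "(\<Prod>b\<in>Basis. (u - l) \<bullet> b) = (\<Prod>i\<in>UNIV. (u - l) \<bullet> axis i 1)"
      unfolding B by (subst prod.reindex) auto
    also have "\<dots> = (u $ 1 - l $ 1) * (u $ 2 - l $ 2)" by (simp add: UNIV_2 inner_axis)
    finally show ?thesis by simp
  qed
  finally show "emeasure (distr (lborel \<Otimes>\<^sub>M lborel) borel vec2) (box l u) = ennreal (\<Prod>b\<in>Basis. (u - l) \<bullet> b)" .
qed simp


abbreviation unit_interval :: "real measure" where
  "unit_interval \<equiv> restrict_space lborel {0..<1}"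

abbreviation unit_square :: "(real \<times> real) measure" where
  "unit_square \<equiv> unit_interval \<Otimes>\<^sub>M unit_interval"


lemma prob_space_unit_interval: "prob_space unit_interval"
  by (rule prob_spaceI) (simp add: emeasure_restrict_space space_restrict_space)

lemma measurable_vec2: "vec2 \<in> borel_measurable unit_square"
proof -
  have i: "(\<lambda>x. x) \<in> borel_measurable unit_interval" by (auto intro: measurable_restrict_space1)
  have "(\<lambda>p. (fst p, snd p)) \<in> unit_square \<rightarrow>\<^sub>M borel \<Otimes>\<^sub>M borel"
    by (intro measurable_Pair measurable_compose[OF measurable_fst i] measurable_compose[OF measurable_snd i])
  then have "(\<lambda>p. vec2 (fst p, snd p)) \<in> borel_measurable unit_square"
    unfolding borel_prod
    by (rule measurable_compose) (rule borel_measurable_continuous_onI[OF continuous_vec2])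
  then show ?thesis by simp
qed

text \<open>Both sides are computed by slices: over a first coordinate outside [0, 1) the slice is
  empty on one side and carries the factor 0 on the other. Half-open intervals match the fundamental
  domain in \<open>torus_measure\<close>.\<close>

lemma torus_measure_eq_distr:
  "torus_measure = distr unit_square borel (\<lambda>p. proj_torus (vec2 p))"
proof (rule measure_eqI)
  interpret I: prob_space unit_interval by (rule prob_space_unit_interval)
  have mp: "proj_torus \<in> borel_measurable borel" 
    by (rule borel_measurable_continuous_onI[OF continuous_proj_torus])
  have mv: "vec2 \<in> borel_measurable (lborel \<Otimes>\<^sub>M lborel)"
    unfolding lborel_prod using borel_measurable_continuous_onI[OF continuous_vec2] by simp
  let ?Q = "{x :: real^2. \<forall>i. 0 \<le> x $ i \<and> x $ i < 1}"
  have Q: "?Q \<in> sets borel" by measurable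
  fix A assume "A \<in> sets torus_measure"
  then have A: "A \<in> sets borel" by simp
  let ?B = "proj_torus -` A"
  have B: "?B \<in> sets borel" using measurable_sets[OF mp A] by simp
  let ?S = "vec2 -` ?B \<inter> space unit_square"
  have S: "?S \<in> sets unit_square" by (rule measurable_sets[OF measurable_vec2 B])
  have S': "vec2 -` (?B \<inter> ?Q) \<in> sets (lborel \<Otimes>\<^sub>M lborel)"
    using measurable_sets[OF mv, of "?B \<inter> ?Q"] B Q by (simp add: space_pair_measure)
  have "emeasure torus_measure A = emeasure lborel (?B \<inter> ?Q)"
  proof -
    have "proj_torus \<in> borel_measurable (restrict_space lborel ?Q)"
      using mp by (intro measurable_restrict_space1) simp
    then show ?thesis unfolding torus_measure_def
      using A Q by (subst emeasure_distr) (auto simp: space_restrict_space emeasure_restrict_space)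
  qed
  also have "\<dots> = emeasure (distr (lborel \<Otimes>\<^sub>M lborel) borel vec2) (?B \<inter> ?Q)" by (simp add: distr_vec2)
  also have "\<dots> = emeasure (lborel \<Otimes>\<^sub>M lborel) (vec2 -` (?B \<inter> ?Q))"
    using mv B Q by (subst emeasure_distr) (auto simp: space_pair_measure)
  also have "\<dots> = (\<integral>\<^sup>+ x. emeasure lborel (Pair x -` (vec2 -` (?B \<inter> ?Q))) \<partial>lborel)"
    by (rule lborel.emeasure_pair_measure_alt[OF S'])
  also have "\<dots> = (\<integral>\<^sup>+ x. emeasure unit_interval (Pair x -` ?S) * indicator {0..<1} x \<partial>lborel)"
  proof (rule nn_integral_cong)
    fix x :: real
    show "emeasure lborel (Pair x -` (vec2 -` (?B \<inter> ?Q))) = emeasure unit_interval (Pair x -` ?S) * indicator {0..<1} x"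
    proof (cases "x \<in> {0..<1}")
      case True
      have "Pair x -` ?S = Pair x -` (vec2 -` (?B \<inter> ?Q))"
        using True by (auto simp: space_pair_measure forall_2 vec2_nth space_restrict_space)
      moreover have "Pair x -` ?S \<subseteq> {0..<1}"
        by (auto simp: space_pair_measure space_restrict_space)
      ultimately show ?thesis using True
        by (subst emeasure_restrict_space) auto
    next
      case False
      then have "Pair x -` (vec2 -` (?B \<inter> ?Q)) = {}" by (auto simp: forall_2 vec2_nth)
      then show ?thesis using False by simp
    qed
  qed
  also have "\<dots> = (\<integral>\<^sup>+ x. emeasure unit_interval (Pair x -` ?S) \<partial>unit_interval)"
    by (subst nn_integral_restrict_space) auto
  also have "\<dots> = emeasure unit_square ?S"
    by (rule I.emeasure_pair_measure_alt[OF S, symmetric])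
  also have "\<dots> = emeasure (distr unit_square borel (\<lambda>p. proj_torus (vec2 p))) A"
    using A measurable_compose[OF measurable_vec2 mp]
    by (subst emeasure_distr) (auto intro!: arg_cong[where f = "emeasure _"])
  finally show "emeasure torus_measure A = emeasure (distr unit_square borel (\<lambda>p. proj_torus (vec2 p))) A" .
qed simp

lemma prob_space_torus_measure: "prob_space torus_measure"
proof -
  interpret I: prob_space unit_interval by (rule prob_space_unit_interval)
  interpret II: pair_prob_space unit_interval unit_interval ..
  show ?thesis unfolding torus_measure_eq_distr
    by (rule II.prob_space_distr)
      (rule measurable_compose[OF measurable_vec2 borel_measurable_continuous_onI[OF continuous_proj_torus]])
qed

lemma integrable_torus_continuous:
  fixes h :: "torus \<Rightarrow> 'b::{banach, second_countable_topology}"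
  assumes "continuous_on UNIV h"
  shows "integrable torus_measure h"
proof -
  interpret prob_space torus_measure by (rule prob_space_torus_measure)
  obtain B where "\<And>x. norm (h x) \<le> B" using torus_continuous_bounded[OF assms] by blast
  then show ?thesis
    by (intro integrable_const_bound[where B = B] borel_measurable_torus assms) auto
qed

text \<open>Links the Bochner integral, to which Fubini applies, with the gauge integral, to which
  the fundamental theorem of calculus applies; the end point 1 is a null set.\<close>

lemma unit_interval_integral:
  fixes g :: "real \<Rightarrow> complex"
  assumes "continuous_on UNIV g"
  shows "(LINT t|unit_interval. g t) = integral {0..1} g"
proof -
  have g: "continuous_on {0..1} g" using assms continuous_on_subset by blast
  have "(LINT t|unit_interval. g t) = (LINT t:{0..<1}|lborel. g t)"
    by (simp add: set_integral_restrict_space set_lebesgue_integral_def integral_restrict_space)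
  also have "\<dots> = (LINT t:{0..1}|lborel. g t)"
  proof (rule set_integral_cong_set)
    have "set_borel_measurable lborel {0..1} g"
      unfolding set_borel_measurable_def using borel_measurable_continuous_onI[OF assms] by simp
    moreover have "set_borel_measurable lborel {0..<1} g"
      unfolding set_borel_measurable_def using borel_measurable_continuous_onI[OF assms] by simp
    ultimately show "set_borel_measurable lborel {0..1} g" "set_borel_measurable lborel {0..<1} g" .
    show "AE x in lborel. (x \<in> {0..1}) = (x \<in> {0..<1::real})"
      using AE_lborel_singleton[of "1::real"] by eventually_elim auto
  qed
  also have "\<dots> = integral {0..1} g"
    by (rule set_borel_integral_eq_integral(2)) (rule borel_integrable_atLeastAtMost', rule g)
  finally show ?thesis .
qed

text \<open>Fubini reduces the integral to lines in direction \<open>i\<close>, and averaging over a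
  probability measure preserves the bound. The axis is left free, so that it can be chosen where the
  phase moves fast.\<close>

lemma torus_integral_bound:
  fixes h :: "torus \<Rightarrow> complex"
  assumes h: "continuous_on UNIV h"
    and B: "\<And>x. cmod (integral {0..1} (\<lambda>t. h (proj_torus (shift x i t)))) \<le> B"
  shows "cmod (LINT x|torus_measure. h x) \<le> B"
proof -
  interpret I: prob_space unit_interval by (rule prob_space_unit_interval)
  interpret II: pair_prob_space unit_interval unit_interval ..
  have c: "continuous_on UNIV (\<lambda>x. h (proj_torus x))"
    using h by (simp add: continuous_on_torus_iff o_def)
  obtain C where C: "\<And>x. norm (h x) \<le> C" using torus_continuous_bounded[OF h] by blast
  have m: "(\<lambda>p. h (proj_torus (vec2 p))) \<in> borel_measurable unit_square"
    by (rule measurable_compose[OF measurable_vec2 borel_measurable_continuous_onI[OF c]])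
  have int: "integrable unit_square (\<lambda>(s, t). h (proj_torus (vec2 (s, t))))"
  proof (rule II.integrable_const_bound[where B = C])
    show "AE p in unit_square. norm (case p of (s, t) \<Rightarrow> h (proj_torus (vec2 (s, t)))) \<le> C"
      using C by (auto simp: split_beta)
  qed (use m in \<open>simp add: split_beta\<close>)
  have eq: "(LINT x|torus_measure. h x) = (LINT p|unit_square. h (proj_torus (vec2 p)))"
    unfolding torus_measure_eq_distr
    by (rule integral_distr[OF measurable_compose[OF measurable_vec2
          borel_measurable_continuous_onI[OF continuous_proj_torus]] borel_measurable_continuous_onI[OF h]])
  have B': "cmod (LINT t|unit_interval. h (proj_torus (shift x i t))) \<le> B" for x
  proof -
    have "continuous_on UNIV (\<lambda>t. h (proj_torus (shift x i t)))"
      by (rule continuous_on_compose2[OF c]) (auto intro!: continuous_intros)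
    then show ?thesis using B[of x] by (simp add: unit_interval_integral)
  qed
  \<comment> \<open>Covers the partial integral without a proof that it is integrable: otherwise its
    Bochner integral is 0, and \<open>B\<close> is nonnegative.\<close>
  have bound: "cmod (LINT s|unit_interval. H s) \<le> B" if "\<And>s. cmod (H s) \<le> B" for H :: "real \<Rightarrow> complex"
  proof (cases "integrable unit_interval H")
    case True
    have "cmod (LINT s|unit_interval. H s) \<le> (LINT s|unit_interval. cmod (H s))"
      by (rule integral_norm_bound)
    also have "\<dots> \<le> B" using True that by (intro I.integral_le_const) simp_all
    finally show ?thesis .
  next
    case False
    then show ?thesis using order_trans[OF norm_ge_zero that] by (simp add: not_integrable_integral_eq)
  qed
  consider "i = 1" | "i = 2" using exhaust_2 by blast
  then show ?thesis
  proof cases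
    case 1
    have "(LINT x|torus_measure. h x) = (LINT t|unit_interval. (LINT s|unit_interval. h (proj_torus (vec2 (s, t)))))"
      using II.integral_snd[OF int] by (simp add: eq split_beta')
    moreover define w where "w t = vec2 (0, t)" for t
    have "vec2 (s, t) = w t + s *\<^sub>R axis i 1" for s t
      by (simp add: vec_eq_iff forall_2 vec2_def axis_def w_def 1)
    ultimately show ?thesis using bound[OF B'] by simp
  next
    case 2
    have "(LINT x|torus_measure. h x) = (LINT s|unit_interval. (LINT t|unit_interval. h (proj_torus (vec2 (s, t)))))"
      using II.integral_fst[OF int] by (simp add: eq split_beta')
    moreover define w where "w s = vec2 (s, 0)" for s
    have "vec2 (s, t) = w s + t *\<^sub>R axis i 1" for s t
      by (simp add: vec_eq_iff forall_2 vec2_def axis_def w_def 2)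
    ultimately show ?thesis using bound[OF B'] by simp
  qed
qed

subsection \<open>Fourier coefficients and transfer operators\<close>

lemma torus_char_proj: "torus_char k (proj_torus x) = cis (2 * pi * (int_vec k \<bullet> x))"
  by (rule torus_char.abs_eq)

lemma continuous_torus_char: "continuous_on UNIV (torus_char k)"
  unfolding continuous_on_torus_iff o_def torus_char_proj cis_conv_exp
  by (intro continuous_intros)

lemma norm_torus_char [simp]: "cmod (torus_char k s) = 1"
  using proj_torus_surj[of s] by (auto simp: torus_char_proj)

lemma int_vec_axis: "int_vec k \<bullet> axis i 1 = k $ i"
  by (simp add: inner_axis int_vec_def)

lemma norm_integral_le_torus:
  fixes h :: "torus \<Rightarrow> complex"
  assumes "continuous_on UNIV h" "\<And>x. cmod (h x) \<le> B"
  shows "cmod (LINT x|torus_measure. h x) \<le> B"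
proof -
  interpret prob_space torus_measure by (rule prob_space_torus_measure)
  have "cmod (LINT x|torus_measure. h x) \<le> (LINT x|torus_measure. cmod (h x))"
    by (rule integral_norm_bound)
  also have "\<dots> \<le> B"
    using assms by (intro integral_le_const integrable_norm integrable_torus_continuous) simp_all
  finally show ?thesis .
qed

lemma has_vector_derivative_cis:
  assumes "(\<theta> has_vector_derivative d) (at t)"
  shows "((\<lambda>t. cis (\<theta> t)) has_vector_derivative (\<i> * complex_of_real d * cis (\<theta> t))) (at t)"
proof -
  have "((\<lambda>t. \<i> * complex_of_real (\<theta> t)) has_vector_derivative (\<i> * complex_of_real d)) (at t)"
    by (intro has_vector_derivative_mult_right has_vector_derivative_of_real
        assms[folded has_real_derivative_iff_has_vector_derivative])
  then have "(exp \<circ> (\<lambda>t. \<i> * complex_of_real (\<theta> t)) has_vector_derivative (\<i> * complex_of_real d * exp (\<i> * complex_of_real (\<theta> t)))) (at t)"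
    by (rule field_vector_diff_chain_at) (rule DERIV_exp)
  then show ?thesis by (simp add: o_def cis_conv_exp)
qed

lemma cmod_diff_squared: "(cmod (z - w))\<^sup>2 = (cmod z)\<^sup>2 + (cmod w)\<^sup>2 - 2 * Re (z * cnj w)"
  unfolding cmod_power2 by (simp add: power2_eq_square algebra_simps)

text \<open>Off the diagonal the product is a pure oscillation along an axis where \<open>j\<close>
  and \<open>k\<close> differ, so the first-order estimate with zero perturbation gives the bound
  0.\<close>

lemma torus_char_orthonormal:
  "(LINT x|torus_measure. torus_char j x * cnj (torus_char k x)) = of_bool (j = k)"
proof (cases "j = k")
  case True
  interpret prob_space torus_measure by (rule prob_space_torus_measure)
  have "torus_char k x * cnj (torus_char k x) = 1" for x
    by (simp add: complex_norm_square[symmetric])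
  then show ?thesis using True prob_space by simp
next
  case False
  then obtain i where i: "j $ i \<noteq> k $ i" by (auto simp: vec_eq_iff)
  have "cmod (LINT x|torus_measure. torus_char j x * cnj (torus_char k x)) \<le> 0"
  proof (rule torus_integral_bound)
    show "continuous_on UNIV (\<lambda>x. torus_char j x * cnj (torus_char k x))"
      by (intro continuous_intros continuous_torus_char)
    fix x :: "real^2"
    define E where "E t = torus_char j (proj_torus (shift x i t)) * cnj (torus_char k (proj_torus (shift x i t)))" for t
    have E: "E t = cis (2 * pi * (int_vec j \<bullet> x - int_vec k \<bullet> x) + 2 * pi * (j $ i - k $ i) * t)" for t
      unfolding E_def torus_char_proj by (simp add: cis_cnj cis_mult int_vec_axis algebra_simps)
    show "cmod (integral {0..1} (\<lambda>t. torus_char j (proj_torus (shift x i t)) *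
          cnj (torus_char k (proj_torus (shift x i t))))) \<le> 0"
      unfolding E_def[symmetric]
    proof (rule nonstationary_phase_first_order[where \<rho> = "\<lambda>_. 0" and a = "2 * pi * \<i> * (j $ i - k $ i)"])
      show "(E has_vector_derivative 2 * pi * \<i> * (j $ i - k $ i) * (1 + 0) * E t) (at t)" for t
        unfolding E[abs_def]
        by (rule has_vector_derivative_cis[THEN has_vector_derivative_eq_rhs])
          (auto intro!: derivative_eq_intros)
      show "cmod (E t) \<le> 1" for t by (simp add: E_def norm_mult)
      show "E 1 = E 0" unfolding E_def using proj_torus_add_axis[of x 0 i] by simp
    qed (use i in auto)
  qed
  then show ?thesis using False by simp
qed

lemma fourier_coeff_torus_char: "fourier_coeff (torus_char j) k = of_bool (j = k)"
  by (simp add: fourier_coeff_def torus_char_orthonormal)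

lemma integrable_fourier:
  "continuous_on UNIV h \<Longrightarrow> integrable torus_measure (\<lambda>x. h x * cnj (torus_char k x))"
  by (intro integrable_torus_continuous continuous_intros continuous_torus_char)

lemma fourier_coeff_sum:
  assumes "\<And>j. j \<in> J \<Longrightarrow> continuous_on UNIV (u j)"
  shows "fourier_coeff (\<lambda>x. \<Sum>j\<in>J. c j * u j x) k = (\<Sum>j\<in>J. c j * fourier_coeff (u j) k)"
  using assms unfolding fourier_coeff_def sum_distrib_right
  by (subst Bochner_Integration.integral_sum) (auto intro!: integrable_fourier simp: mult.assoc)

lemma fourier_coeff_diff:
  assumes "continuous_on UNIV u" "continuous_on UNIV v"
  shows "fourier_coeff (\<lambda>x. u x - v x) k = fourier_coeff u k - fourier_coeff v k"
  using integrable_fourier[OF assms(1)] integrable_fourier[OF assms(2)]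
  by (simp add: fourier_coeff_def left_diff_distrib)

lemma cmod_fourier_coeff_le:
  assumes "continuous_on UNIV h" "\<And>x. cmod (h x) \<le> B"
  shows "cmod (fourier_coeff h k) \<le> B"
  unfolding fourier_coeff_def
  by (rule norm_integral_le_torus) (auto intro!: continuous_intros continuous_torus_char assms simp: norm_mult)

lemma parseval_finite:
  assumes "finite J"
  shows "(LINT x|torus_measure. (cmod (\<Sum>j\<in>J. c j * torus_char j x))\<^sup>2) = (\<Sum>j\<in>J. (cmod (c j))\<^sup>2)"
proof -
  let ?P = "\<lambda>x. \<Sum>j\<in>J. c j * torus_char j x"
  have P: "continuous_on UNIV ?P" by (intro continuous_intros continuous_torus_char)
  have "(LINT x|torus_measure. complex_of_real ((cmod (?P x))\<^sup>2)) = (LINT x|torus_measure. (\<Sum>k\<in>J. cnj (c k) * (?P x * cnj (torus_char k x))))"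
    by (intro Bochner_Integration.integral_cong refl)
      (simp only: complex_norm_square cnj_sum sum_distrib_left complex_cnj_mult mult_ac)
  also have "\<dots> = (\<Sum>k\<in>J. cnj (c k) * fourier_coeff ?P k)"
    unfolding fourier_coeff_def
    by (subst Bochner_Integration.integral_sum)
      (auto intro!: integrable_mult_right integrable_fourier P)
  also have "\<dots> = (\<Sum>k\<in>J. complex_of_real ((cmod (c k))\<^sup>2))"
    using assms by (intro sum.cong refl)
      (simp only: complex_norm_square, simp add: fourier_coeff_sum continuous_torus_char fourier_coeff_torus_char)
  finally have "complex_of_real (LINT x|torus_measure. (cmod (?P x))\<^sup>2) = complex_of_real (\<Sum>k\<in>J. (cmod (c k))\<^sup>2)"
    unfolding integral_complex_of_real of_real_sum .
  then show ?thesis unfolding of_real_eq_iff .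
qed

lemma bessel_inequality:
  assumes "finite K" and u: "continuous_on UNIV u"
  shows "(\<Sum>k\<in>K. (cmod (fourier_coeff u k))\<^sup>2) \<le> (LINT x|torus_measure. (cmod (u x))\<^sup>2)"
proof -
  let ?P = "\<lambda>x. \<Sum>k\<in>K. fourier_coeff u k * torus_char k x"
  let ?S = "\<Sum>k\<in>K. (cmod (fourier_coeff u k))\<^sup>2"
  have P: "continuous_on UNIV ?P" by (intro continuous_intros continuous_torus_char)
  have uP: "(LINT x|torus_measure. u x * cnj (?P x)) = ?S"
  proof -
    have "(LINT x|torus_measure. u x * cnj (?P x)) = (LINT x|torus_measure. (\<Sum>k\<in>K. cnj (fourier_coeff u k) * (u x * cnj (torus_char k x))))"
      by (intro Bochner_Integration.integral_cong refl)
        (simp add: cnj_sum sum_distrib_left mult_ac)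
    also have "\<dots> = (\<Sum>k\<in>K. cnj (fourier_coeff u k) * fourier_coeff u k)"
      by (subst Bochner_Integration.integral_sum)
        (auto intro!: integrable_mult_right integrable_fourier u simp: fourier_coeff_def)
    also have "\<dots> = complex_of_real ?S"
      by (simp add: complex_norm_square[symmetric] mult.commute)
    finally show ?thesis .
  qed
  define Q where "Q = ?P"
  have cQ: "continuous_on UNIV Q" unfolding Q_def by (rule P)
  have i: "integrable torus_measure (\<lambda>x. (cmod (u x))\<^sup>2)" "integrable torus_measure (\<lambda>x. (cmod (Q x))\<^sup>2)"
      "integrable torus_measure (\<lambda>x. u x * cnj (Q x))"
    by (intro integrable_torus_continuous continuous_intros cQ u)+
  then have i': "integrable torus_measure (\<lambda>x. Re (u x * cnj (Q x)))"
    by (intro integrable_Re)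
  have "0 \<le> (LINT x|torus_measure. (cmod (u x - Q x))\<^sup>2)" by simp
  also have "\<dots> = (LINT x|torus_measure. (cmod (u x))\<^sup>2 + (cmod (Q x))\<^sup>2 - 2 * Re (u x * cnj (Q x)))"
    by (intro Bochner_Integration.integral_cong refl) (rule cmod_diff_squared)
  also have "\<dots> = (LINT x|torus_measure. (cmod (u x))\<^sup>2) + (LINT x|torus_measure. (cmod (Q x))\<^sup>2)
      - 2 * (LINT x|torus_measure. Re (u x * cnj (Q x)))"
    using i i' by (simp only: Bochner_Integration.integral_diff Bochner_Integration.integral_add
        integral_mult_right_zero Bochner_Integration.integrable_add integrable_mult_right)
  also have "(LINT x|torus_measure. Re (u x * cnj (Q x))) = ?S"
    using integral_Re[OF i(3)] uP unfolding Q_def by simp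
  also have "(LINT x|torus_measure. (cmod (Q x))\<^sup>2) = ?S"
    unfolding Q_def by (rule parseval_finite[OF assms(1)])
  finally show ?thesis by simp
qed

section \<open>Volume-preserving homeomorphisms and their transfer matrices\<close>

definition volume_homeo :: "(torus \<Rightarrow> torus) \<Rightarrow> bool" where
  "volume_homeo f \<longleftrightarrow> bij f \<and> continuous_on UNIV f \<and> continuous_on UNIV (inv f) \<and> volume_preserving f"

lemma integral_volume_preserving:
  fixes h :: "torus \<Rightarrow> 'b::{banach, second_countable_topology}"
  assumes "volume_preserving f" "continuous_on UNIV h"
  shows "(LINT x|torus_measure. h (f x)) = (LINT x|torus_measure. h x)"
proof -
  have f: "f \<in> torus_measure \<rightarrow>\<^sub>M torus_measure" and d: "distr torus_measure torus_measure f = torus_measure"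
    using assms(1) by (auto simp: volume_preserving_def)
  have "(LINT x|torus_measure. h x) = (LINT x|distr torus_measure torus_measure f. h x)" by (simp add: d)
  also have "\<dots> = (LINT x|torus_measure. h (f x))"
    by (rule integral_distr[OF f borel_measurable_torus[OF assms(2)]])
  finally show ?thesis by simp
qed

text \<open>The change of variable by \<open>f\<close> moves the map from \<open>h\<close> to the
  character. Hence the phase contains derivatives of \<open>f\<close> and never those of its
  inverse.\<close>

lemma fourier_coeff_transfer:
  assumes f: "volume_homeo f" and h: "continuous_on UNIV h"
  shows "fourier_coeff (transfer_op f h) k = (LINT x|torus_measure. h x * cnj (torus_char k (f x)))"
proof -
  have "continuous_on UNIV (\<lambda>x. h (inv f x) * cnj (torus_char k x))"
    using f by (auto intro!: continuous_intros continuous_torus_char continuous_on_compose2[OF h] simp: volume_homeo_def)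
  from integral_volume_preserving[OF _ this, of f] f show ?thesis
    by (simp add: fourier_coeff_def transfer_op_def volume_homeo_def bij_is_inj)
qed

lemma continuous_transfer_op:
  assumes f: "volume_homeo f" and h: "continuous_on UNIV h"
  shows "continuous_on UNIV (transfer_op f h)"
  using f by (auto intro!: continuous_on_compose2[OF h] simp: volume_homeo_def transfer_op_def o_def)

definition transfer_coeff :: "(torus \<Rightarrow> torus) \<Rightarrow> int^2 \<Rightarrow> int^2 \<Rightarrow> complex" where
  "transfer_coeff f k j = fourier_coeff (transfer_op f (torus_char j)) k"

text \<open>Composition with a volume-preserving bijection is an isometry of L2, so Bessel's
  inequality for the image combines with Parseval's identity for the trigonometric
  polynomial.\<close>

lemma transfer_coeff_bessel_finite:
  assumes f: "volume_homeo f" and "finite K" "finite J"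
  shows "(\<Sum>k\<in>K. (cmod (\<Sum>j\<in>J. c j * transfer_coeff f k j))\<^sup>2) \<le> (\<Sum>j\<in>J. (cmod (c j))\<^sup>2)"
proof -
  let ?P = "\<lambda>x. \<Sum>j\<in>J. c j * torus_char j x"
  let ?u = "\<lambda>x. \<Sum>j\<in>J. c j * transfer_op f (torus_char j) x"
  have cu: "continuous_on UNIV ?u"
    by (intro continuous_intros continuous_transfer_op f continuous_torus_char)
  have "(\<Sum>k\<in>K. (cmod (\<Sum>j\<in>J. c j * transfer_coeff f k j))\<^sup>2) = (\<Sum>k\<in>K. (cmod (fourier_coeff ?u k))\<^sup>2)"
    by (simp add: fourier_coeff_sum continuous_transfer_op f continuous_torus_char transfer_coeff_def)
  also have "\<dots> \<le> (LINT x|torus_measure. (cmod (?u x))\<^sup>2)"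
    by (rule bessel_inequality[OF assms(2) cu])
  also have "\<dots> = (LINT x|torus_measure. (cmod (?u (f x)))\<^sup>2)"
    using f by (intro integral_volume_preserving[symmetric] continuous_intros cu) (simp add: volume_homeo_def)
  also have "\<dots> = (LINT x|torus_measure. (cmod (?P x))\<^sup>2)"
    using f by (simp add: transfer_op_def volume_homeo_def bij_is_inj)
  also have "\<dots> = (\<Sum>j\<in>J. (cmod (c j))\<^sup>2)" by (rule parseval_finite[OF assms(3)])
  finally show ?thesis .
qed

text \<open>The series converges uniformly by the Weierstrass test, and a coefficient is bounded by
  the sup norm, so coefficients may be taken termwise. General functions \<open>u j\<close> cover
  both the characters and their compositions with \<open>inv f\<close>.\<close>

lemma continuous_fourier_infsum:
  fixes u :: "'i \<Rightarrow> torus \<Rightarrow> complex"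
  assumes u: "\<And>j. continuous_on UNIV (u j)" "\<And>j x. cmod (u j x) \<le> 1"
    and c: "(\<lambda>j. cmod (c j)) summable_on UNIV"
  shows "continuous_on UNIV (\<lambda>x. \<Sum>\<^sub>\<infinity>j. c j * u j x)"
    and "((\<lambda>j. c j * fourier_coeff (u j) k) has_sum fourier_coeff (\<lambda>x. \<Sum>\<^sub>\<infinity>j. c j * u j x) k) UNIV"
proof -
  let ?s = "\<lambda>x. \<Sum>\<^sub>\<infinity>j. c j * u j x"
  have lim: "uniform_limit UNIV (\<lambda>J x. \<Sum>j\<in>J. c j * u j x) ?s (finite_subsets_at_top UNIV)"
  proof (rule Weierstrass_m_test_general[OF _ c])
    show "norm (c j * u j x) \<le> cmod (c j)" for j x
      using mult_left_mono[OF u(2)[of j x], of "cmod (c j)"] by (simp add: norm_mult)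
  qed
  have cJ: "continuous_on UNIV (\<lambda>x. \<Sum>j\<in>J. c j * u j x)" for J
    by (intro continuous_intros u)
  show cs: "continuous_on UNIV ?s"
    by (rule uniform_limit_theorem[OF _ lim]) (auto simp: cJ)
  show "((\<lambda>j. c j * fourier_coeff (u j) k) has_sum fourier_coeff ?s k) UNIV"
    unfolding has_sum_def
  proof (rule tendstoI)
    fix e :: real assume "e > 0"
    then have "\<forall>\<^sub>F J in finite_subsets_at_top UNIV. \<forall>x\<in>UNIV. dist (\<Sum>j\<in>J. c j * u j x) (?s x) < e / 2"
      using uniform_limitD[OF lim, of "e / 2"] by simp
    then show "\<forall>\<^sub>F J in finite_subsets_at_top UNIV. dist (\<Sum>j\<in>J. c j * fourier_coeff (u j) k) (fourier_coeff ?s k) < e"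
    proof eventually_elim
      case (elim J)
      have "(\<Sum>j\<in>J. c j * fourier_coeff (u j) k) - fourier_coeff ?s k = fourier_coeff (\<lambda>x. (\<Sum>j\<in>J. c j * u j x) - ?s x) k"
        by (simp add: fourier_coeff_diff cJ cs fourier_coeff_sum u)
      also have "cmod \<dots> \<le> e / 2"
        using elim by (intro cmod_fourier_coeff_le continuous_on_diff cJ cs) (auto simp: dist_norm less_imp_le)
      finally show ?case using \<open>e > 0\<close> by (simp add: dist_norm)
    qed
  qed
qed

text \<open>A limit over finite sets of columns. The columns range over an arbitrary set
  \<open>S\<close> because the weighted estimate applies this to one weight layer at a time.\<close>

lemma transfer_coeff_bessel:
  assumes f: "volume_homeo f" and c: "(\<lambda>j. cmod (c j)) summable_on UNIV"
    and c2: "(\<lambda>j. (cmod (c j))\<^sup>2) summable_on S" and K: "finite K"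
  shows "(\<Sum>k\<in>K. (cmod (\<Sum>\<^sub>\<infinity>j\<in>S. c j * transfer_coeff f k j))\<^sup>2) \<le> (\<Sum>\<^sub>\<infinity>j\<in>S. (cmod (c j))\<^sup>2)"
proof (rule tendsto_le)
  show "finite_subsets_at_top S \<noteq> bot" by simp
  have "cmod (transfer_coeff f k j) \<le> 1" for k j
    unfolding transfer_coeff_def
    by (intro cmod_fourier_coeff_le continuous_transfer_op f continuous_torus_char) (simp add: transfer_op_def)
  then have le: "norm (c j * transfer_coeff f k j) \<le> cmod (c j)" for k j
    unfolding norm_mult by (metis mult_left_le norm_ge_zero)
  have s: "(\<lambda>j. c j * transfer_coeff f k j) summable_on S" for k
    by (rule abs_summable_summable[OF Infinite_Sum.abs_summable_on_comparison_test'[OF summable_on_subset_banach[OF c subset_UNIV] le]])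
  show "((\<lambda>J. \<Sum>k\<in>K. (cmod (\<Sum>j\<in>J. c j * transfer_coeff f k j))\<^sup>2) \<longlongrightarrow>
      (\<Sum>k\<in>K. (cmod (\<Sum>\<^sub>\<infinity>j\<in>S. c j * transfer_coeff f k j))\<^sup>2)) (finite_subsets_at_top S)"
    by (intro tendsto_sum tendsto_power tendsto_norm infsum_tendsto s)
  show "((\<lambda>J. \<Sum>j\<in>J. (cmod (c j))\<^sup>2) \<longlongrightarrow> (\<Sum>\<^sub>\<infinity>j\<in>S. (cmod (c j))\<^sup>2)) (finite_subsets_at_top S)"
    by (rule infsum_tendsto[OF c2])
  show "\<forall>\<^sub>F J in finite_subsets_at_top S. (\<Sum>k\<in>K. (cmod (\<Sum>j\<in>J. c j * transfer_coeff f k j))\<^sup>2) \<le> (\<Sum>j\<in>J. (cmod (c j))\<^sup>2)"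
    by (rule eventually_finite_subsets_at_top_weakI) (rule transfer_coeff_bessel_finite[OF f K])
qed

subsection \<open>The heat semigroup\<close>

lemma summable_on_int_inverse_square: "(\<lambda>n::int. 1 / (1 + \<bar>real_of_int n\<bar>)\<^sup>2) summable_on UNIV"
proof -
  let ?f = "\<lambda>n::int. 1 / (1 + \<bar>real_of_int n\<bar>)\<^sup>2"
  let ?neg = "\<lambda>n::nat. - int n - 1"
  have s: "(\<lambda>n. 1 / (real (n + m))\<^sup>2) summable_on UNIV" for m :: nat
    using summable_ignore_initial_segment[OF inverse_power_summable[of 2, where 'a = real], of m]
    by (subst summable_on_UNIV_nonneg_real_iff) (auto simp: inverse_eq_divide)
  have "?f summable_on range int"
    using s[of 1] by (subst summable_on_reindex) (auto simp: o_def add.commute)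
  moreover have "?f summable_on range ?neg"
    using s[of 2] by (subst summable_on_reindex) (auto simp: o_def inj_def algebra_simps)
  ultimately have "?f summable_on (range int \<union> range ?neg)"
    by (rule summable_on_Un_disjoint) auto
  moreover have "range int \<union> range ?neg = UNIV"
  proof -
    have "x \<in> range int \<union> range ?neg" for x
    proof (cases "x \<ge> 0")
      case True
      then show ?thesis by (metis UnI1 nonneg_int_cases rangeI)
    next
      case False
      then have "x = ?neg (nat (- x - 1))" by simp
      then show ?thesis by blast
    qed
    then show ?thesis by blast
  qed
  ultimately show ?thesis by simp
qed

text \<open>The common majorant of all estimates over frequencies. With exponent 4 it is dominated
  by a product of one inverse square per coordinate, whence it is summable on the lattice.\<close>

definition decay :: "int^2 \<Rightarrow> real" where
  "decay k = 1 / (1 + freq k) ^ 4"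

lemma decay_pos: "decay k > 0"
  unfolding decay_def by (intro divide_pos_pos zero_less_power) (simp_all add: add_pos_nonneg)

lemma summable_decay: "decay summable_on UNIV"
proof -
  let ?f = "\<lambda>n::int. 1 / (1 + \<bar>real_of_int n\<bar>)\<^sup>2"
  have "(\<lambda>(a, b). ?f a * ?f b) summable_on UNIV \<times> UNIV"
  proof (rule summable_on_SigmaI[where g = "\<lambda>a. ?f a * (\<Sum>\<^sub>\<infinity>b. ?f b)"])
    show "((\<lambda>b. case (a, b) of (a, b) \<Rightarrow> ?f a * ?f b) has_sum ?f a * (\<Sum>\<^sub>\<infinity>b. ?f b)) UNIV" for a
      using has_sum_cmult_right[OF has_sum_infsum[OF summable_on_int_inverse_square], of "?f a"]
      unfolding prod.case .
    show "(\<lambda>a. ?f a * (\<Sum>\<^sub>\<infinity>b. ?f b)) summable_on UNIV"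
      by (intro summable_on_cmult_left summable_on_int_inverse_square)
  qed auto
  then have "(\<lambda>k::int^2. ?f (k $ 1) * ?f (k $ 2)) summable_on UNIV"
    by (subst summable_on_reindex_bij_witness[where T = "UNIV \<times> UNIV" and h = "\<lambda>(a, b). ?f a * ?f b"
          and j = "\<lambda>k. (k $ 1, k $ 2)" and i = "\<lambda>(a, b). \<chi> i. if i = 1 then a else b"])
      (auto simp: vec_eq_iff forall_2)
  then show ?thesis
  proof (rule summable_on_comparison_test)
    fix k :: "int^2"
    have "\<bar>real_of_int (k $ i)\<bar> \<le> freq k" for i
      using component_le_norm_cart[of "int_vec k" i] by (simp add: int_vec_def)
    then have "(1 + \<bar>real_of_int (k $ 1)\<bar>)\<^sup>2 * (1 + \<bar>real_of_int (k $ 2)\<bar>)\<^sup>2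
        \<le> (1 + freq k)\<^sup>2 * (1 + freq k)\<^sup>2"
      by (intro mult_mono power_mono) (auto simp: add_increasing)
    also have "\<dots> = (1 + freq k) ^ 4" by (simp flip: power_add)
    finally show "decay k \<le> ?f (k $ 1) * ?f (k $ 2)"
      unfolding decay_def times_divide_times_eq mult_1_right by (rule frac_le[rotated 3]) auto
    show "0 \<le> decay k" using decay_pos[of k] by simp
  qed
qed

lemma gaussian_polynomial_bound:
  fixes a :: real
  assumes "a > 0"
  shows "\<exists>C. \<forall>s\<ge>0. (1 + s) ^ (2 * m) * exp (- (a * s\<^sup>2)) \<le> C"
proof (intro exI allI impI)
  fix s :: real assume s: "s \<ge> 0"
  \<comment> \<open>Chosen so that the m-th power of exp (e s^2) stays below exp (a s^2); dividing
    by m + 1 covers m = 0, and the cap 1 gives e (1 + s^2) <= 1 + e s^2.\<close>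
  define e where "e = min 1 (a / (m + 1))"
  have e: "0 < e" "e \<le> 1" "m * e \<le> a"
    using assms by (auto simp: e_def min_def field_simps)
  have "(1 + s)\<^sup>2 \<le> 2 * (1 + s\<^sup>2)" using sum_squares_bound[of 1 s] by (simp add: power2_sum)
  also have "\<dots> \<le> 2 / e * exp (e * s\<^sup>2)"
  proof -
    have "e * (1 + s\<^sup>2) \<le> 1 + e * s\<^sup>2" using e by (simp add: algebra_simps)
    also have "\<dots> \<le> exp (e * s\<^sup>2)" by (rule exp_ge_add_one_self)
    finally show ?thesis using e by (simp add: field_simps)
  qed
  finally have "((1 + s)\<^sup>2) ^ m \<le> (2 / e * exp (e * s\<^sup>2)) ^ m" by (intro power_mono) auto
  then have "(1 + s) ^ (2 * m) \<le> (2 / e) ^ m * exp (m * (e * s\<^sup>2))"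
    by (simp add: power_mult power_mult_distrib power_divide exp_of_nat_mult)
  also have "\<dots> \<le> (2 / e) ^ m * exp (a * s\<^sup>2)"
    using e mult_right_mono[OF e(3), of "s\<^sup>2"] by (intro mult_left_mono) (auto simp: mult.assoc)
  finally show "(1 + s) ^ (2 * m) * exp (- (a * s\<^sup>2)) \<le> (2 / min 1 (a / (m + 1))) ^ m"
    by (simp add: exp_minus field_simps e_def)
qed

definition heat_factor :: "real \<Rightarrow> int^2 \<Rightarrow> real" where
  "heat_factor \<kappa> k = exp (- (4 * pi\<^sup>2 * (freq k)\<^sup>2 * \<kappa>))"

lemma heat_factor_nonneg: "heat_factor \<kappa> k \<ge> 0"
  by (simp add: heat_factor_def)

lemma heat_factor_le_1: "\<kappa> > 0 \<Longrightarrow> heat_factor \<kappa> k \<le> 1"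
  by (simp add: heat_factor_def)

text \<open>The constant may depend on \<kappa>. It is therefore used for summability and
  convergence only, and never reaches the final bound.\<close>

lemma heat_factor_decay:
  assumes "\<kappa> > 0"
  shows "\<exists>C\<ge>0. \<forall>k. heat_factor \<kappa> k * (1 + freq k) ^ m \<le> C * decay k"
proof -
  obtain C where C: "\<And>s. s \<ge> 0 \<Longrightarrow> (1 + s) ^ (2 * (m + 4)) * exp (- (4 * pi\<^sup>2 * \<kappa> * s\<^sup>2)) \<le> C"
    using gaussian_polynomial_bound[of "4 * pi\<^sup>2 * \<kappa>" "m + 4"] assms by auto
  have "heat_factor \<kappa> k * (1 + freq k) ^ m \<le> C * decay k" for k
  proof -
    let ?s = "freq k"
    have "heat_factor \<kappa> k * (1 + ?s) ^ m * (1 + ?s) ^ 4 \<le> heat_factor \<kappa> k * (1 + ?s) ^ (2 * (m + 4))"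
      unfolding mult.assoc power_add[symmetric]
      by (intro mult_left_mono power_increasing) (auto simp: heat_factor_nonneg)
    also have "\<dots> \<le> C" using C[of ?s] by (simp add: heat_factor_def mult_ac)
    finally have "heat_factor \<kappa> k * (1 + ?s) ^ m \<le> C / (1 + ?s) ^ 4"
      by (intro mult_imp_le_div_pos zero_less_power add_pos_nonneg) simp_all
    then show ?thesis by (simp add: decay_def)
  qed
  moreover have "C \<ge> 0" using C[of 0] by simp
  ultimately show ?thesis by blast
qed

text \<open>The coefficients of a continuous function are bounded by its sup norm; the summable heat
  factor supplies the absolute convergence.\<close>

lemma heat_continuous:
  assumes \<kappa>: "\<kappa> > 0" and h: "continuous_on UNIV h"
  shows "continuous_on UNIV (heat \<kappa> h)"
    and "fourier_coeff (heat \<kappa> h) k = heat_factor \<kappa> k * fourier_coeff h k"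
    and "(\<lambda>k. cmod (fourier_coeff (heat \<kappa> h) k)) summable_on UNIV"
    and "cmod (heat \<kappa> h x) \<le> (\<Sum>\<^sub>\<infinity>k. cmod (fourier_coeff (heat \<kappa> h) k))"
proof -
  define c where "c k = heat_factor \<kappa> k * fourier_coeff h k" for k
  obtain B where B: "\<And>x. cmod (h x) \<le> B" using torus_continuous_bounded[OF h] by blast
  obtain C where C: "\<And>k. heat_factor \<kappa> k * (1 + freq k) ^ 0 \<le> C * decay k"
    using heat_factor_decay[OF \<kappa>] by blast
  have cs: "(\<lambda>k. cmod (c k)) summable_on UNIV"
  proof (rule summable_on_comparison_test)
    show "(\<lambda>k. C * decay k * B) summable_on UNIV"
      by (intro summable_on_cmult_left summable_on_cmult_right summable_decay)
    show "cmod (c k) \<le> C * decay k * B" for k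
    proof -
      have "heat_factor \<kappa> k \<le> C * decay k" using C by simp
      moreover have ck: "cmod (fourier_coeff h k) \<le> B" by (rule cmod_fourier_coeff_le[OF h]) (rule B)
      ultimately have "heat_factor \<kappa> k * cmod (fourier_coeff h k) \<le> C * decay k * B"
        using ck heat_factor_nonneg[of \<kappa> k]
        by (intro mult_mono) auto
      then show ?thesis by (simp add: c_def norm_mult heat_factor_nonneg)
    qed
  qed simp
  have eq: "heat \<kappa> h = (\<lambda>x. \<Sum>\<^sub>\<infinity>k. c k * torus_char k x)"
    by (simp add: heat_def c_def heat_factor_def fun_eq_iff)
  show "continuous_on UNIV (heat \<kappa> h)"
    unfolding eq by (rule continuous_fourier_infsum(1)[OF continuous_torus_char _ cs]) simp
  have "((\<lambda>j. c j * of_bool (j = k)) has_sum fourier_coeff (heat \<kappa> h) k) UNIV" for k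
    using continuous_fourier_infsum(2)[OF continuous_torus_char _ cs, where k = k]
    by (simp add: eq fourier_coeff_torus_char)
  moreover have "((\<lambda>j. c j * of_bool (j = k)) has_sum c k) UNIV" for k
    using has_sum_finite_neutralI[of "{k}" UNIV "\<lambda>j. c j * of_bool (j = k)"] by auto
  ultimately have fc: "fourier_coeff (heat \<kappa> h) k = c k" for k
    by (rule has_sum_unique)
  then show "fourier_coeff (heat \<kappa> h) k = heat_factor \<kappa> k * fourier_coeff h k"
    by (simp add: c_def)
  show "(\<lambda>k. cmod (fourier_coeff (heat \<kappa> h) k)) summable_on UNIV"
    using cs by (simp add: fc)
  show "cmod (heat \<kappa> h x) \<le> (\<Sum>\<^sub>\<infinity>k. cmod (fourier_coeff (heat \<kappa> h) k))"
  proof -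
    have "(\<lambda>k. norm (c k * torus_char k x)) summable_on UNIV"
      using cs by (simp add: norm_mult)
    from norm_infsum_bound[OF this] show ?thesis
      unfolding fc by (simp add: eq norm_mult)
  qed
qed

text \<open>Composition with \<open>inv f\<close> acts termwise on the series that defines
  \<open>heat\<close>, so on coefficients the operator is the matrix
  \<open>transfer_coeff\<close>.\<close>

lemma fourier_coeff_transfer_heat:
  assumes f: "volume_homeo f" and \<kappa>: "\<kappa> > 0" and h: "continuous_on UNIV h"
  shows "fourier_coeff (transfer_op f (heat \<kappa> h)) k = (\<Sum>\<^sub>\<infinity>j. fourier_coeff (heat \<kappa> h) j * transfer_coeff f k j)"
proof -
  let ?c = "fourier_coeff (heat \<kappa> h)"
  have "transfer_op f (heat \<kappa> h) = (\<lambda>x. \<Sum>\<^sub>\<infinity>j. ?c j * transfer_op f (torus_char j) x)"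
    by (simp add: fun_eq_iff transfer_op_def heat_continuous(2)[OF \<kappa> h] heat_def heat_factor_def)
  moreover have "((\<lambda>j. ?c j * transfer_coeff f k j) has_sum
      fourier_coeff (\<lambda>x. \<Sum>\<^sub>\<infinity>j. ?c j * transfer_op f (torus_char j) x) k) UNIV"
    unfolding transfer_coeff_def
    by (rule continuous_fourier_infsum(2)[OF continuous_transfer_op[OF f continuous_torus_char] _
          heat_continuous(3)[OF \<kappa> h]]) (simp add: transfer_op_def)
  ultimately show ?thesis by (simp add: infsumI)
qed

subsection \<open>Contraction in a weighted norm\<close>

lemma infsum_sum_finite:
  fixes f :: "'a \<Rightarrow> 'b \<Rightarrow> real"
  assumes "\<And>n. n \<in> A \<Longrightarrow> f n summable_on S"
  shows "(\<Sum>\<^sub>\<infinity>j\<in>S. \<Sum>n\<in>A. f n j) = (\<Sum>n\<in>A. infsum (f n) S)"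
proof (rule infsumI)
  have eq: "(\<lambda>F. \<Sum>j\<in>F. \<Sum>n\<in>A. f n j) = (\<lambda>F. \<Sum>n\<in>A. sum (f n) F)"
    by (rule ext) (rule sum.swap)
  show "((\<lambda>j. \<Sum>n\<in>A. f n j) has_sum (\<Sum>n\<in>A. infsum (f n) S)) S"
    unfolding has_sum_def eq by (intro tendsto_sum infsum_tendsto assms)
qed

text \<open>Counted downwards from their largest exponent, distinct powers of 2 form part of a
  geometric series of ratio 1/2, whose sum is at most twice its first term.\<close>

lemma sum_power_int_two_le:
  assumes "finite F" "\<And>s. s \<in> F \<Longrightarrow> 2 powi s \<le> x" "(0::real) \<le> x"
  shows "(\<Sum>s\<in>F. 2 powi s) \<le> 2 * x"
proof (cases "F = {}")
  case False
  define M where "M = Max F"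
  have "(\<Sum>s\<in>F. 2 powi s) \<le> (\<Sum>i\<le>nat (M - Min F). 2 powi (M - int i) :: real)"
  proof -
    have "(\<Sum>s\<in>F. 2 powi s) = (\<Sum>i\<in>(\<lambda>s. nat (M - s)) ` F. 2 powi (M - int i) :: real)"
    proof (subst sum.reindex)
      have le: "s \<le> M" if "s \<in> F" for s using assms(1) that by (simp add: M_def)
      show "inj_on (\<lambda>s. nat (M - s)) F" 
      proof (rule inj_onI)
        fix x y assume "x \<in> F" "y \<in> F" "nat (M - x) = nat (M - y)"
        then show "x = y" using le[of x] le[of y] by (simp add: nat_eq_iff)
      qed
      show "(\<Sum>s\<in>F. 2 powi s) = sum ((\<lambda>i. 2 powi (M - int i) :: real) \<circ> (\<lambda>s. nat (M - s))) F"
        using le by (intro sum.cong) auto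
    qed
    also have "\<dots> \<le> (\<Sum>i\<le>nat (M - Min F). 2 powi (M - int i))"
      using assms(1) by (intro sum_mono2) (auto intro!: nat_mono diff_left_mono)
    finally show ?thesis .
  qed
  also have "\<dots> = 2 powi M * (\<Sum>i\<le>nat (M - Min F). (1/2) ^ i)"
    by (simp add: sum_distrib_left power_int_diff power_divide)
  also have "\<dots> \<le> 2 powi M * 2"
  proof (rule mult_left_mono)
    have "(\<Sum>i\<le>n. (1/2) ^ i) = 2 - (1/2 :: real) ^ n" for n
      by (induction n) (auto simp: field_simps)
    then show "(\<Sum>i\<le>nat (M - Min F). (1/2) ^ i) \<le> (2 :: real)" by simp
  qed simp
  also have "\<dots> \<le> 2 * x"
    using assms(2)[of M] Max_in[OF assms(1) False] by (simp add: M_def)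
  finally show ?thesis .
qed (use assms in simp)

lemma dyadic_level: "x > 0 \<Longrightarrow> \<exists>s::int. 2 powi s < x \<and> x \<le> 2 * 2 powi s" for x :: real
proof -
  assume x: "x > 0"
  define s where "s = \<lceil>log 2 x\<rceil> - 1"
  have p: "2 powi s = 2 powr (real_of_int s)" by (simp add: powr_real_of_int')
  have "real_of_int s < log 2 x" "log 2 x \<le> real_of_int s + 1"
    unfolding s_def by linarith+
  then have "2 powr s < x" "x \<le> 2 powr (s + 1)"
    using x by (auto simp: less_log_iff log_le_iff)
  then show ?thesis unfolding p[symmetric] by (intro exI[of _ s]) (simp add: p powr_add)
qed

text \<open>\<open>m\<close> is an \<open>\<ell>\<^sup>2\<close> contraction whose entries \<open>(k, j)\<close> are negligible unless the weight grows by
  a factor of 64 from \<open>k\<close> to \<open>j\<close>; cutting the weight into dyadic layers turns this growth into a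
  contraction of the weighted norm.\<close>

lemma weighted_contraction:
  fixes m :: "'i \<Rightarrow> 'i \<Rightarrow> complex" and w a :: "'i \<Rightarrow> real" and c :: "'i \<Rightarrow> complex"
  assumes bessel: "\<And>K S. finite K \<Longrightarrow> (\<Sum>k\<in>K. (cmod (\<Sum>\<^sub>\<infinity>j\<in>S. c j * m k j))\<^sup>2) \<le> (\<Sum>\<^sub>\<infinity>j\<in>S. (cmod (c j))\<^sup>2)"
    and sm: "\<And>k. (\<lambda>j. norm (c j * m k j)) summable_on UNIV"
    and s2: "(\<lambda>j. (cmod (c j))\<^sup>2) summable_on UNIV"
    and w: "\<And>j. w j \<ge> 0" and sw: "(\<lambda>j. w j * (cmod (c j))\<^sup>2) summable_on UNIV"
    and a: "\<And>j. a j \<ge> 0" "a summable_on UNIV" and \<epsilon>: "\<epsilon> \<ge> 0" "\<epsilon> * (infsum a UNIV)\<^sup>2 \<le> 1 / 16"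
    and far: "\<And>k j. w j < 64 * w k \<Longrightarrow> (cmod (m k j))\<^sup>2 * w k \<le> w j * (\<epsilon> * a k * a j)"
  shows "(\<lambda>k. w k * (cmod (\<Sum>\<^sub>\<infinity>j. c j * m k j))\<^sup>2) summable_on UNIV"
    and "(\<Sum>\<^sub>\<infinity>k. w k * (cmod (\<Sum>\<^sub>\<infinity>j. c j * m k j))\<^sup>2) \<le> (\<Sum>\<^sub>\<infinity>j. w j * (cmod (c j))\<^sup>2) / 4"
proof -
  let ?H = "\<lambda>k. \<Sum>\<^sub>\<infinity>j. c j * m k j"
  let ?N = "\<Sum>\<^sub>\<infinity>j. w j * (cmod (c j))\<^sup>2" and ?A = "infsum a UNIV"
  have sm': "(\<lambda>j. norm (c j * m k j)) summable_on S" for k S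
    by (rule summable_on_subset_banach[OF sm]) simp
  have sms: "(\<lambda>j. c j * m k j) summable_on S" for k S
    by (rule abs_summable_summable[OF sm'])
  \<comment> \<open>Cauchy-Schwarz pairs sqrt (w j) |c j| with sqrt (\<epsilon> a k a j). The factor
    \<open>a j\<close> makes the sum over columns finite, and \<open>a k\<close> leaves a bound that
    can be summed over rows.\<close>
  have far_sum: "w k * (cmod (\<Sum>\<^sub>\<infinity>j\<in>S. c j * m k j))\<^sup>2 \<le> ?N * (\<epsilon> * a k * ?A)"
    if S: "\<And>j. j \<in> S \<Longrightarrow> w j < 64 * w k" for k S
  proof (rule tendsto_upperbound)
    show "((\<lambda>J. w k * (cmod (\<Sum>j\<in>J. c j * m k j))\<^sup>2) \<longlongrightarrow> w k * (cmod (\<Sum>\<^sub>\<infinity>j\<in>S. c j * m k j))\<^sup>2) (finite_subsets_at_top S)"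
      by (intro tendsto_mult tendsto_const tendsto_power tendsto_norm infsum_tendsto sms)
    show "\<forall>\<^sub>F J in finite_subsets_at_top S. w k * (cmod (\<Sum>j\<in>J. c j * m k j))\<^sup>2 \<le> ?N * (\<epsilon> * a k * ?A)"
    proof (rule eventually_finite_subsets_at_top_weakI)
      fix J assume J: "finite J" "J \<subseteq> S"
      have "sqrt (w k) * cmod (\<Sum>j\<in>J. c j * m k j) \<le> (\<Sum>j\<in>J. (sqrt (w j) * cmod (c j)) * sqrt (\<epsilon> * a k * a j))"
      proof -
        have "sqrt (w k) * cmod (\<Sum>j\<in>J. c j * m k j) \<le> sqrt (w k) * (\<Sum>j\<in>J. cmod (c j * m k j))"
          using w by (intro mult_left_mono norm_sum) auto
        also have "\<dots> = (\<Sum>j\<in>J. cmod (c j) * (cmod (m k j) * sqrt (w k)))"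
          by (simp add: sum_distrib_left norm_mult mult_ac)
        also have "\<dots> \<le> (\<Sum>j\<in>J. cmod (c j) * (sqrt (w j) * sqrt (\<epsilon> * a k * a j)))"
        proof (intro sum_mono mult_left_mono)
          fix j assume "j \<in> J"
          then have "sqrt ((cmod (m k j))\<^sup>2 * w k) \<le> sqrt (w j * (\<epsilon> * a k * a j))"
            using J S by (intro real_sqrt_le_mono far) auto
          then show "cmod (m k j) * sqrt (w k) \<le> sqrt (w j) * sqrt (\<epsilon> * a k * a j)"
            by (simp add: real_sqrt_mult)
        qed simp
        finally show ?thesis by (simp add: mult_ac)
      qed
      then have "(sqrt (w k) * cmod (\<Sum>j\<in>J. c j * m k j))\<^sup>2 \<le> (\<Sum>j\<in>J. (sqrt (w j) * cmod (c j)) * sqrt (\<epsilon> * a k * a j))\<^sup>2"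
        using w by (intro power_mono) auto
      also have "\<dots> \<le> (\<Sum>j\<in>J. (sqrt (w j) * cmod (c j))\<^sup>2) * (\<Sum>j\<in>J. (sqrt (\<epsilon> * a k * a j))\<^sup>2)"
        by (rule Cauchy_Schwarz_ineq_sum)
      also have "\<dots> = (\<Sum>j\<in>J. w j * (cmod (c j))\<^sup>2) * (\<Sum>j\<in>J. \<epsilon> * a k * a j)"
        using w a \<epsilon> by (simp add: power_mult_distrib)
      also have "\<dots> \<le> ?N * (\<epsilon> * a k * ?A)"
        using w a \<epsilon> J(1) unfolding sum_distrib_left[symmetric]
        by (intro mult_mono mult_left_mono finite_sum_le_infsum sw infsum_nonneg) (auto intro!: sum_nonneg mult_nonneg_nonneg)
      finally show "w k * (cmod (\<Sum>j\<in>J. c j * m k j))\<^sup>2 \<le> ?N * (\<epsilon> * a k * ?A)"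
        using w by (simp add: power_mult_distrib)
    qed
  qed simp
  have N: "?N \<ge> 0" using w by (intro infsum_nonneg) auto
  have A: "?A \<ge> 0" using a by (intro infsum_nonneg) auto
  \<comment> \<open>Rows of weight 0 have no dyadic level and contribute nothing; they are removed
    here and restored in \<open>fin'\<close>.\<close>
  have fin: "(\<Sum>k\<in>K. w k * (cmod (?H k))\<^sup>2) \<le> ?N / 4" if K0: "finite K0" and K: "K = {k\<in>K0. w k > 0}" for K K0
  proof -
    have fK: "finite K" using K0 K by simp
    have "\<exists>s. \<forall>k\<in>K. 2 powi (s k) < w k \<and> w k \<le> 2 * 2 powi (s k)"
      using K by (intro bchoice) (auto intro: dyadic_level)
    then obtain s :: "'i \<Rightarrow> int" where s: "\<And>k. k \<in> K \<Longrightarrow> 2 powi (s k) < w k" "\<And>k. k \<in> K \<Longrightarrow> w k \<le> 2 * 2 powi (s k)"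
      by blast
    \<comment> \<open>The threshold uses the lower end of the layer, so that all rows of one level
      share the same columns, as Bessel's inequality requires. A column outside satisfies w j < 64 *
      2^n < 64 w k and is covered by \<open>far_sum\<close>.\<close>
    define S where "S n = {j. 64 * 2 powi n \<le> w j}" for n :: int
    define H where "H n k = (\<Sum>\<^sub>\<infinity>j\<in>S n. c j * m k j)" for n k
    define L where "L n k = (\<Sum>\<^sub>\<infinity>j\<in>- S n. c j * m k j)" for n k
    have split: "w k * (cmod (?H k))\<^sup>2 \<le> 4 * (2 powi s k * (cmod (H (s k) k))\<^sup>2) + 2 * (?N * (\<epsilon> * a k * ?A))"
      if k: "k \<in> K" for k
    proof -
      have "(?H k) = H (s k) k + L (s k) k"
        unfolding H_def L_def by (subst infsum_Un_disjoint[symmetric]) (auto intro: sms)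
      then have "(cmod (?H k))\<^sup>2 \<le> (cmod (H (s k) k) + cmod (L (s k) k))\<^sup>2"
        by (simp add: power_mono norm_triangle_ineq)
      also have "\<dots> \<le> 2 * (cmod (H (s k) k))\<^sup>2 + 2 * (cmod (L (s k) k))\<^sup>2"
        using sum_squares_bound[of "cmod (H (s k) k)" "cmod (L (s k) k)"] by (simp add: power2_sum)
      finally have "w k * (cmod (?H k))\<^sup>2 \<le> w k * (2 * (cmod (H (s k) k))\<^sup>2 + 2 * (cmod (L (s k) k))\<^sup>2)"
        by (rule mult_left_mono[OF _ w])
      also have "\<dots> = 2 * (w k * (cmod (H (s k) k))\<^sup>2) + 2 * (w k * (cmod (L (s k) k))\<^sup>2)"
        by (simp add: algebra_simps)
      also have "w k * (cmod (H (s k) k))\<^sup>2 \<le> 2 * 2 powi s k * (cmod (H (s k) k))\<^sup>2"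
        using s(2)[OF k] by (intro mult_right_mono) auto
      also have "w k * (cmod (L (s k) k))\<^sup>2 \<le> ?N * (\<epsilon> * a k * ?A)"
        unfolding L_def using s(1)[OF k] by (intro far_sum) (auto simp: S_def)
      finally show ?thesis by simp
    qed
    \<comment> \<open>After Bessel on each layer, the sums over layers and columns are exchanged:
      column \<open>j\<close> meets only the levels with 2^n <= w j / 64, whose powers of 2 sum to
      at most w j / 32.\<close>
    have main: "(\<Sum>k\<in>K. 2 powi s k * (cmod (H (s k) k))\<^sup>2) \<le> ?N / 32"
    proof -
      have "(\<Sum>k\<in>K. 2 powi s k * (cmod (H (s k) k))\<^sup>2) = (\<Sum>n\<in>s ` K. \<Sum>k\<in>{k\<in>K. s k = n}. 2 powi s k * (cmod (H (s k) k))\<^sup>2)"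
        by (rule sum.image_gen[OF fK])
      also have "\<dots> = (\<Sum>n\<in>s ` K. 2 powi n * (\<Sum>k\<in>{k\<in>K. s k = n}. (cmod (H n k))\<^sup>2))"
        by (simp add: sum_distrib_left)
      also have "\<dots> \<le> (\<Sum>n\<in>s ` K. 2 powi n * (\<Sum>\<^sub>\<infinity>j\<in>S n. (cmod (c j))\<^sup>2))"
        unfolding H_def by (intro sum_mono mult_left_mono bessel) (auto simp: fK)
      also have "\<dots> = (\<Sum>n\<in>s ` K. \<Sum>\<^sub>\<infinity>j. 2 powi n * (of_bool (j \<in> S n) * (cmod (c j))\<^sup>2))"
        by (intro sum.cong refl, subst infsum_cmult_right', intro arg_cong2[where f = "(*)"] refl infsum_cong_neutral) auto
      also have "\<dots> = (\<Sum>\<^sub>\<infinity>j. \<Sum>n\<in>s ` K. 2 powi n * (of_bool (j \<in> S n) * (cmod (c j))\<^sup>2))"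
      proof (rule infsum_sum_finite[symmetric])
        fix n show "(\<lambda>j. 2 powi n * (of_bool (j \<in> S n) * (cmod (c j))\<^sup>2)) summable_on UNIV"
          by (intro summable_on_cmult_right summable_on_comparison_test[OF s2]) auto
      qed
      also have "\<dots> \<le> (\<Sum>\<^sub>\<infinity>j. w j * (cmod (c j))\<^sup>2 * (1 / 32))"
      proof (rule infsum_mono)
        have le: "(\<Sum>n\<in>s ` K. 2 powi n * (of_bool (j \<in> S n) * (cmod (c j))\<^sup>2)) \<le> w j * (cmod (c j))\<^sup>2 * (1 / 32)" for j
        proof -
          have "(\<Sum>n\<in>s ` K. 2 powi n * (of_bool (j \<in> S n) * (cmod (c j))\<^sup>2)) = (\<Sum>n\<in>{n\<in>s ` K. j \<in> S n}. 2 powi n) * (cmod (c j))\<^sup>2"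
            unfolding sum_distrib_right by (rule sum.mono_neutral_cong_right) (use fK in auto)
          also have "(\<Sum>n\<in>{n\<in>s ` K. j \<in> S n}. 2 powi n) \<le> 2 * (w j / 64)"
            by (intro sum_power_int_two_le) (use fK w in \<open>auto simp: S_def\<close>)
          finally show ?thesis by (simp add: mult_right_mono)
        qed
        show "(\<lambda>j. w j * (cmod (c j))\<^sup>2 * (1 / 32)) summable_on UNIV"
          by (intro summable_on_cmult_left sw)
        from this show "(\<lambda>j. \<Sum>n\<in>s ` K. 2 powi n * (of_bool (j \<in> S n) * (cmod (c j))\<^sup>2)) summable_on UNIV"
          by (rule summable_on_comparison_test) (use le in \<open>auto intro!: sum_nonneg\<close>)
        show "(\<Sum>n\<in>s ` K. 2 powi n * (of_bool (j \<in> S n) * (cmod (c j))\<^sup>2)) \<le> w j * (cmod (c j))\<^sup>2 * (1 / 32)" for j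
          by (rule le)
      qed
      also have "\<dots> = ?N / 32" by (subst infsum_cmult_left') simp
      finally show ?thesis .
    qed
    have "(\<Sum>k\<in>K. w k * (cmod (?H k))\<^sup>2) \<le>
       4 * (\<Sum>k\<in>K. 2 powi s k * (cmod (H (s k) k))\<^sup>2) + 2 * (?N * (\<epsilon> * (\<Sum>k\<in>K. a k) * ?A))"
      unfolding sum_distrib_left sum_distrib_right sum.distrib[symmetric]
      using split by (intro sum_mono) (simp add: mult_ac)
    \<comment> \<open>The budget: 4 / 32 from the heavy columns and 2 / 16 from the others add up to
      1/4.\<close>
    also have "\<dots> \<le> 4 * (?N / 32) + 2 * (?N * (\<epsilon> * ?A * ?A))"
      using N A \<epsilon> a fK
      by (intro add_mono mult_left_mono mult_right_mono main finite_sum_le_infsum) (auto intro!: mult_nonneg_nonneg)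
    also have "\<epsilon> * ?A * ?A \<le> 1 / 16" using \<epsilon>(2) by (simp add: power2_eq_square mult.assoc)
    finally show ?thesis using N by (simp add: mult_left_mono)
  qed
  have fin': "(\<Sum>k\<in>K. w k * (cmod (?H k))\<^sup>2) \<le> ?N / 4" if "finite K" for K
  proof -
    have "(\<Sum>k\<in>K. w k * (cmod (?H k))\<^sup>2) = (\<Sum>k\<in>{k\<in>K. w k > 0}. w k * (cmod (?H k))\<^sup>2)"
      using that w by (intro sum.mono_neutral_right) (auto simp: less_le)
    then show ?thesis using fin[OF that refl] by simp
  qed
  show sH: "(\<lambda>k. w k * (cmod (?H k))\<^sup>2) summable_on UNIV"
    using fin' w by (intro nonneg_bdd_above_summable_on bdd_aboveI2[where M = "?N / 4"]) auto
  show "(\<Sum>\<^sub>\<infinity>k. w k * (cmod (?H k))\<^sup>2) \<le> ?N / 4"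
    by (rule infsum_le_finite_sums[OF sH fin'])
qed

subsection \<open>An anisotropic weight\<close>

text \<open>\<open>x\<close> and \<open>y\<close> are the moduli of the unstable and stable coordinates of a frequency. At a nonzero
  frequency the larger one is at least \<open>1 / 2\<close>, so the factor 4 makes the base of both powers at
  least 2. This is what gives growth along orbits that cross the diagonal \<open>y = x\<close>, where the weight
  is discontinuous.\<close>

definition cone_weight :: "nat \<Rightarrow> real \<Rightarrow> real \<Rightarrow> real" where
  "cone_weight q x y = (if y \<le> x then (4 * x) ^ (2 * q) else 1 / (4 * y) ^ (2 * q))"

text \<open>A gap of 2 \<delta> on both sides of the unit circle pays for an error of relative size
  \<delta>. Inside the cone x grows by at least 1 + \<delta> and the step stays inside; outside it y
  is multiplied by at most 1 - \<delta>, and (1 - \<delta>)(1 + \<delta>) <= 1. The exponent turns 1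
  + \<delta> into 64, except when the step enters the cone, where the jump of the weight is used
  instead.\<close>

lemma cone_weight_step:
  fixes x y x' y' l \<mu> \<delta> :: real
  assumes "0 \<le> x" "0 \<le> y" "1 / 2 \<le> max x y" "1 / 2 \<le> max x' y'"
    and \<delta>: "0 < \<delta>" "1 + 2 * \<delta> \<le> l" "0 \<le> \<mu>" "\<mu> \<le> 1 - 2 * \<delta>"
    and x': "l * x - \<delta> * max x y \<le> x'" and y': "y' \<le> \<mu> * y + \<delta> * max x y"
    and q: "64 \<le> (1 + \<delta>) ^ (2 * q)" "2 \<le> q"
  shows "64 * cone_weight q x y \<le> cone_weight q x' y'"
proof (cases "y \<le> x")
  case True
  then have m: "max x y = x" by simp
  have dx: "0 \<le> \<delta> * x" using \<delta> assms(1) by simp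
  have "(1 + 2 * \<delta>) * x \<le> l * x" using \<delta> assms(1) by (intro mult_right_mono)
  then have 1: "(1 + \<delta>) * x \<le> x'" using x' m by (simp add: algebra_simps)
  have "\<mu> * y \<le> (1 - 2 * \<delta>) * x" using \<delta> assms True by (intro mult_mono) auto
  then have "y' \<le> x" using y' m dx by (simp add: algebra_simps)
  moreover have "x \<le> x'" using 1 dx by (simp add: algebra_simps)
  ultimately have c: "y' \<le> x'" by simp
  have "64 * (4 * x) ^ (2 * q) \<le> (1 + \<delta>) ^ (2 * q) * (4 * x) ^ (2 * q)"
    using assms(1) q by (intro mult_right_mono) auto
  also have "\<dots> = (4 * ((1 + \<delta>) * x)) ^ (2 * q)"
    unfolding power_mult_distrib[symmetric] by (simp only: mult.left_commute)
  also have "\<dots> \<le> (4 * x') ^ (2 * q)" using 1 \<delta> assms(1) by (intro power_mono) auto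
  finally show ?thesis using True c by (simp add: cone_weight_def)
next
  case False
  then have m: "max x y = y" "1 / 2 \<le> y" using assms by auto
  show ?thesis
  proof (cases "y' \<le> x'")
    case True
    then have "1 / 2 \<le> x'" using assms by auto
    \<comment> \<open>Both bases are at least 2 and the exponent is at least 4, so the weight jumps
      from at most 1/16 to at least 16.\<close>
    have two: "(2::real) ^ 4 \<le> 2 ^ (2 * q)" using q by (intro power_increasing) auto
    also have "\<dots> \<le> (4 * y) ^ (2 * q)" using m by (intro power_mono) auto
    finally have "64 / (4 * y) ^ (2 * q) \<le> 64 / 2 ^ 4"
      using m by (intro divide_left_mono) auto
    also have "\<dots> \<le> 2 ^ (2 * q)" using two by simp
    also have "\<dots> \<le> (4 * x') ^ (2 * q)" using \<open>1 / 2 \<le> x'\<close> by (intro power_mono) auto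
    finally show ?thesis using False True by (simp add: cone_weight_def)
  next
    case F: False
    then have y1: "1 / 2 \<le> y'" using assms by auto
    have "\<mu> * y \<le> (1 - 2 * \<delta>) * y" using \<delta> m by (intro mult_right_mono) auto
    then have "y' \<le> (1 - \<delta>) * y" using y' m by (simp add: algebra_simps)
    then have "(1 + \<delta>) * y' \<le> (1 + \<delta>) * ((1 - \<delta>) * y)" using \<delta> by (intro mult_left_mono) auto
    also have "\<dots> = y - \<delta> * \<delta> * y" by (simp add: algebra_simps)
    also have "\<dots> \<le> y" using \<delta> m by simp
    finally have 1: "(1 + \<delta>) * y' \<le> y" .
    have "64 * (4 * y') ^ (2 * q) \<le> (1 + \<delta>) ^ (2 * q) * (4 * y') ^ (2 * q)"
      using y1 q by (intro mult_right_mono) auto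
    also have "\<dots> = (4 * ((1 + \<delta>) * y')) ^ (2 * q)"
      unfolding power_mult_distrib[symmetric] by (simp only: mult.left_commute)
    also have "\<dots> \<le> (4 * y) ^ (2 * q)" using 1 \<delta> y1 by (intro power_mono) auto
    finally have "64 / (4 * y) ^ (2 * q) \<le> 1 / (4 * y') ^ (2 * q)"
      using y1 m by (simp add: field_simps)
    then show ?thesis using False F by (simp add: cone_weight_def)
  qed
qed

lemma norm_int_vec_ge_1:
  assumes "k \<noteq> 0"
  shows "1 \<le> freq k"
proof -
  obtain i where "k $ i \<noteq> 0" using assms by (auto simp: vec_eq_iff)
  then have "1 \<le> \<bar>int_vec k $ i\<bar>" by (simp add: int_vec_def)
  also have "\<dots> \<le> freq k" by (rule component_le_norm_cart)
  finally show ?thesis .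
qed

text \<open>The coordinates are Cramer's quotients with denominator \<open>d\<close>, which is
  nonzero because proportional eigenvectors would have the same eigenvalue.\<close>

lemma eigenbasis_coordinates:
  fixes B :: "real^2^2" and vu vs :: "real^2"
  assumes u: "is_eigenvector B lu vu" and s: "is_eigenvector B ls vs" and ne: "lu \<noteq> ls"
  shows "\<exists>x y. linear x \<and> linear y \<and> (\<forall>k. k = x k *\<^sub>R vu + y k *\<^sub>R vs) \<and>
     (\<forall>a b. x (a *\<^sub>R vu + b *\<^sub>R vs) = a \<and> y (a *\<^sub>R vu + b *\<^sub>R vs) = b) \<and>
     (\<forall>k. x (B *v k) = lu * x k \<and> y (B *v k) = ls * y k)"
proof -
  define d where "d = vu $ 1 * vs $ 2 - vu $ 2 * vs $ 1"
  have nz: "vu \<noteq> 0" "vs \<noteq> 0" and eu: "B *v vu = lu *\<^sub>R vu" and es: "B *v vs = ls *\<^sub>R vs"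
    using u s by (auto simp: is_eigenvector_def scalar_mult_eq_scaleR)
  have d: "d \<noteq> 0"
  proof
    assume d0: "d = 0"
    have "\<exists>c. vs = c *\<^sub>R vu"
    proof (cases "vu $ 1 = 0")
      case True
      then have "vu $ 2 \<noteq> 0" using nz by (auto simp: vec_eq_iff forall_2)
      then show ?thesis using True d0 by (intro exI[of _ "vs $ 2 / vu $ 2"]) (auto simp: d_def vec_eq_iff forall_2)
    next
      case False
      then show ?thesis using d0 by (intro exI[of _ "vs $ 1 / vu $ 1"]) (auto simp: d_def vec_eq_iff forall_2 field_simps)
    qed
    then obtain c where c: "vs = c *\<^sub>R vu" ..
    then have "ls *\<^sub>R vs = lu *\<^sub>R vs" using es eu by (auto simp: matrix_vector_mult_scaleR scaleR_scaleR mult.commute)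
    then show False using ne nz by simp
  qed
  define x where "x k = (k $ 1 * vs $ 2 - k $ 2 * vs $ 1) / d" for k :: "real^2"
  define y where "y k = (vu $ 1 * k $ 2 - vu $ 2 * k $ 1) / d" for k :: "real^2"
  have lin: "linear x" "linear y"
    using d by (auto intro!: linearI simp: x_def y_def field_simps)
  have xy: "x (a *\<^sub>R vu + b *\<^sub>R vs) = a" "y (a *\<^sub>R vu + b *\<^sub>R vs) = b" for a b
  proof -
    have "(a *\<^sub>R vu + b *\<^sub>R vs) $ 1 * vs $ 2 - (a *\<^sub>R vu + b *\<^sub>R vs) $ 2 * vs $ 1 = a * d"
      "vu $ 1 * (a *\<^sub>R vu + b *\<^sub>R vs) $ 2 - vu $ 2 * (a *\<^sub>R vu + b *\<^sub>R vs) $ 1 = b * d"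
      by (auto simp: d_def algebra_simps)
    then show "x (a *\<^sub>R vu + b *\<^sub>R vs) = a" "y (a *\<^sub>R vu + b *\<^sub>R vs) = b"
      using d by (auto simp: x_def y_def)
  qed
  have dec: "k = x k *\<^sub>R vu + y k *\<^sub>R vs" for k
  proof -
    have "d * k $ i = (d * x k) * vu $ i + (d * y k) * vs $ i" for i
      using d exhaust_2[of i] by (auto simp: x_def y_def) (auto simp: d_def algebra_simps)
    then have "d * k $ i = d * (x k *\<^sub>R vu + y k *\<^sub>R vs) $ i" for i by (simp add: algebra_simps)
    then show ?thesis using d by (simp add: vec_eq_iff)
  qed
  have "x (B *v k) = lu * x k \<and> y (B *v k) = ls * y k" for k
  proof -
    have "B *v k = (x k * lu) *\<^sub>R vu + (y k * ls) *\<^sub>R vs"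
      by (subst dec[of k], simp only: matrix_vector_right_distrib matrix_vector_mult_scaleR eu es scaleR_scaleR)
    then show ?thesis using xy[of "x k * lu" "y k * ls"] by simp
  qed
  then show ?thesis using lin xy dec by (intro exI[of _ x] exI[of _ y] conjI allI) simp_all
qed

text \<open>The constant \<open>c\<close> has two tasks: it is the relative radius within which a
  column counts as near, and it bounds \<open>B\<close> from below, so that frequency 0 is at
  relative distance at least \<open>c\<close> from the image of every nonzero frequency.\<close>

lemma anisotropic_weight:
  fixes B :: "real^2^2" and vu vs :: "real^2" and p :: real
  assumes u: "is_eigenvector B lu vu" "1 < \<bar>lu\<bar>" "norm vu = 1"
    and s: "is_eigenvector B ls vs" "\<bar>ls\<bar> < 1" "norm vs = 1" and ls: "ls \<noteq> 0"
  shows "\<exists>w r c C. 0 < c \<and> 0 < C \<and> w 0 = 0 \<and> (\<forall>k. 0 \<le> w k) \<and>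
     (\<forall>k. w k \<le> C * (1 + freq k) ^ r) \<and>
     (\<forall>k. k \<noteq> 0 \<longrightarrow> 1 \<le> w k * (C * (1 + freq k) ^ r)) \<and>
     (\<forall>k. k \<noteq> 0 \<longrightarrow> int_vec k \<in> unstable_cone vu vs \<longrightarrow> freq k powr (2 * p) \<le> C * w k) \<and>
     (\<forall>k. c * freq k \<le> norm (B *v int_vec k)) \<and>
     (\<forall>j k. j \<noteq> 0 \<longrightarrow> k \<noteq> 0 \<longrightarrow> norm (B *v int_vec k - int_vec j) \<le> c * freq k \<longrightarrow> 64 * w k \<le> w j)"
proof -
  have "lu \<noteq> ls" using u(2) s(2) by auto
  then obtain x y where lin: "linear x" "linear y" and dec: "\<And>k. k = x k *\<^sub>R vu + y k *\<^sub>R vs"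
    and xy: "\<And>a b. x (a *\<^sub>R vu + b *\<^sub>R vs) = a" "\<And>a b. y (a *\<^sub>R vu + b *\<^sub>R vs) = b"
    and B: "\<And>k. x (B *v k) = lu * x k" "\<And>k. y (B *v k) = ls * y k"
    using eigenbasis_coordinates[OF u(1) s(1)] by metis
  obtain D1 D2 where "\<And>k. norm (x k) \<le> D1 * norm k" "\<And>k. norm (y k) \<le> D2 * norm k"
    using linear_bounded lin by metis
  then obtain D where D: "D \<ge> 1" "\<And>k. \<bar>x k\<bar> \<le> D * norm k" "\<And>k. \<bar>y k\<bar> \<le> D * norm k"
  proof (rule_tac that[of "max 1 (max D1 D2)"])
    show "\<bar>x k\<bar> \<le> max 1 (max D1 D2) * norm k" if "\<And>k. norm (x k) \<le> D1 * norm k" for k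
      by (rule order_trans[OF that[unfolded real_norm_def]]) (auto intro!: mult_right_mono)
    show "\<bar>y k\<bar> \<le> max 1 (max D1 D2) * norm k" if "\<And>k. norm (y k) \<le> D2 * norm k" for k
      by (rule order_trans[OF that[unfolded real_norm_def]]) (auto intro!: mult_right_mono)
  qed auto
  define m where "m k = max \<bar>x k\<bar> \<bar>y k\<bar>" for k
  let ?m = "\<lambda>k. m (int_vec k)"
  have m: "norm k \<le> 2 * m k" "m k \<le> D * norm k" "0 \<le> m k" for k
  proof -
    have "norm k \<le> norm (x k *\<^sub>R vu) + norm (y k *\<^sub>R vs)"
      by (subst dec[of k]) (rule norm_triangle_ineq)
    then show "norm k \<le> 2 * m k" using u(3) s(3) by (simp add: m_def)
    show "m k \<le> D * norm k" "0 \<le> m k" using D by (auto simp: m_def)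
  qed
  \<comment> \<open>Half the smaller distance of the two eigenvalue moduli from 1; the other half is
    left to absorb the error.\<close>
  define \<delta> where "\<delta> = min ((\<bar>lu\<bar> - 1) / 2) ((1 - \<bar>ls\<bar>) / 2)"
  have \<delta>: "0 < \<delta>" "1 + 2 * \<delta> \<le> \<bar>lu\<bar>" "\<bar>ls\<bar> \<le> 1 - 2 * \<delta>"
  proof -
    have "\<delta> \<le> (\<bar>lu\<bar> - 1) / 2" "\<delta> \<le> (1 - \<bar>ls\<bar>) / 2" 
      unfolding \<delta>_def by (rule min.cobounded1, rule min.cobounded2)
    then show "1 + 2 * \<delta> \<le> \<bar>lu\<bar>" "\<bar>ls\<bar> \<le> 1 - 2 * \<delta>" by simp_all
  qed (use u(2) s(2) in \<open>simp add: \<delta>_def\<close>)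
  obtain n where n: "64 < (1 + \<delta>) ^ n" using real_arch_pow[of "1 + \<delta>" 64] \<delta> by auto
  \<comment> \<open>\<open>n\<close> makes one step gain the factor 64, 2 pays for entering the
    cone, and \<open>p\<close> makes the weight dominate |k|^(2p) inside the cone.\<close>
  define q where "q = max n (max 2 (nat \<lceil>p\<rceil>))"
  have q: "64 \<le> (1 + \<delta>) ^ (2 * q)" "2 \<le> q" "p \<le> q"
  proof -
    have "(1 + \<delta>) ^ n \<le> (1 + \<delta>) ^ (2 * q)" using \<delta> by (intro power_increasing) (auto simp: q_def)
    then show "64 \<le> (1 + \<delta>) ^ (2 * q)" using n by simp
    show "2 \<le> q" "p \<le> q" by (auto simp: q_def) linarith
  qed
  define w where "w k = (if k = 0 then 0 else cone_weight q \<bar>x (int_vec k)\<bar> \<bar>y (int_vec k)\<bar>)" for k :: "int^2"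
  \<comment> \<open>With |k| <= 2 m k, the first entry makes an error of norm c |k| at most \<delta>
    m k in each coordinate. The second comes from |ls| m k <= m (B k) <= D |B k|.\<close>
  define c where "c = min (\<delta> / (2 * D)) (\<bar>ls\<bar> / (2 * D))"
  define C where "C = (8 * D) ^ (2 * q)"
  have C: "0 < C" using D(1) by (simp add: C_def)
  have c: "0 < c" using \<delta> D(1) ls by (simp add: c_def)
  have m1: "1 / 2 \<le> ?m k" if "k \<noteq> 0" for k
    using norm_int_vec_ge_1[OF that] m(1)[of "int_vec k"] by simp
  have pw: "(4 * ?m k) ^ (2 * q) \<le> C * (1 + freq k) ^ (2 * q)" for k
  proof -
    have "4 * ?m k \<le> 8 * D * (1 + freq k)"
    proof -
      have "0 \<le> D * freq k" using D(1) by simp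
      moreover have "8 * D * (1 + freq k) = 8 * D + 8 * (D * freq k)"
        by (simp add: distrib_left)
      ultimately show ?thesis using m(2)[of "int_vec k"] D(1) by linarith
    qed
    then have "(4 * ?m k) ^ (2 * q) \<le> (8 * D * (1 + freq k)) ^ (2 * q)"
      using m(3)[of "int_vec k"] by (intro power_mono) auto
    then show ?thesis by (simp add: C_def power_mult_distrib)
  qed
  have one: "1 \<le> (4 * ?m k) ^ (2 * q)" if "k \<noteq> 0" for k
    using m1[OF that] by (intro one_le_power) auto
  \<comment> \<open>The weight is a power of 4 m k or its reciprocal, and this power lies between 1
    and a polynomial in |k|; both polynomial bounds on the weight follow.\<close>
  have wc: "w k = (4 * ?m k) ^ (2 * q) \<or> w k * (4 * ?m k) ^ (2 * q) = 1 \<and> w k \<le> 1 \<and> w k \<ge> 0" if "k \<noteq> 0" for k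
  proof (cases "\<bar>y (int_vec k)\<bar> \<le> \<bar>x (int_vec k)\<bar>")
    case True
    then show ?thesis using that by (simp add: w_def cone_weight_def m_def)
  next
    case False
    define P where "P = (4 * ?m k) ^ (2 * q)"
    have "w k = 1 / P" using that False by (simp add: w_def cone_weight_def m_def P_def)
    moreover have "1 \<le> P" using one[OF that] by (simp add: P_def)
    ultimately show ?thesis unfolding P_def[symmetric] by (simp add: divide_le_eq_1)
  qed
  show ?thesis
  proof (rule exI[of _ w], rule exI[of _ "2 * q"], rule exI[of _ c], rule exI[of _ C], intro conjI allI impI)
    show "w 0 = 0" by (simp add: w_def)
    fix k :: "int^2"
    show "0 \<le> w k" by (simp add: w_def cone_weight_def)
    show "w k \<le> C * (1 + freq k) ^ (2 * q)"
    proof (cases "k = 0")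
      case True
      then show ?thesis using C by (simp add: w_def)
    next
      case False
      then show ?thesis using wc[OF False] one[OF False] pw[of k] by auto
    qed
    show "1 \<le> w k * (C * (1 + freq k) ^ (2 * q))" if k: "k \<noteq> 0"
      using wc[OF k]
    proof
      assume "w k = (4 * ?m k) ^ (2 * q)"
      moreover have "1 * 1 \<le> (4 * ?m k) ^ (2 * q) * (C * (1 + freq k) ^ (2 * q))"
        using one[OF k] pw[of k] by (intro mult_mono) auto
      ultimately show ?thesis by simp
    next
      assume "w k * (4 * ?m k) ^ (2 * q) = 1 \<and> w k \<le> 1 \<and> w k \<ge> 0"
      then show ?thesis using mult_left_mono[OF pw[of k], of "w k"] by simp
    qed
    show "freq k powr (2 * p) \<le> C * w k" if k: "k \<noteq> 0" "int_vec k \<in> unstable_cone vu vs"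
    proof -
      obtain au as where "int_vec k = au *\<^sub>R vu + as *\<^sub>R vs" "\<bar>as\<bar> \<le> \<bar>au\<bar>"
        using k(2) by (auto simp: unstable_cone_def)
      then have "\<bar>y (int_vec k)\<bar> \<le> \<bar>x (int_vec k)\<bar>" using xy by simp
      then have w: "w k = (4 * ?m k) ^ (2 * q)" using k by (simp add: w_def cone_weight_def m_def)
      have "freq k powr (2 * p) \<le> freq k powr (real (2 * q))"
        using q(3) norm_int_vec_ge_1[OF k(1)] by (intro powr_mono) auto
      also have "\<dots> = freq k ^ (2 * q)"
        using norm_int_vec_ge_1[OF k(1)] by (subst powr_realpow) auto
      also have "\<dots> \<le> (4 * ?m k) ^ (2 * q)"
        using m[of "int_vec k"] by (intro power_mono) auto
      also have "\<dots> \<le> C * w k"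
      proof -
        have "1 \<le> C" unfolding C_def using D(1) by (intro one_le_power) simp
        then have "1 * (4 * ?m k) ^ (2 * q) \<le> C * (4 * ?m k) ^ (2 * q)"
          using m(3)[of "int_vec k"] by (intro mult_right_mono) auto
        then show ?thesis by (simp add: w)
      qed
      finally show ?thesis .
    qed
    show "c * freq k \<le> norm (B *v int_vec k)"
    proof -
      have "\<bar>ls\<bar> * ?m k \<le> m (B *v int_vec k)"
      proof -
        have "\<bar>ls\<bar> * \<bar>x (int_vec k)\<bar> \<le> \<bar>lu\<bar> * \<bar>x (int_vec k)\<bar>" using u(2) s(2) by (intro mult_right_mono) auto
        then show ?thesis by (auto simp: m_def B abs_mult max_def)
      qed
      then have "\<bar>ls\<bar> * freq k \<le> 2 * (D * norm (B *v int_vec k))"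
        using m(2)[of "B *v int_vec k"] mult_left_mono[OF m(1)[of "int_vec k"], of "\<bar>ls\<bar>"] by simp
      then have "\<bar>ls\<bar> / (2 * D) * freq k \<le> norm (B *v int_vec k)"
        using D(1) by (simp add: field_simps)
      moreover have "c * freq k \<le> \<bar>ls\<bar> / (2 * D) * freq k"
        by (intro mult_right_mono) (auto simp: c_def)
      ultimately show ?thesis by linarith
    qed
    fix j :: "int^2"
    assume jk: "j \<noteq> 0" "k \<noteq> 0" and near: "norm (B *v int_vec k - int_vec j) \<le> c * freq k"
    have "D * norm (B *v int_vec k - int_vec j) \<le> D * (c * freq k)"
      using near D(1) by (intro mult_left_mono) auto
    also have "\<dots> \<le> D * (\<delta> / (2 * D) * (2 * ?m k))"
      using m(1)[of "int_vec k"] D(1) c by (intro mult_left_mono mult_mono) (auto simp: c_def)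
    also have "\<dots> = \<delta> * ?m k" using D(1) by simp
    finally have near': "D * norm (B *v int_vec k - int_vec j) \<le> \<delta> * ?m k" .
    have "\<bar>lu * x (int_vec k) - x (int_vec j)\<bar> \<le> \<delta> * ?m k"
      using near' D(2)[of "B *v int_vec k - int_vec j"] by (simp add: linear_diff[OF lin(1)] B)
    then have 1: "\<bar>lu\<bar> * \<bar>x (int_vec k)\<bar> - \<delta> * ?m k \<le> \<bar>x (int_vec j)\<bar>"
      by (simp add: abs_mult[symmetric])
    have "\<bar>ls * y (int_vec k) - y (int_vec j)\<bar> \<le> \<delta> * ?m k"
      using near' D(3)[of "B *v int_vec k - int_vec j"] by (simp add: linear_diff[OF lin(2)] B)
    then have 2: "\<bar>y (int_vec j)\<bar> \<le> \<bar>ls\<bar> * \<bar>y (int_vec k)\<bar> + \<delta> * ?m k"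
      by (simp add: abs_mult[symmetric])
    show "64 * w k \<le> w j"
      unfolding w_def using jk
      by (simp, intro cone_weight_step[OF _ _ _ _ \<delta>(1,2) _ \<delta>(3) 1[unfolded m_def] 2[unfolded m_def] q(1,2)])
        (use m1[OF jk(1)] m1[OF jk(2)] in \<open>auto simp: m_def\<close>)
  qed (fact c C)+
qed

subsection \<open>Lifts of torus maps\<close>

lemma smooth_has_derivative:
  "smooth F \<Longrightarrow> (iter_deriv F vs has_derivative (\<lambda>v. iter_deriv F (v # vs) x)) (at x)"
  unfolding iter_deriv.simps by (auto simp: smooth_def frechet_derivative_works[symmetric])

lemma smooth_line_derivative:
  assumes "smooth F"
  shows "((\<lambda>t. iter_deriv F vs (x + t *\<^sub>R v)) has_vector_derivative iter_deriv F (v # vs) (x + t *\<^sub>R v)) (at t)"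
proof -
  have "((\<lambda>t. x + t *\<^sub>R v) has_derivative (\<lambda>t. t *\<^sub>R v)) (at t)"
    by (auto intro!: derivative_eq_intros)
  from has_derivative_compose[OF this smooth_has_derivative[OF assms]]
  have "((\<lambda>t. iter_deriv F vs (x + t *\<^sub>R v)) has_derivative (\<lambda>s. iter_deriv F ((s *\<^sub>R v) # vs) (x + t *\<^sub>R v))) (at t)" .
  moreover have "iter_deriv F ((s *\<^sub>R v) # vs) y = s *\<^sub>R iter_deriv F (v # vs) y" for s y
    using linear_scale[OF has_derivative_linear[OF smooth_has_derivative[OF assms]]] .
  ultimately show ?thesis by (simp add: has_vector_derivative_def)
qed

lemma continuous_iter_deriv: "smooth F \<Longrightarrow> continuous_on UNIV (iter_deriv F vs)"
  by (metis smooth_def differentiable_imp_continuous_on differentiable_on_def differentiable_at_withinI)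

text \<open>In the outermost slot this is linearity of a derivative; differentiating the identity
  once more moves it one slot deeper. Symmetry of higher derivatives does not enter.\<close>

lemma iter_deriv_expand:
  fixes F :: "real^2 \<Rightarrow> 'b::real_normed_vector"
  assumes "smooth F"
  shows "iter_deriv F (us @ v # ws) x = (\<Sum>i\<in>UNIV. v $ i *\<^sub>R iter_deriv F (us @ axis i 1 # ws) x)"
proof (induction us arbitrary: x)
  case Nil
  interpret linear "\<lambda>v. iter_deriv F (v # ws) x"
    by (rule has_derivative_linear[OF smooth_has_derivative[OF assms]])
  have "v = (\<Sum>i\<in>UNIV. v $ i *\<^sub>R axis i 1)"
    by (simp add: vec_eq_iff axis_def if_distrib cong: if_cong)
  then have "iter_deriv F (v # ws) x = iter_deriv F ((\<Sum>i\<in>UNIV. v $ i *\<^sub>R axis i 1) # ws) x" by simp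
  then show ?case by (simp only: sum scale append_Nil)
next
  case (Cons u us)
  have "iter_deriv F (us @ v # ws) = (\<lambda>x. \<Sum>i\<in>UNIV. v $ i *\<^sub>R iter_deriv F (us @ axis i 1 # ws) x)"
    using Cons.IH by (rule ext)
  moreover have "((\<lambda>x. \<Sum>i\<in>UNIV. v $ i *\<^sub>R iter_deriv F (us @ axis i 1 # ws) x) has_derivative
      (\<lambda>u. \<Sum>i\<in>UNIV. v $ i *\<^sub>R iter_deriv F (u # us @ axis i 1 # ws) x)) (at x)"
    by (intro has_derivative_sum has_derivative_scaleR_right smooth_has_derivative[OF assms])
  ultimately have "(iter_deriv F (us @ v # ws) has_derivative
      (\<lambda>u. \<Sum>i\<in>UNIV. v $ i *\<^sub>R iter_deriv F (u # us @ axis i 1 # ws) x)) (at x)" by simp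
  from has_derivative_unique[OF this smooth_has_derivative[OF assms]]
  show ?case by (simp add: fun_eq_iff del: iter_deriv.simps)
qed

lemma iter_deriv_shift:
  assumes "smooth F"
  shows "iter_deriv (\<lambda>y. F (y + c)) vs x = iter_deriv F vs (x + c)"
proof (induction vs arbitrary: x)
  case (Cons v vs)
  have "iter_deriv (\<lambda>y. F (y + c)) vs = (\<lambda>x. iter_deriv F vs (x + c))" using Cons.IH by (rule ext)
  moreover have "((\<lambda>x. iter_deriv F vs (x + c)) has_derivative (\<lambda>v. iter_deriv F (v # vs) (x + c))) (at x)"
    by (rule has_derivative_compose[OF _ smooth_has_derivative[OF assms]]) (auto intro!: derivative_eq_intros)
  ultimately show ?case by (simp add: fun_cong[OF frechet_derivative_at[symmetric]])
qed simp

lemma iter_deriv_add_const: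
  fixes F :: "'a::euclidean_space \<Rightarrow> 'b::real_normed_vector"
  assumes "smooth F"
  shows "iter_deriv (\<lambda>y. F y + d) vs x = iter_deriv F vs x + (if vs = [] then d else 0)"
proof (induction vs arbitrary: x)
  case (Cons v vs)
  have "iter_deriv (\<lambda>y. F y + d) vs = (\<lambda>x. iter_deriv F vs x + (if vs = [] then d else 0))"
    using Cons.IH by (rule ext)
  moreover have "((\<lambda>x. iter_deriv F vs x + (if vs = [] then d else 0)) has_derivative (\<lambda>v. iter_deriv F (v # vs) x)) (at x)"
    using has_derivative_add[OF smooth_has_derivative[OF assms] has_derivative_const] by simp
  ultimately show ?case by (simp add: fun_cong[OF frechet_derivative_at[symmetric]])
qed simp

text \<open>Different integers are at distance at least 1, so each coordinate is a continuous
  function with discrete range on a connected space.\<close>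

lemma continuous_int_valued_constant:
  fixes g :: "real^2 \<Rightarrow> real^2"
  assumes "continuous_on UNIV g" "\<And>x. \<exists>n. g x = int_vec n"
  shows "\<exists>n. \<forall>x. g x = int_vec n"
proof -
  have "(\<lambda>x. g x $ i) constant_on UNIV" for i
  proof (rule continuous_discrete_range_constant)
    show "continuous_on UNIV (\<lambda>x. g x $ i)" by (intro continuous_intros assms(1))
    fix x
    have "1 \<le> norm (g y $ i - g x $ i)" if "g y $ i \<noteq> g x $ i" for y
    proof -
      obtain m n where "g x = int_vec m" "g y = int_vec n" using assms(2) by metis
      then have *: "g y $ i - g x $ i = real_of_int (n $ i - m $ i)" by (simp add: int_vec_def)
      with that have "n $ i - m $ i \<noteq> 0" by auto
      then show ?thesis unfolding * real_norm_def by linarith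
    qed
    then show "\<exists>e>0. \<forall>y. y \<in> UNIV \<and> g y $ i \<noteq> g x $ i \<longrightarrow> e \<le> norm (g y $ i - g x $ i)"
      by (intro exI[of _ 1]) auto
  qed (rule convex_connected[OF convex_UNIV])
  then have "g x $ i = g 0 $ i" for x i unfolding constant_on_def by (metis UNIV_I)
  then have "g x = g 0" for x by (simp add: vec_eq_iff)
  then show ?thesis using assms(2) by metis
qed

lemma lift_unique:
  fixes F G :: "real^2 \<Rightarrow> real^2"
  assumes "continuous_on UNIV F" "continuous_on UNIV G" "proj_torus \<circ> F = proj_torus \<circ> G"
  shows "\<exists>n. \<forall>x. F x = G x + int_vec n"
proof -
  have "\<exists>n. F x - G x = int_vec n" for x
    using fun_cong[OF assms(3), of x] by (simp add: proj_torus_eq_iff)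
  then obtain n where n: "\<And>x. F x - G x = int_vec n"
    using continuous_int_valued_constant[OF continuous_on_diff[OF assms(1,2)]] by blast
  have "F x = G x + int_vec n" for x using n[of x] by (simp add: algebra_simps)
  then show ?thesis by blast
qed

lemma smooth_continuous: "smooth F \<Longrightarrow> continuous_on UNIV F"
proof -
  have "iter_deriv F [] = F" by (rule ext) simp
  then show "smooth F \<Longrightarrow> continuous_on UNIV F" using continuous_iter_deriv[of F "[]"] by simp
qed

text \<open>Shifting the argument by an integer vector gives another lift of \<open>f\<close>, which
  differs from \<open>F\<close> by a constant; derivatives of order at least one remove the
  constant.\<close>

lemma iter_deriv_lift_periodic:
  assumes "smooth_lift f F" "vs \<noteq> []"
  shows "iter_deriv F vs (x + int_vec n) = iter_deriv F vs x"
proof -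
  have F: "smooth F" "proj_torus \<circ> F = f \<circ> proj_torus" using assms(1) by (auto simp: smooth_lift_def)
  have "continuous_on UNIV (\<lambda>x. F (x + int_vec n))"
    by (rule continuous_on_compose2[OF smooth_continuous[OF F(1)]]) (auto intro!: continuous_intros)
  moreover have "proj_torus \<circ> (\<lambda>x. F (x + int_vec n)) = proj_torus \<circ> F"
    using F(2) by (auto simp: fun_eq_iff proj_torus_add_int)
  ultimately obtain m where "\<And>x. F (x + int_vec n) = F x + int_vec m"
    using lift_unique smooth_continuous[OF F(1)] by blast
  then have "(\<lambda>x. F (x + int_vec n)) = (\<lambda>x. F x + int_vec m)" by (rule ext)
  then have "iter_deriv (\<lambda>x. F (x + int_vec n)) vs x = iter_deriv (\<lambda>x. F x + int_vec m) vs x" by simp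
  then show ?thesis using assms(2) by (simp add: iter_deriv_shift iter_deriv_add_const F(1))
qed

lemma continuous_periodic_bounded:
  fixes g :: "real^2 \<Rightarrow> 'b::real_normed_vector"
  assumes g: "continuous_on UNIV g" and per: "\<And>x n. g (x + int_vec n) = g x"
  shows "\<exists>K. \<forall>x. norm (g x) \<le> K"
proof -
  have "bounded (g ` cbox 0 1)"
    by (intro compact_imp_bounded compact_continuous_image continuous_on_subset[OF g]) auto
  then obtain K where K: "\<And>x. x \<in> cbox 0 1 \<Longrightarrow> norm (g x) \<le> K" unfolding bounded_iff by auto
  have "norm (g x) \<le> K" for x
  proof -
    obtain y where y: "proj_torus y = proj_torus x" "\<forall>i. 0 \<le> y $ i \<and> y $ i < 1" using proj_torus_cbox by blast
    then obtain n where "y - x = int_vec n" by (auto simp: proj_torus_eq_iff)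
    then have "y = x + int_vec n" by (simp add: algebra_simps)
    then have "g y = g x" using per by simp
    then show ?thesis using K[of y] y(2) by (auto simp: mem_box_cart less_imp_le)
  qed
  then show ?thesis by blast
qed

text \<open>The hypothesis bounds each fixed list of directions separately. Expansion in the two
  axes reduces all lists to finitely many. The uniform bound is what makes the suprema in
  \<open>deriv_dist_at\<close> genuine upper bounds.\<close>

lemma iter_deriv_bounded_unit:
  fixes F :: "real^2 \<Rightarrow> 'b::real_normed_vector"
  assumes F: "smooth F" and bd: "\<And>vs. length vs = n \<Longrightarrow> \<exists>K. \<forall>x. norm (iter_deriv F vs x) \<le> K"
  shows "\<exists>K. \<forall>vs x. length vs = n \<and> (\<forall>v\<in>set vs. norm v \<le> 1) \<longrightarrow> norm (iter_deriv F vs x) \<le> K"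
proof -
  let ?Ax = "range (\<lambda>i. axis i 1) :: (real^2) set"
  \<comment> \<open>Mixed lists: the leading entries are axes, the last \<open>m\<close> are
    arbitrary vectors of norm at most 1. Each induction step expands one more vector and doubles the
    bound.\<close>
  have "\<exists>K. \<forall>ws us x. set ws \<subseteq> ?Ax \<and> length ws + m = n \<and> length us = m \<and> (\<forall>v\<in>set us. norm v \<le> 1) \<longrightarrow>
      norm (iter_deriv F (ws @ us) x) \<le> K" for m
  proof (induction m)
    case 0
    have "finite {ws. set ws \<subseteq> ?Ax \<and> length ws = n}" by (intro finite_lists_length_eq) auto
    moreover obtain K where K: "\<And>vs x. length vs = n \<Longrightarrow> norm (iter_deriv F vs x) \<le> K vs"
      using bd by metis
    ultimately obtain M where M: "\<And>ws. set ws \<subseteq> ?Ax \<and> length ws = n \<Longrightarrow> K ws \<le> M"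
      using that[of "Max (K ` {ws. set ws \<subseteq> ?Ax \<and> length ws = n})"] by auto
    show ?case by (intro exI[of _ M]) (auto intro: order_trans[OF K M])
  next
    case (Suc m)
    then obtain K where K: "\<And>ws us x. set ws \<subseteq> ?Ax \<Longrightarrow> length ws + m = n \<Longrightarrow> length us = m \<Longrightarrow>
        (\<forall>v\<in>set us. norm v \<le> 1) \<Longrightarrow> norm (iter_deriv F (ws @ us) x) \<le> K" by blast
    have "norm (iter_deriv F (ws @ us) x) \<le> (\<Sum>i\<in>(UNIV::2 set). K)"
      if h: "set ws \<subseteq> ?Ax" "length ws + Suc m = n" "length us = Suc m" "\<forall>v\<in>set us. norm v \<le> 1" for ws us x
    proof -
      obtain u us' where us: "us = u # us'" using h(3) by (cases us) auto
      have "norm (iter_deriv F (ws @ us) x) \<le> (\<Sum>i\<in>UNIV. norm (u $ i *\<^sub>R iter_deriv F ((ws @ [axis i 1]) @ us') x))"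
        unfolding us by (subst iter_deriv_expand[OF F]) (rule order_trans[OF norm_sum], simp)
      also have "\<dots> \<le> (\<Sum>i\<in>(UNIV::2 set). K)"
      proof (rule sum_mono)
        fix i :: 2
        have 1: "norm (iter_deriv F ((ws @ [axis i 1]) @ us') x) \<le> K"
          using h us by (intro K) auto
        have "\<bar>u $ i\<bar> \<le> 1" using component_le_norm_cart[of u i] h(4) us by auto
        then have "\<bar>u $ i\<bar> * norm (iter_deriv F ((ws @ [axis i 1]) @ us') x) \<le> 1 * K"
          using 1 by (intro mult_mono) auto
        then show "norm (u $ i *\<^sub>R iter_deriv F ((ws @ [axis i 1]) @ us') x) \<le> K" by simp
      qed
      finally show ?thesis .
    qed
    then show ?case by blast
  qed
  from this[of n] obtain K where K: "\<forall>ws us x. set ws \<subseteq> ?Ax \<and> length ws + n = n \<and> length us = n \<and>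
      (\<forall>v\<in>set us. norm v \<le> 1) \<longrightarrow> norm (iter_deriv F (ws @ us) x) \<le> K" by blast
  show ?thesis by (intro exI[of _ K]) (use K[rule_format, of "[]"] in simp)
qed

lemma iter_deriv_lift_bounded:
  assumes "smooth_lift f F" "n > 0"
  shows "\<exists>K. \<forall>vs x. length vs = n \<and> (\<forall>v\<in>set vs. norm v \<le> 1) \<longrightarrow> norm (iter_deriv F vs x) \<le> K"
proof (rule iter_deriv_bounded_unit)
  show F: "smooth F" using assms(1) by (simp add: smooth_lift_def)
  show "\<exists>K. \<forall>x. norm (iter_deriv F vs x) \<le> K" if "length vs = n" for vs
    using that assms by (intro continuous_periodic_bounded continuous_iter_deriv[OF F] iter_deriv_lift_periodic[OF assms(1)]) auto
qed

lemma the_lift_smooth: "smooth_torus_map f \<Longrightarrow> smooth_lift f (the_lift f)"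
  by (metis smooth_torus_map_def the_lift_def someI)

section \<open>From the C-infinity distance to the derivatives of lifts\<close>

lemma torus_dist_bounds: "0 \<le> torus_dist s t" "torus_dist s t \<le> 2"
proof -
  let ?D = "{dist x y | x y. proj_torus x = s \<and> proj_torus y = t}"
  obtain x where x: "proj_torus x = s" "\<forall>i. 0 \<le> x $ i \<and> x $ i < 1" using proj_torus_cbox by blast
  obtain y where y: "proj_torus y = t" "\<forall>i. 0 \<le> y $ i \<and> y $ i < 1" using proj_torus_cbox by blast
  have mem: "dist x y \<in> ?D" using x y by blast
  show "0 \<le> torus_dist s t" unfolding torus_dist_def
    by (rule cInf_greatest) (use mem in auto)
  have "torus_dist s t \<le> dist x y" unfolding torus_dist_def
    by (rule cInf_lower[OF mem]) (auto simp: bdd_below_def intro!: exI[of _ 0])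
  also have "\<dots> \<le> (\<Sum>i\<in>UNIV. \<bar>(x - y) $ i\<bar>)" unfolding dist_norm by (rule norm_le_l1_cart)
  also have "\<dots> \<le> (\<Sum>i\<in>(UNIV :: 2 set). 1)"
  proof (rule sum_mono)
    fix i :: 2
    show "\<bar>(x - y) $ i\<bar> \<le> 1" using x(2)[rule_format, of i] y(2)[rule_format, of i] by (simp add: abs_le_iff)
  qed
  finally show "torus_dist s t \<le> 2" by simp
qed

text \<open>The bound 2 on \<open>torus_dist\<close> makes the supremum at order 0 an upper bound of
  its values; higher orders inherit the sign through the maximum.\<close>

lemma dist_C_nonneg: "0 \<le> dist_C n f g"
proof (induction n)
  case 0
  have "0 \<le> torus_dist (f undefined) (g undefined)" by (rule torus_dist_bounds)
  also have "\<dots> \<le> (SUP x. torus_dist (f x) (g x))"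
    by (rule cSUP_upper) (auto intro!: bdd_aboveI2[where M = 2] torus_dist_bounds)
  finally show ?case by simp
qed simp

lemma dist_C_mono: "m \<le> n \<Longrightarrow> dist_C m f g \<le> dist_C n f g"
  by (induction n rule: dec_induct) auto

text \<open>Lifts have bounded derivatives of positive order, so each supremum dominates its values.
  Order 0 is excluded because there \<open>dist_C\<close> compares points of the torus, while lifts
  may differ by an integer vector.\<close>

lemma iter_deriv_diff_le_dist_C:
  assumes f: "smooth_torus_map f" and g: "smooth_torus_map g"
    and vs: "vs \<noteq> []" "length vs \<le> n" "\<And>v. v \<in> set vs \<Longrightarrow> norm v \<le> 1"
  shows "norm (iter_deriv (the_lift f) vs x - iter_deriv (the_lift g) vs x) \<le> dist_C n f g"
proof -
  let ?F = "the_lift f" and ?G = "the_lift g"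
  obtain k where k: "length vs = Suc k" using vs(1) by (cases vs) auto
  let ?V = "{vs :: (real^2) list. length vs = Suc k \<and> (\<forall>v\<in>set vs. norm v \<le> 1)}"
  obtain K1 K2 where
    K1: "\<forall>vs x. length vs = Suc k \<and> (\<forall>v\<in>set vs. norm v \<le> 1) \<longrightarrow> norm (iter_deriv ?F vs x) \<le> K1" and
    K2: "\<forall>vs x. length vs = Suc k \<and> (\<forall>v\<in>set vs. norm v \<le> 1) \<longrightarrow> norm (iter_deriv ?G vs x) \<le> K2"
    using iter_deriv_lift_bounded[OF the_lift_smooth[OF f], of "Suc k"]
      iter_deriv_lift_bounded[OF the_lift_smooth[OF g], of "Suc k"] by blast
  have bd: "norm (iter_deriv ?F vs x - iter_deriv ?G vs x) \<le> K1 + K2" if "vs \<in> ?V" for vs x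
    using that K1 K2 by (intro norm_triangle_le_diff add_mono) auto
  have V: "vs \<in> ?V" using vs k by auto
  have at: "norm (iter_deriv ?F vs x - iter_deriv ?G vs x) \<le> deriv_dist_at (Suc k) ?F ?G x" if "vs \<in> ?V" for vs x
    unfolding deriv_dist_at_def by (rule cSUP_upper[OF that bdd_aboveI2[where M = "K1 + K2"]]) (rule bd)
  have at': "deriv_dist_at (Suc k) ?F ?G x \<le> K1 + K2" for x
    unfolding deriv_dist_at_def by (rule cSUP_least) (use V bd in auto)
  have "norm (iter_deriv ?F vs x - iter_deriv ?G vs x) \<le> deriv_dist_at (Suc k) ?F ?G x" by (rule at[OF V])
  also have "\<dots> \<le> (SUP x. deriv_dist_at (Suc k) ?F ?G x)"
    by (intro cSUP_upper bdd_aboveI2[where M = "K1 + K2"] at') auto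
  also have "\<dots> \<le> dist_C (Suc k) f g" by simp
  also have "\<dots> \<le> dist_C n f g" using vs(2) k by (intro dist_C_mono) simp
  finally show ?thesis .
qed

text \<open>A single nonnegative summand is at most the whole series, and t / (1 + t) is increasing
  in t, so the bound on the summand of index \<open>n\<close> can be inverted.\<close>

lemma dist_C_le_of_dist_C_inf:
  assumes "0 < \<delta>" "dist_C_inf f g < (1 / 2) ^ n * (\<delta> / (1 + \<delta>))"
  shows "dist_C n f g \<le> \<delta>"
proof -
  let ?d = "\<lambda>k. dist_C k f g"
  have le1: "?d k / (1 + ?d k) \<le> 1" for k using dist_C_nonneg[of k f g] by simp
  have "(\<Sum>k. (1 / 2) ^ k * (?d k / (1 + ?d k))) \<ge> (\<Sum>k\<in>{n}. (1 / 2) ^ k * (?d k / (1 + ?d k)))"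
  proof (rule sum_le_suminf)
    show "summable (\<lambda>k. (1 / 2) ^ k * (?d k / (1 + ?d k)))"
    proof (rule summable_comparison_test')
      show "summable (\<lambda>k. (1 / 2 :: real) ^ k)" by (rule summable_geometric) simp
      show "norm ((1 / 2) ^ k * (?d k / (1 + ?d k))) \<le> (1 / 2) ^ k" if "k \<ge> 0" for k
        using mult_left_mono[OF le1[of k], of "(1/2)^k"] dist_C_nonneg[of k f g] by (simp add: abs_mult)
    qed
  qed (use dist_C_nonneg[of _ f g] in auto)
  then have "(1 / 2) ^ n * (?d n / (1 + ?d n)) < (1 / 2) ^ n * (\<delta> / (1 + \<delta>))"
    using assms(2) by (simp add: dist_C_inf_def)
  then have "?d n / (1 + ?d n) < \<delta> / (1 + \<delta>)" by (simp only: mult_less_cancel_left_pos zero_less_power zero_less_divide_1_iff zero_less_numeral)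
  then show ?thesis using dist_C_nonneg[of n f g] assms(1) by (simp add: field_simps add_pos_nonneg)
qed

lemma iter_deriv_linear:
  assumes "linear L"
  shows "iter_deriv L vs = (\<lambda>x. if vs = [] then L x else if length vs = 1 then L (hd vs) else 0)"
    and "smooth (L :: real^2 \<Rightarrow> real^2)"
proof -
  have L: "(L has_derivative L) (at x)" for x
    using assms by (intro bounded_linear_imp_has_derivative) (simp add: linear_conv_bounded_linear)
  show *: "iter_deriv L vs = (\<lambda>x. if vs = [] then L x else if length vs = 1 then L (hd vs) else 0)" for vs
  proof (induction vs)
    case (Cons v vs)
    show ?case
    proof (cases "vs = []")
      case True
      have e: "iter_deriv L [] = L" by (rule ext) simp
      show ?thesis unfolding True by (simp add: fun_eq_iff e frechet_derivative_at[OF L, symmetric])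
    next
      case False
      then show ?thesis by (simp add: Cons.IH fun_eq_iff frechet_derivative_const)
    qed
  qed (simp add: fun_eq_iff)
  have d: "L differentiable at x" for x using L by (auto simp: differentiable_def)
  show "smooth L" unfolding smooth_def
  proof (intro allI)
    fix vs x
    show "iter_deriv L vs differentiable at x"
      unfolding * by (cases "vs = []"; cases "length vs = 1") (use d in auto)
  qed
qed

text \<open>The chosen lift of the linear map is \<open>L\<close> up to an integer vector, which
  derivatives do not see. The witness for \<epsilon> is the threshold of
  \<open>dist_C_le_of_dist_C_inf\<close> at order \<open>n\<close>.\<close>

lemma iter_deriv_perturbation:
  fixes A :: "int^2^2"
  defines "L \<equiv> \<lambda>x. map_matrix real_of_int A *v x"
  assumes "0 < \<delta>"
  shows "\<exists>\<epsilon>>0. \<forall>f. smooth_torus_map f \<and> dist_C_inf f (linear_torus_map A) < \<epsilon> \<longrightarrow>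
    (\<forall>vs x. vs \<noteq> [] \<and> length vs \<le> n \<and> (\<forall>v\<in>set vs. norm v \<le> 1) \<longrightarrow>
       norm (iter_deriv (the_lift f) vs x - (if length vs = 1 then L (hd vs) else 0)) \<le> \<delta>)"
proof (intro exI[of _ "(1 / 2) ^ n * (\<delta> / (1 + \<delta>))"] conjI allI impI)
  show "0 < (1 / 2) ^ n * (\<delta> / (1 + \<delta>))" using assms by simp
  fix f :: "torus \<Rightarrow> torus" and vs :: "(real^2) list" and x :: "real^2"
  let ?g = "linear_torus_map A"
  assume f: "smooth_torus_map f \<and> dist_C_inf f ?g < (1 / 2) ^ n * (\<delta> / (1 + \<delta>))"
    and vs: "vs \<noteq> [] \<and> length vs \<le> n \<and> (\<forall>v\<in>set vs. norm v \<le> 1)"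
  have lin: "linear L" unfolding L_def by (rule matrix_vector_mul_linear)
  have L: "smooth_lift ?g L"
    using iter_deriv_linear(2)[OF lin] by (simp add: smooth_lift_def fun_eq_iff L_def linear_torus_map.abs_eq)
  then have g: "smooth_torus_map ?g" by (auto simp: smooth_torus_map_def)
  obtain n' where "\<And>x. the_lift ?g x = L x + int_vec n'"
  proof -
    have "\<exists>n'. \<forall>x. the_lift ?g x = L x + int_vec n'"
      using L the_lift_smooth[OF g] unfolding smooth_lift_def
      by (intro lift_unique smooth_continuous) simp_all
    then show thesis using that by blast
  qed
  then have "the_lift ?g = (\<lambda>x. L x + int_vec n')" by (rule ext)
  then have "iter_deriv (the_lift ?g) vs x = iter_deriv L vs x"
    using vs by (simp add: iter_deriv_add_const iter_deriv_linear(2)[OF lin])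
  also have "\<dots> = (if length vs = 1 then L (hd vs) else 0)"
    using vs by (simp add: iter_deriv_linear(1)[OF lin])
  finally have "norm (iter_deriv (the_lift f) vs x - (if length vs = 1 then L (hd vs) else 0)) \<le> dist_C n f ?g"
    using iter_deriv_diff_le_dist_C[OF _ g, of f vs n x] f vs by simp
  also have "\<dots> \<le> \<delta>" using f assms by (intro dist_C_le_of_dist_C_inf) auto
  finally show "norm (iter_deriv (the_lift f) vs x - (if length vs = 1 then L (hd vs) else 0)) \<le> \<delta>" .
qed

subsection \<open>Nonstationary phase for torus maps\<close>

text \<open>Order 0 is left out because the phase estimates see only derivatives of a lift. The
  comparison values are the derivatives of the linear map: its value on the direction at order one,
  and 0 above.\<close>

definition deriv_close :: "int^2^2 \<Rightarrow> nat \<Rightarrow> real \<Rightarrow> (real^2 \<Rightarrow> real^2) \<Rightarrow> bool" where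
  "deriv_close A n \<delta> F \<longleftrightarrow> (\<forall>vs x. vs \<noteq> [] \<and> length vs \<le> n \<and> (\<forall>v\<in>set vs. norm v \<le> 1) \<longrightarrow>
     norm (iter_deriv F vs x - (if length vs = 1 then map_matrix real_of_int A *v hd vs else 0)) \<le> \<delta>)"

lemma smooth_torus_map_continuous: "smooth_torus_map f \<Longrightarrow> continuous_on UNIV f"
proof -
  assume "smooth_torus_map f"
  then obtain F where F: "smooth F" "proj_torus \<circ> F = f \<circ> proj_torus"
    by (auto simp: smooth_torus_map_def smooth_lift_def)
  have "continuous_on UNIV (proj_torus \<circ> F)"
    by (intro continuous_on_compose smooth_continuous[OF F(1)] continuous_on_subset[OF continuous_proj_torus]) simp
  then show "continuous_on UNIV f" by (simp add: continuous_on_torus_iff F(2))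
qed

lemma torus_diffeo_volume_homeo:
  "torus_diffeo f \<Longrightarrow> volume_preserving f \<Longrightarrow> volume_homeo f"
  by (simp add: torus_diffeo_def volume_homeo_def smooth_torus_map_continuous)

lemma smooth_scalar_continuous: "smooth_scalar b \<Longrightarrow> continuous_on UNIV b"
  unfolding smooth_scalar_def continuous_on_torus_iff by (rule smooth_continuous)

lemma int_vec_line_periodic:
  assumes "\<And>y n. G (y + int_vec n) = G y"
  shows "G (x + (t + 1) *\<^sub>R axis i 1) = G (shift x i t)"
proof -
  have "x + (t + 1) *\<^sub>R axis i 1 = (shift x i t) + int_vec (axis i 1)"
    by (simp add: int_vec_def vec_eq_iff axis_def algebra_simps)
  then show ?thesis by (simp only: assms)
qed

lemma smooth_scalar_Ck_bounded:
  fixes x :: "'i \<Rightarrow> real^2" and i :: "'i \<Rightarrow> 2"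
  assumes b: "smooth_scalar b"
  shows "Ck_bounded I n (\<lambda>\<iota> t. b (proj_torus (x \<iota> + t *\<^sub>R axis (i \<iota>) 1)))"
proof -
  define h where "h = b \<circ> proj_torus"
  have h: "smooth h" using b by (simp add: smooth_scalar_def h_def)
  have per: "iter_deriv h vs (y + int_vec n) = iter_deriv h vs y" for vs y n
  proof -
    have "(\<lambda>y. h (y + int_vec n)) = h" by (simp add: h_def proj_torus_add_int fun_eq_iff)
    then show ?thesis using iter_deriv_shift[OF h, of "int_vec n" vs y] by simp
  qed
  \<comment> \<open>Generalised to the m-th derivative along the line, since each differentiation
    raises \<open>m\<close> while it lowers the order \<open>n\<close>.\<close>
  have "Ck_bounded I n (\<lambda>\<iota> t. iter_deriv h (replicate m (axis (i \<iota>) 1)) (x \<iota> + t *\<^sub>R axis (i \<iota>) 1))" for m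
  proof (induction n arbitrary: m)
    case 0
    have "\<exists>K. \<forall>y. norm (iter_deriv h (replicate m (axis i 1)) y) \<le> K" for i
      by (intro continuous_periodic_bounded continuous_iter_deriv h per)
    then obtain K where K: "\<And>i y. norm (iter_deriv h (replicate m (axis i 1)) y) \<le> K i" by metis
    have "norm (iter_deriv h (replicate m (axis i 1)) y) \<le> Max (range K)" for i y
      using order_trans[OF K Max_ge[of "range K" "K i"]] by simp
    moreover have "continuous_on UNIV (\<lambda>t. iter_deriv h (replicate m (axis i 1)) (y + t *\<^sub>R axis i 1))" for i y
      by (rule continuous_on_vector_derivative[OF smooth_line_derivative[OF h]])
    ultimately show ?case
      by (auto simp: uniformly_bounded_def int_vec_line_periodic[of "iter_deriv h _", OF per])
  next
    case (Suc n)
    show ?case unfolding Ck_bounded.simps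
    proof (intro conjI exI ballI allI)
      show "uniformly_bounded I (\<lambda>\<iota> t. iter_deriv h (replicate m (axis (i \<iota>) 1)) (x \<iota> + t *\<^sub>R axis (i \<iota>) 1))"
        by (rule Ck_bounded_imp_uniformly_bounded[OF Suc.IH])
      show "((\<lambda>t. iter_deriv h (replicate m (axis (i \<iota>) 1)) (x \<iota> + t *\<^sub>R axis (i \<iota>) 1)) has_vector_derivative
          iter_deriv h (replicate (Suc m) (axis (i \<iota>) 1)) (x \<iota> + t *\<^sub>R axis (i \<iota>) 1)) (at t)" for \<iota> t
        unfolding replicate_Suc by (rule smooth_line_derivative[OF h])
      show "Ck_bounded I n (\<lambda>\<iota> t. iter_deriv h (replicate (Suc m) (axis (i \<iota>) 1)) (x \<iota> + t *\<^sub>R axis (i \<iota>) 1))"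
        by (rule Suc.IH)
    qed
  qed
  from this[of 0] show ?thesis by (simp add: h_def)
qed

lemma matrix_column_inner:
  fixes A :: "int^2^2"
  shows "int_vec k \<bullet> (map_matrix real_of_int A *v axis i 1) = int_vec (transpose A *v k) $ i"
  by (simp add: int_vec_def map_matrix_def matrix_vector_mult_def transpose_def inner_vec_def axis_def
      if_distrib mult.commute cong: if_cong)

lemma norm_le_twice_component: "\<exists>i. norm (l :: real^2) \<le> 2 * \<bar>l $ i\<bar>"
proof -
  have "norm l \<le> \<bar>l $ 1\<bar> + \<bar>l $ 2\<bar>" using norm_le_l1_cart[of l] by (simp add: UNIV_2)
  then have "norm l \<le> 2 * \<bar>l $ 1\<bar> \<or> norm l \<le> 2 * \<bar>l $ 2\<bar>" by linarith
  then show ?thesis by blast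
qed

text \<open>For \<open>m\<close> at least 1 and up to the factor 2 pi, this is the m-th derivative
  along axis \<open>i\<close> of the phase j . y - k . F y; the linear term survives in the first
  derivative only.\<close>

definition phase_velocity :: "(real^2 \<Rightarrow> real^2) \<Rightarrow> int^2 \<Rightarrow> int^2 \<Rightarrow> 2 \<Rightarrow> nat \<Rightarrow> real^2 \<Rightarrow> real" where
  "phase_velocity F k j i m y = (if m = 1 then real_of_int (j $ i) else 0) -
     int_vec k \<bullet> iter_deriv F (replicate m (axis i 1)) y"

abbreviation (input) oscillation :: "(torus \<Rightarrow> torus) \<Rightarrow> int^2 \<Rightarrow> int^2 \<Rightarrow> real^2 \<Rightarrow> 2 \<Rightarrow> real \<Rightarrow> complex" where
  "oscillation f k j x i t \<equiv> torus_char j (proj_torus (shift x i t)) * cnj (torus_char k (f (proj_torus (shift x i t))))"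

lemma oscillation_derivative:
  assumes F: "smooth_lift f F"
  shows "((oscillation f k j x i)
    has_vector_derivative (2 * pi * \<i> * phase_velocity F k j i 1 (shift x i t)) *
      (oscillation f k j x i t)) (at t)"
proof -
  have sF: "smooth F" and lift: "f (proj_torus y) = proj_torus (F y)" for y
    using F by (auto simp: smooth_lift_def fun_eq_iff)
  define \<theta> where "\<theta> t = 2 * pi * (int_vec j \<bullet> (shift x i t) - int_vec k \<bullet> F (shift x i t))" for t
  have eq: "oscillation f k j x i t = cis (\<theta> t)" for t
    by (simp add: lift torus_char_proj cis_cnj cis_mult \<theta>_def algebra_simps)
  have "((\<lambda>t. F (shift x i t)) has_vector_derivative iter_deriv F [axis i 1] (shift x i t)) (at t)"
    using smooth_line_derivative[OF sF, of "[]" x "axis i 1" t] by simp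
  then have "((\<lambda>t. int_vec k \<bullet> F (shift x i t)) has_vector_derivative
      int_vec k \<bullet> iter_deriv F [axis i 1] (shift x i t)) (at t)"
    by (rule bounded_linear.has_vector_derivative[OF bounded_linear_inner_right])
  moreover have "((\<lambda>t. int_vec j \<bullet> (shift x i t)) has_vector_derivative real_of_int (j $ i)) (at t)"
    by (auto simp: inner_add_right int_vec_axis intro!: derivative_eq_intros)
  ultimately have "(\<theta> has_vector_derivative 2 * pi * phase_velocity F k j i 1 (shift x i t)) (at t)"
    unfolding \<theta>_def[abs_def] phase_velocity_def
    by (intro has_vector_derivative_mult_right has_vector_derivative_diff) simp_all
  from has_vector_derivative_cis[OF this] show ?thesis
    unfolding eq by (simp add: mult_ac)
qed

text \<open>For the linear map the velocity is exactly minus the i-th coordinate of A^T k - j, and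
  the higher derivatives vanish. Closeness \<delta> changes this by at most |k| \<delta>, by
  Cauchy-Schwarz.\<close>

lemma phase_velocity_close:
  fixes A :: "int^2^2" and k j :: "int^2"
  assumes "deriv_close A n \<delta> F" "1 \<le> m" "m \<le> n"
  defines "l \<equiv> transpose A *v k - j"
  shows "\<bar>phase_velocity F k j i m y + (if m = 1 then int_vec l $ i else 0)\<bar> \<le> freq k * \<delta>"
proof -
  let ?D = "iter_deriv F (replicate m (axis i 1)) y - (if m = 1 then map_matrix real_of_int A *v axis i 1 else 0)"
  have "hd (replicate m (axis i 1 :: real^2)) = axis i 1" using assms(2) by (cases m) auto
  moreover have "replicate m (axis i 1 :: real^2) \<noteq> [] \<and> length (replicate m (axis i 1 :: real^2)) \<le> n \<and>
      (\<forall>v\<in>set (replicate m (axis i 1 :: real^2)). norm v \<le> 1)"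
    using assms(2,3) by auto
  from assms(1)[unfolded deriv_close_def, rule_format, OF this, of y]
  have "norm (iter_deriv F (replicate m (axis i 1)) y -
      (if length (replicate m (axis i 1 :: real^2)) = 1 then map_matrix real_of_int A *v hd (replicate m (axis i 1)) else 0)) \<le> \<delta>" .
  ultimately have D: "norm ?D \<le> \<delta>" by (simp only: length_replicate)
  have "phase_velocity F k j i m y + (if m = 1 then int_vec l $ i else 0) = - (int_vec k \<bullet> ?D)"
    using matrix_column_inner[of k A i]
    by (auto simp: phase_velocity_def inner_diff_right l_def int_vec_def)
  also have "\<bar>\<dots>\<bar> \<le> freq k * norm ?D" unfolding abs_minus by (rule Cauchy_Schwarz_ineq2)
  also have "\<dots> \<le> freq k * \<delta>" using D by (intro mult_left_mono) auto
  finally show ?thesis .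
qed

text \<open>Along an axis with |l| <= 2 |l_i|, where l = A^T k - j, the radius c / 4 gives |k| c / 4
  <= |l| / 4 <= |l_i| / 2, so the perturbation removes at most half of the velocity. Closeness to
  order N + 1 is asked because the velocity, itself a first derivative, is differentiated N times.
  The amplitude is 1 for matrix entries; for the first iterate it is the source, with j = 0.\<close>

lemma oscillatory_integral_decay:
  fixes A :: "int^2^2" and c :: real
  assumes c: "c > 0" and b: "smooth_scalar b"
  shows "\<exists>B\<ge>0. \<forall>f F k j. continuous_on UNIV f \<and> smooth_lift f F \<and> deriv_close A (Suc N) (c / 4) F \<and>
      transpose A *v k \<noteq> j \<and> c * freq k \<le> norm (int_vec (transpose A *v k - j)) \<longrightarrow>
      cmod (LINT x|torus_measure. b x * (torus_char j x * cnj (torus_char k (f x))))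
        \<le> B / norm (int_vec (transpose A *v k - j)) ^ N"
proof -
  let ?J = "\<lambda>f k j x i. cmod (integral {0..1} (\<lambda>t. b (proj_torus (shift x i t)) * (oscillation f k j x i t)))"
  define l where "l k j = int_vec (transpose A *v k - j)" for k j :: "int^2"
  \<comment> \<open>The index contains everything the constant must not depend on, including the
    map, its lift and the line.\<close>
  define I where "I = {(f, F, k, j, x :: real^2, i). continuous_on UNIV f \<and> smooth_lift f F \<and> deriv_close A (Suc N) (c / 4) F \<and>
      transpose A *v k \<noteq> j \<and> c * freq k \<le> norm (l k j) \<and> norm (l k j) \<le> 2 * \<bar>l k j $ i\<bar>}"
  define E where "E = (\<lambda>(f, F :: real^2 \<Rightarrow> real^2, k, j, x, i) t. torus_char j (proj_torus (shift x i t)) *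
      cnj (torus_char k (f (proj_torus (shift x i t)) :: torus)))"
  define L where "L = (\<lambda>(f :: torus \<Rightarrow> torus, F :: real^2 \<Rightarrow> real^2, k, j, x :: real^2, i). \<bar>l k j $ i\<bar>)"
  \<comment> \<open>Velocities divided by the large parameter |l_i|, so that their bounds are
    absolute: modulus at most 3 pi, and for m = 1 at least pi.\<close>
  define u where "u m = (\<lambda>(f :: torus \<Rightarrow> torus, F, k, j, x, i) t.
      (2 * pi * \<i> / \<bar>l k j $ i\<bar>) * phase_velocity F k j i m (shift x i t))" for m
  have lpos: "0 < norm (l k j)" if "transpose A *v k \<noteq> j" for k j
  proof -
    have "1 \<le> norm (l k j)" unfolding l_def by (rule norm_int_vec_ge_1) (use that in simp)
    then show ?thesis by linarith
  qed
  have Ipos: "0 < \<bar>l k j $ i\<bar>" if "(f, F, k, j, x, i) \<in> I" for f F k j x i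
    using that lpos[of k j] by (auto simp: I_def)
  have kl: "freq k * (c / 4) \<le> \<bar>l k j $ i\<bar> / 2" if "(f, F, k, j, x, i) \<in> I" for f F k j x i
    using that by (auto simp: I_def mult.commute)
  have close: "\<bar>phase_velocity F k j i m y + (if m = 1 then l k j $ i else 0)\<bar> \<le> \<bar>l k j $ i\<bar> / 2"
    if "(f, F, k, j, x, i) \<in> I" "1 \<le> m" "m \<le> Suc N" for f F k j x i m y
  proof -
    have "deriv_close A (Suc N) (c / 4) F" using that(1) by (simp add: I_def)
    from order_trans[OF phase_velocity_close[OF this that(2,3), of k j i y] kl[OF that(1)]]
    show ?thesis unfolding l_def .
  qed
  have ub: "cmod (u m (f, F, k, j, x, i) t) \<le> 2 * pi * (3 / 2)"
    if "(f, F, k, j, x, i) \<in> I" "1 \<le> m" "m \<le> Suc N" for f F k j x i m t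
  proof -
    have "\<bar>phase_velocity F k j i m (shift x i t)\<bar> \<le> \<bar>l k j $ i\<bar> * (3 / 2)"
    proof -
      define z where "z = (if m = 1 then l k j $ i else 0)"
      have "\<bar>phase_velocity F k j i m (shift x i t) + z\<bar> \<le> \<bar>l k j $ i\<bar> / 2"
        unfolding z_def by (rule close[OF that])
      moreover have "\<bar>z\<bar> \<le> \<bar>l k j $ i\<bar>" by (simp add: z_def)
      ultimately show ?thesis by linarith
    qed
    then show ?thesis using Ipos[OF that(1)]
      by (simp add: u_def norm_mult norm_divide field_simps)
  qed
  \<comment> \<open>\<open>u (Suc m)\<close> is the derivative of \<open>u m\<close>: one more
    derivative trades \<open>n\<close> for \<open>m\<close>, and m + n <= N + 1 stays within the
    orders controlled by \<open>deriv_close\<close>.\<close>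
  have Ck: "Ck_bounded I n (u m)" if "1 \<le> m" "m + n \<le> Suc N" for n m
    using that
  proof (induction n arbitrary: m)
    case 0
    have "cmod (u m \<iota> t) \<le> 2 * pi * (3 / 2)" if "\<iota> \<in> I" for \<iota> t
      using ub that 0 by (cases \<iota>) auto
    moreover have "continuous_on UNIV (u m \<iota>) \<and> (\<forall>t. u m \<iota> (t + 1) = u m \<iota> t)" if "\<iota> \<in> I" for \<iota>
    proof -
      obtain f F k j x i where \<iota>: "\<iota> = (f, F, k, j, x, i)" by (cases \<iota>)
      have F: "smooth_lift f F" "smooth F" using that by (auto simp: \<iota> I_def smooth_lift_def)
      have "replicate m (axis i 1 :: real^2) \<noteq> []" using 0 by auto
      then have "iter_deriv F (replicate m (axis i 1)) (x + (t + 1) *\<^sub>R axis i 1) =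
          iter_deriv F (replicate m (axis i 1)) (shift x i t)" for t
        by (intro int_vec_line_periodic iter_deriv_lift_periodic[OF F(1)])
      moreover have "continuous_on UNIV (\<lambda>t. iter_deriv F (replicate m (axis i 1)) (shift x i t))"
        by (rule continuous_on_vector_derivative[OF smooth_line_derivative[OF F(2)]])
      ultimately show ?thesis using Ipos[OF that[unfolded \<iota>]]
        by (auto simp: u_def \<iota> phase_velocity_def intro!: continuous_intros)
    qed
    ultimately show ?case unfolding Ck_bounded.simps uniformly_bounded_def
      by (intro conjI exI[of _ "2 * pi * (3 / 2)"] ballI allI) simp_all
  next
    case (Suc n)
    have "(u m \<iota> has_vector_derivative u (Suc m) \<iota> t) (at t)" if "\<iota> \<in> I" for \<iota> t
    proof -
      obtain f F k j x i where \<iota>: "\<iota> = (f, F, k, j, x, i)" by (cases \<iota>)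
      have F: "smooth F" using that by (auto simp: \<iota> I_def smooth_lift_def)
      have "((\<lambda>t. int_vec k \<bullet> iter_deriv F (replicate m (axis i 1)) (shift x i t)) has_vector_derivative
        int_vec k \<bullet> iter_deriv F (replicate (Suc m) (axis i 1)) (shift x i t)) (at t)"
        unfolding replicate_Suc
        by (rule bounded_linear.has_vector_derivative[OF bounded_linear_inner_right smooth_line_derivative[OF F]])
      from has_vector_derivative_diff[OF has_vector_derivative_const this, of "if m = 1 then real_of_int (j $ i) else 0"]
      have "((\<lambda>t. phase_velocity F k j i m (shift x i t)) has_vector_derivative
          phase_velocity F k j i (Suc m) (shift x i t)) (at t)"
        using Suc.prems by (simp add: phase_velocity_def)
      then show ?thesis unfolding u_def \<iota> prod.case
        by (intro has_vector_derivative_mult_right has_vector_derivative_of_real)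
          (simp add: has_real_derivative_iff_has_vector_derivative)
    qed
    moreover have "Ck_bounded I n (u m)" "Ck_bounded I n (u (Suc m))"
      using Suc.prems by (intro Suc.IH; simp)+
    ultimately show ?case unfolding Ck_bounded.simps
      by (intro conjI exI[of _ "u (Suc m)"] ballI allI) (simp_all add: Ck_bounded_imp_uniformly_bounded)
  qed
  have "\<exists>B. \<forall>\<iota>\<in>I. cmod (integral {0..1} (\<lambda>t. E \<iota> t * (\<lambda>(f, F, k, j, x, i) t. b (proj_torus (shift x i t))) \<iota> t)) \<le> B / L \<iota> ^ N"
  proof (rule nonstationary_phase[where \<omega> = "u 1" and c = "pi"])
    fix \<iota> t assume "\<iota> \<in> I"
    obtain f F k j x i where \<iota>: "\<iota> = (f, F, k, j, x, i)" by (cases \<iota>)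
    note I = \<open>\<iota> \<in> I\<close>[unfolded \<iota>]
    have F: "smooth_lift f F" using I by (auto simp: I_def)
    show "0 < L \<iota>" using Ipos[OF I] by (simp add: L_def \<iota>)
    show "(E \<iota> has_vector_derivative L \<iota> * u 1 \<iota> t * E \<iota> t) (at t)"
      using oscillation_derivative[OF F, of j x i k t] Ipos[OF I] by (simp add: E_def L_def u_def \<iota>)
    show "cmod (E \<iota> t) \<le> 1" by (simp add: E_def \<iota> norm_mult)
    show "E \<iota> (t + 1) = E \<iota> t" by (simp add: E_def \<iota> proj_torus_add_axis)
    have "\<bar>l k j $ i\<bar> / 2 \<le> \<bar>phase_velocity F k j i 1 (shift x i t)\<bar>"
    proof -
      have "\<bar>phase_velocity F k j i 1 (shift x i t) + l k j $ i\<bar> \<le> \<bar>l k j $ i\<bar> / 2"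
        using close[OF I, of 1 "x + t *\<^sub>R axis i 1"] by simp
      then show ?thesis by linarith
    qed
    then show "pi \<le> cmod (u 1 \<iota> t)"
      using Ipos[OF I] by (simp add: u_def \<iota> norm_mult norm_divide field_simps)
  next
    show "Ck_bounded I N (u 1)" by (rule Ck) auto
    show "Ck_bounded I N (\<lambda>\<iota>. (\<lambda>(f, F, k, j, x, i) t. b (proj_torus (shift x i t))) \<iota>)"
      using smooth_scalar_Ck_bounded[OF b, of I N "\<lambda>(f, F, k, j, x, i). x" "\<lambda>(f, F, k, j, x, i). i"]
      by (simp add: split_beta)
  qed simp
  then obtain B where B: "\<And>f F k j x i. (f, F, k, j, x, i) \<in> I \<Longrightarrow>
      ?J f k j x i \<le> B / \<bar>l k j $ i\<bar> ^ N"
  proof -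
    assume that: "\<And>B. (\<And>f F k j x i. (f, F, k, j, x, i) \<in> I \<Longrightarrow>
      ?J f k j x i \<le> B / \<bar>l k j $ i\<bar> ^ N) \<Longrightarrow> thesis"
    assume "\<exists>B. \<forall>\<iota>\<in>I. cmod (integral {0..1} (\<lambda>t. E \<iota> t * (\<lambda>(f, F, k, j, x, i) t. b (proj_torus (shift x i t))) \<iota> t)) \<le> B / L \<iota> ^ N"
    then obtain B where B: "\<forall>\<iota>\<in>I. cmod (integral {0..1} (\<lambda>t. E \<iota> t * (\<lambda>(f, F, k, j, x, i) t. b (proj_torus (shift x i t))) \<iota> t)) \<le> B / L \<iota> ^ N" ..
    show thesis
      by (rule that[of B]) (use bspec[OF B] in \<open>fastforce simp: E_def L_def mult.commute\<close>)
  qed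
  show ?thesis unfolding l_def[symmetric]
  \<comment> \<open>The maximum is taken because the sign of \<open>B\<close> is unknown; 2^N passes
    from |l_i| to |l|.\<close>
  proof (intro exI[of _ "max B 0 * 2 ^ N"] conjI allI impI)
    fix f F k j
    assume h: "continuous_on UNIV f \<and> smooth_lift f F \<and> deriv_close A (Suc N) (c / 4) F \<and>
      transpose A *v k \<noteq> j \<and> c * freq k \<le> norm (l k j)"
    obtain i where i: "norm (l k j) \<le> 2 * \<bar>l k j $ i\<bar>" using norm_le_twice_component by blast
    have li: "0 < norm (l k j)" using lpos h by blast
    show "cmod (LINT x|torus_measure. b x * (torus_char j x * cnj (torus_char k (f x)))) \<le> max B 0 * 2 ^ N / norm (l k j) ^ N"
    proof (rule torus_integral_bound[where i = i])
      show "continuous_on UNIV (\<lambda>x. b x * (torus_char j x * cnj (torus_char k (f x))))"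
        using h by (intro continuous_intros continuous_torus_char smooth_scalar_continuous b
            continuous_on_compose2[OF continuous_torus_char]) auto
      fix x :: "real^2"
      have "(f, F, k, j, x, i) \<in> I" using h i by (simp add: I_def)
      from B[OF this]
      have "?J f k j x i \<le> B / \<bar>l k j $ i\<bar> ^ N" .
      also have "\<dots> \<le> max B 0 / \<bar>l k j $ i\<bar> ^ N" by (intro divide_right_mono) auto
      also have "\<dots> \<le> max B 0 / (norm (l k j) / 2) ^ N"
        using i li by (intro divide_left_mono power_mono mult_pos_pos zero_less_power) auto
      also have "\<dots> = max B 0 * 2 ^ N / norm (l k j) ^ N" by (simp add: power_divide)
      finally show "?J f k j x i \<le> max B 0 * 2 ^ N / norm (l k j) ^ N" .
    qed
  qed simp
qed

text \<open>The first-order estimate with \<rho> the relative error of the velocity against its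
  unperturbed value -l_i. It gives no decay in l, but a factor proportional to \<delta> from
  closeness of the first derivative alone.\<close>

lemma oscillatory_integral_small:
  fixes A :: "int^2^2" and c \<delta> :: real
  assumes c: "c > 0" and f: "continuous_on UNIV f" "smooth_lift f F" and close: "deriv_close A 1 \<delta> F" and \<delta>: "0 \<le> \<delta>"
    and jk: "transpose A *v k \<noteq> j" "c * freq k \<le> norm (int_vec (transpose A *v k - j))"
  shows "cmod (LINT x|torus_measure. torus_char j x * cnj (torus_char k (f x))) \<le> 2 * \<delta> / c"
proof -
  define l where "l = int_vec (transpose A *v k - j)"
  obtain i where i: "norm l \<le> 2 * \<bar>l $ i\<bar>" using norm_le_twice_component by blast
  have "1 \<le> norm l" unfolding l_def using jk by (intro norm_int_vec_ge_1) simp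
  then have li: "0 < \<bar>l $ i\<bar>" using i by simp
  have kl: "freq k * \<delta> / \<bar>l $ i\<bar> \<le> 2 * \<delta> / c"
  proof -
    have "c * freq k \<le> 2 * \<bar>l $ i\<bar>" using jk(2) i by (simp add: l_def)
    from mult_right_mono[OF this \<delta>] show ?thesis using li c by (simp add: field_simps)
  qed
  show ?thesis
  proof (rule torus_integral_bound[where i = i])
    show "continuous_on UNIV (\<lambda>x. torus_char j x * cnj (torus_char k (f x)))"
      using f by (intro continuous_intros continuous_torus_char continuous_on_compose2[OF continuous_torus_char]) auto
    fix x :: "real^2"
    define v where "v t = phase_velocity F k j i 1 (shift x i t)" for t
    define E where "E t = oscillation f k j x i t" for t
    define \<rho> where "\<rho> t = complex_of_real ((v t + l $ i) / (- (l $ i)))" for t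
    have "cmod (integral {0..1} E) \<le> 2 * \<delta> / c"
    proof (rule nonstationary_phase_first_order)
      show "(E has_vector_derivative (2 * pi * \<i> * (- (l $ i))) * (1 + \<rho> t) * E t) (at t)" for t
      proof -
        have "- (l $ i) * (1 + (v t + l $ i) / (- (l $ i))) = v t" using li by (simp add: field_simps)
        then have "complex_of_real (- (l $ i)) * (1 + \<rho> t) = v t"
          unfolding \<rho>_def by (metis of_real_1 of_real_add of_real_mult)
        then have "2 * pi * \<i> * (- (l $ i)) * (1 + \<rho> t) = 2 * pi * \<i> * v t"
          by (metis mult.assoc)
        then show ?thesis using oscillation_derivative[OF f(2), of j x i k t] by (simp only: E_def[abs_def] v_def)
      qed
      show "cmod (E t) \<le> 1" for t by (simp add: E_def norm_mult)
      show "E 1 = E 0" unfolding E_def using proj_torus_add_axis[of x 0 i] by simp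
      show "complex_of_real (2 * pi) * \<i> * (- (l $ i)) \<noteq> 0" using li by auto
      show "cmod (\<rho> t) \<le> 2 * \<delta> / c" for t
      proof -
        have "\<bar>v t + l $ i\<bar> / \<bar>l $ i\<bar> \<le> freq k * \<delta> / \<bar>l $ i\<bar>"
          using phase_velocity_close[OF close, of 1 k j i "x + t *\<^sub>R axis i 1"]
          by (intro divide_right_mono) (auto simp: v_def l_def)
        with kl show ?thesis unfolding \<rho>_def norm_of_real abs_divide abs_minus by linarith
      qed
      have "smooth F" using f by (simp add: smooth_lift_def)
      then have "continuous_on UNIV (\<lambda>t. iter_deriv F (replicate 1 (axis i 1)) (shift x i t))"
        by (rule continuous_on_vector_derivative[OF smooth_line_derivative])
      then show "continuous_on UNIV \<rho>"
        unfolding \<rho>_def v_def phase_velocity_def using li by (intro continuous_intros) auto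
    qed
    then show "cmod (integral {0..1} (oscillation f k j x i)) \<le> 2 * \<delta> / c"
      unfolding E_def[abs_def] .
  qed
qed

subsection \<open>Random series\<close>

lemma in_L2_integrable_cmod:
  assumes "in_L2 h"
  shows "integrable torus_measure (\<lambda>x. cmod (h x))"
proof (rule Bochner_Integration.integrable_bound)
  interpret prob_space torus_measure by (rule prob_space_torus_measure)
  show "integrable torus_measure (\<lambda>x. 1 + (cmod (h x))\<^sup>2)" using assms by (simp add: in_L2_def)
  have "a \<le> 1 + a\<^sup>2" for a :: real using sum_squares_bound[of a 1] by (simp add: power2_eq_square) (smt (verit) zero_le_square)
  then show "AE x in torus_measure. norm (cmod (h x)) \<le> norm (1 + (cmod (h x))\<^sup>2)" by simp
qed (use assms in \<open>auto simp: in_L2_def\<close>)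

lemma in_L2_imp_integrable_fourier:
  assumes "in_L2 h"
  shows "integrable torus_measure (\<lambda>x. h x * cnj (torus_char k x))"
  by (rule Bochner_Integration.integrable_bound[OF in_L2_integrable_cmod[OF assms]])
    (use assms borel_measurable_torus[OF continuous_on_cnj[OF continuous_torus_char]] in \<open>auto simp: in_L2_def norm_mult\<close>)

text \<open>Nonnegativity of the variance of |h| on a probability space serves as the Cauchy-Schwarz
  inequality.\<close>

lemma cmod_fourier_coeff_le_L2_norm:
  assumes "in_L2 h"
  shows "cmod (fourier_coeff h k) \<le> L2_norm h"
proof -
  interpret prob_space torus_measure by (rule prob_space_torus_measure)
  have "integrable torus_measure (\<lambda>x. (cmod (h x))\<^sup>2)" using assms by (simp add: in_L2_def)
  note eq = variance_eq[OF in_L2_integrable_cmod[OF assms] this]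
  have "0 \<le> variance (\<lambda>x. cmod (h x))" by (rule variance_positive)
  then have "(LINT x|torus_measure. cmod (h x))\<^sup>2 \<le> (LINT x|torus_measure. (cmod (h x))\<^sup>2)"
    by (simp add: eq)
  then have "(LINT x|torus_measure. cmod (h x)) \<le> L2_norm h"
    unfolding L2_norm_def by (rule real_le_rsqrt)
  moreover have "cmod (fourier_coeff h k) \<le> (LINT x|torus_measure. cmod (h x * cnj (torus_char k x)))"
    unfolding fourier_coeff_def by (rule integral_norm_bound)
  ultimately show ?thesis by (simp add: norm_mult)
qed

lemma in_L2_continuous: "continuous_on UNIV h \<Longrightarrow> in_L2 h"
  unfolding in_L2_def
  by (intro conjI borel_measurable_torus integrable_torus_continuous continuous_intros)

lemma in_L2_diff:
  assumes "in_L2 g" "in_L2 h"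
  shows "in_L2 (\<lambda>x. g x - h x)"
proof -
  have [measurable]: "g \<in> borel_measurable torus_measure" "h \<in> borel_measurable torus_measure"
    using assms by (auto simp: in_L2_def)
  have "integrable torus_measure (\<lambda>x. (cmod (g x - h x))\<^sup>2)"
  proof (rule Bochner_Integration.integrable_bound)
    show "integrable torus_measure (\<lambda>x. 2 * (cmod (g x))\<^sup>2 + 2 * (cmod (h x))\<^sup>2)"
      using assms by (simp add: in_L2_def)
    have "(cmod (g x - h x))\<^sup>2 \<le> 2 * (cmod (g x))\<^sup>2 + 2 * (cmod (h x))\<^sup>2" for x
    proof -
      have "(cmod (g x - h x))\<^sup>2 \<le> (cmod (g x) + cmod (h x))\<^sup>2"
        by (intro power_mono norm_triangle_ineq4) simp
      also have "\<dots> \<le> 2 * (cmod (g x))\<^sup>2 + 2 * (cmod (h x))\<^sup>2"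
        using sum_squares_bound[of "cmod (g x)" "cmod (h x)"] by (simp add: power2_sum)
      finally show ?thesis .
    qed
    then show "AE x in torus_measure. norm ((cmod (g x - h x))\<^sup>2) \<le> norm (2 * (cmod (g x))\<^sup>2 + 2 * (cmod (h x))\<^sup>2)"
      by simp
  qed measurable
  then show ?thesis using assms by (simp add: in_L2_def)
qed

text \<open>Coefficients are continuous in L2, so the identity holds for every function that
  represents the sum, hence also for the one picked by \<open>L2_suminf\<close>.\<close>

lemma L2_sums_fourier_coeff:
  assumes "L2_sums u h" "\<And>n. continuous_on UNIV (u n)"
  shows "(\<lambda>n. fourier_coeff (u n) k) sums fourier_coeff h k"
  unfolding sums_def
proof (rule LIM_zero_cancel, rule Lim_null_comparison)
  have h: "in_L2 h" and lim: "(\<lambda>N. L2_norm (\<lambda>x. (\<Sum>n<N. u n x) - h x)) \<longlonglongrightarrow> 0"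
    using assms(1) by (auto simp: L2_sums_def)
  show "(\<lambda>N. L2_norm (\<lambda>x. (\<Sum>n<N. u n x) - h x)) \<longlonglongrightarrow> 0" by (rule lim)
  have "norm ((\<Sum>n<N. fourier_coeff (u n) k) - fourier_coeff h k) \<le> L2_norm (\<lambda>x. (\<Sum>n<N. u n x) - h x)" for N
  proof -
    have c: "continuous_on UNIV (\<lambda>x. \<Sum>n<N. u n x)" by (intro continuous_intros assms(2))
    have "(\<Sum>n<N. fourier_coeff (u n) k) = fourier_coeff (\<lambda>x. \<Sum>n<N. u n x) k"
      using fourier_coeff_sum[of "{..<N}" u "\<lambda>_. 1" k] assms(2) by simp
    moreover have "fourier_coeff (\<lambda>x. \<Sum>n<N. u n x) k - fourier_coeff h k = fourier_coeff (\<lambda>x. (\<Sum>n<N. u n x) - h x) k"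
      unfolding fourier_coeff_def left_diff_distrib
      by (rule Bochner_Integration.integral_diff[symmetric])
        (rule in_L2_imp_integrable_fourier[OF in_L2_continuous[OF c]] in_L2_imp_integrable_fourier[OF h])+
    ultimately show ?thesis
      using cmod_fourier_coeff_le_L2_norm[OF in_L2_diff[OF in_L2_continuous[OF c] h]] by simp
  qed
  then show "\<forall>\<^sub>F N in sequentially. norm ((\<Sum>n<N. fourier_coeff (u n) k) - fourier_coeff h k) \<le> L2_norm (\<lambda>x. (\<Sum>n<N. u n x) - h x)"
    by simp
qed

text \<open>Supplies the witness for the choice in \<open>L2_suminf\<close>: on a probability space
  uniform convergence implies convergence in L2.\<close>

lemma L2_sums_uniform:
  assumes u: "\<And>n. continuous_on UNIV (u n)" "\<And>n x. cmod (u n x) \<le> G n" and G: "summable G"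
  shows "L2_sums u (\<lambda>x. \<Sum>n. u n x)"
proof -
  have lim: "uniform_limit UNIV (\<lambda>N x. \<Sum>n<N. u n x) (\<lambda>x. \<Sum>n. u n x) sequentially"
    by (rule Weierstrass_m_test[OF _ G]) (use u in auto)
  have cN: "continuous_on UNIV (\<lambda>x. \<Sum>n<N. u n x)" for N by (intro continuous_intros u)
  have c: "continuous_on UNIV (\<lambda>x. \<Sum>n. u n x)"
    by (rule uniform_limit_theorem[OF _ lim]) (auto simp: cN)
  have "(\<lambda>N. L2_norm (\<lambda>x. (\<Sum>n<N. u n x) - (\<Sum>n. u n x))) \<longlonglongrightarrow> 0"
  proof (rule tendstoI)
    interpret prob_space torus_measure by (rule prob_space_torus_measure)
    fix e :: real assume e: "e > 0"
    then have "\<forall>\<^sub>F N in sequentially. \<forall>x\<in>UNIV. dist (\<Sum>n<N. u n x) (\<Sum>n. u n x) < e / 2"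
      by (intro uniform_limitD[OF lim]) simp
    then show "\<forall>\<^sub>F N in sequentially. dist (L2_norm (\<lambda>x. (\<Sum>n<N. u n x) - (\<Sum>n. u n x))) 0 < e"
    proof eventually_elim
      case (elim N)
      have "(cmod ((\<Sum>n<N. u n x) - (\<Sum>n. u n x)))\<^sup>2 \<le> (e / 2)\<^sup>2" for x
        using elim by (intro power_mono) (auto simp: dist_norm less_imp_le)
      then have "(LINT x|torus_measure. (cmod ((\<Sum>n<N. u n x) - (\<Sum>n. u n x)))\<^sup>2) \<le> (e / 2)\<^sup>2"
        by (intro integral_le_const integrable_torus_continuous continuous_on_power continuous_on_norm
            continuous_on_diff cN c) simp_all
      then have "L2_norm (\<lambda>x. (\<Sum>n<N. u n x) - (\<Sum>n. u n x)) \<le> e / 2"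
        unfolding L2_norm_def using e by (intro real_le_lsqrt) auto
      moreover have "0 \<le> L2_norm (\<lambda>x. (\<Sum>n<N. u n x) - (\<Sum>n. u n x))" by (simp add: L2_norm_def)
      ultimately show ?case using e by simp
    qed
  qed
  then show ?thesis using in_L2_continuous[OF u(1)] in_L2_continuous[OF c] by (simp add: L2_sums_def)
qed

lemma fourier_coeff_L2_suminf:
  assumes u: "\<And>n. continuous_on UNIV (u n)" "\<And>n x. cmod (u n x) \<le> G n" and G: "summable G"
  shows "(\<lambda>n. fourier_coeff (u n) k) sums fourier_coeff (L2_suminf u) k"
proof (rule L2_sums_fourier_coeff[OF _ u(1)])
  show "L2_sums u (L2_suminf u)"
    unfolding L2_suminf_def by (rule someI[of "L2_sums u"]) (rule L2_sums_uniform[OF assms])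
qed

section \<open>Second moments of random series\<close>

lemma normalized_iid_moments:
  assumes "normalized_iid M \<eta>"
  shows "\<eta> n \<in> borel_measurable M" "integrable M (\<eta> n)" "integrable M (\<lambda>w. (\<eta> n w)\<^sup>2)"
    "(LINT w|M. \<eta> n w) = 0" "(LINT w|M. (\<eta> n w)\<^sup>2) = 1"
    "m \<noteq> n \<Longrightarrow> (LINT w|M. \<eta> m w * \<eta> n w) = 0" "integrable M (\<lambda>w. \<eta> m w * \<eta> n w)"
proof -
  interpret prob_space M using assms by (simp add: normalized_iid_def)
  have ind: "indep_vars (\<lambda>_. borel) \<eta> UNIV" and eq: "\<And>n. distr M borel (\<eta> n) = distr M borel (\<eta> 0)"
    and i0: "integrable M (\<lambda>w. (\<eta> 0 w)\<^sup>2)" and e0: "expectation (\<eta> 0) = 0" and v0: "variance (\<eta> 0) = 1"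
    using assms unfolding normalized_iid_def by blast+
  have meas: "\<eta> n \<in> borel_measurable M" for n using ind by (simp add: indep_vars_def)
  then show "\<eta> n \<in> borel_measurable M" .
  have "integrable (distr M borel (\<eta> n)) (\<lambda>x. x\<^sup>2)" for n
    unfolding eq[of n] using i0 meas by (simp add: integrable_distr_eq)
  then have i2: "integrable M (\<lambda>w. (\<eta> n w)\<^sup>2)" for n
    using meas by (simp add: integrable_distr_eq)
  then show "integrable M (\<lambda>w. (\<eta> n w)\<^sup>2)" .
  have i1: "integrable M (\<eta> n)" for n
    by (rule square_integrable_imp_integrable[OF meas i2])
  then show "integrable M (\<eta> n)" .
  have e: "expectation (\<eta> n) = 0" for n
  proof -
    have "expectation (\<eta> n) = (LINT x|distr M borel (\<eta> n). x)" using meas by (simp add: integral_distr)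
    also have "\<dots> = expectation (\<eta> 0)" unfolding eq[of n] using meas by (simp add: integral_distr)
    finally show ?thesis using e0 by simp
  qed
  then show "(LINT w|M. \<eta> n w) = 0" .
  have "(LINT w|M. (\<eta> n w)\<^sup>2) = (LINT x|distr M borel (\<eta> n). x\<^sup>2)" using meas by (simp add: integral_distr)
  also have "\<dots> = (LINT w|M. (\<eta> 0 w)\<^sup>2)" unfolding eq[of n] using meas by (simp add: integral_distr)
  also have "\<dots> = 1" using v0 by (simp add: e0)
  finally show "(LINT w|M. (\<eta> n w)\<^sup>2) = 1" .
  have prod: "expectation (\<lambda>w. \<eta> m w * \<eta> n w) = 0 \<and> integrable M (\<lambda>w. \<eta> m w * \<eta> n w)" if "m \<noteq> n"
  proof -
    have "indep_vars (\<lambda>_. borel) \<eta> {m, n}" by (rule indep_vars_subset[OF ind]) simp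
    from indep_vars_lebesgue_integral[OF _ this] indep_vars_integrable[OF _ this] i1 that e
    show ?thesis by simp
  qed
  then show "m \<noteq> n \<Longrightarrow> (LINT w|M. \<eta> m w * \<eta> n w) = 0" by simp
  show "integrable M (\<lambda>w. \<eta> m w * \<eta> n w)"
    using prod i2[of n] by (cases "m = n") (auto simp: power2_eq_square)
qed

text \<open>Independence and mean 0 remove the mixed terms. The result is stated as a nonnegative
  integral, ready for Fatou's lemma.\<close>

lemma second_moment_sum:
  assumes \<eta>: "normalized_iid M \<eta>"
  shows "(\<integral>\<^sup>+ w. ennreal ((cmod (\<Sum>n<N. complex_of_real (\<eta> n w) * c n))\<^sup>2) \<partial>M) = ennreal (\<Sum>n<N. (cmod (c n))\<^sup>2)"
proof -
  have expand: "(cmod (\<Sum>n<N. complex_of_real (\<eta> n w) * c n))\<^sup>2 = (\<Sum>m<N. \<Sum>n<N. (\<eta> m w * \<eta> n w) * Re (c m * cnj (c n)))" for w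
  proof -
    have "complex_of_real ((cmod (\<Sum>n<N. complex_of_real (\<eta> n w) * c n))\<^sup>2) =
       (\<Sum>m<N. \<Sum>n<N. complex_of_real (\<eta> m w * \<eta> n w) * (c m * cnj (c n)))"
      unfolding complex_norm_square cnj_sum sum_product by (simp add: mult_ac)
    from arg_cong[OF this, of Re] show ?thesis by (simp del: of_real_mult complex_cnj_mult mult.assoc)
  qed
  have int: "integrable M (\<lambda>w. \<Sum>m<N. \<Sum>n<N. (\<eta> m w * \<eta> n w) * Re (c m * cnj (c n)))"
    by (intro Bochner_Integration.integrable_sum integrable_mult_left normalized_iid_moments(7)[OF \<eta>])
  have "(\<integral>\<^sup>+ w. ennreal ((cmod (\<Sum>n<N. complex_of_real (\<eta> n w) * c n))\<^sup>2) \<partial>M) =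
      ennreal (LINT w|M. (\<Sum>m<N. \<Sum>n<N. (\<eta> m w * \<eta> n w) * Re (c m * cnj (c n))))"
    unfolding expand by (rule nn_integral_eq_integral[OF int], rule AE_I2) (simp only: expand[symmetric] zero_le_power2)
  also have "(LINT w|M. (\<Sum>m<N. \<Sum>n<N. (\<eta> m w * \<eta> n w) * Re (c m * cnj (c n)))) =
      (\<Sum>m<N. \<Sum>n<N. (LINT w|M. \<eta> m w * \<eta> n w) * Re (c m * cnj (c n)))"
    by (subst Bochner_Integration.integral_sum, intro Bochner_Integration.integrable_sum integrable_mult_left
        normalized_iid_moments(7)[OF \<eta>], intro sum.cong refl, subst Bochner_Integration.integral_sum,
        intro integrable_mult_left normalized_iid_moments(7)[OF \<eta>], simp)
  also have "\<dots> = (\<Sum>m<N. \<Sum>n<N. if m = n then (cmod (c m))\<^sup>2 else 0)"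
  proof (intro sum.cong refl)
    fix m n
    have "Re (c m * cnj (c m)) = (cmod (c m))\<^sup>2" unfolding cmod_power2 by (simp add: power2_eq_square)
    moreover have "(LINT w|M. \<eta> n w * \<eta> n w) = 1"
      using normalized_iid_moments(5)[OF \<eta>] by (simp add: power2_eq_square)
    ultimately show "(LINT w|M. \<eta> m w * \<eta> n w) * Re (c m * cnj (c n)) = (if m = n then (cmod (c m))\<^sup>2 else 0)"
      using normalized_iid_moments(6)[OF \<eta>] by (cases "m = n") (simp_all del: times_complex.sel)
  qed
  also have "\<dots> = (\<Sum>n<N. (cmod (c n))\<^sup>2)" by (simp add: sum.delta)
  finally show ?thesis .
qed

text \<open>The sup bounds \<open>G\<close> give absolute convergence almost surely; there the
  coefficient is a limit of partial sums, and Fatou's lemma carries their second moments over. Only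
  \<open>S\<close> enters the bound, so \<open>G\<close> may depend on \<kappa>.\<close>

lemma stationary_second_moment:
  assumes \<eta>: "normalized_iid M \<eta>"
    and g: "\<And>n. continuous_on UNIV (g n)" "\<And>n x. cmod (g n x) \<le> G n" and G: "summable G"
    and S: "\<And>N. (\<Sum>n<N. (cmod (fourier_coeff (g n) k))\<^sup>2) \<le> S"
  shows "(\<integral>\<^sup>+ w. ennreal ((cmod (fourier_coeff (L2_suminf (\<lambda>n x. complex_of_real (\<eta> n w) * g n x)) k))\<^sup>2) \<partial>M) \<le> ennreal S"
proof -
  let ?c = "\<lambda>w. fourier_coeff (L2_suminf (\<lambda>n x. complex_of_real (\<eta> n w) * g n x)) k"
  interpret prob_space M using \<eta> by (simp add: normalized_iid_def)
  have [measurable]: "\<eta> n \<in> borel_measurable M" for n by (rule normalized_iid_moments[OF \<eta>])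
  have G0: "0 \<le> G n" for n by (rule order_trans[OF norm_ge_zero g(2)])
  define X where "X N w = (cmod (\<Sum>n<N. complex_of_real (\<eta> n w) * fourier_coeff (g n) k))\<^sup>2" for N w
  \<comment> \<open>The expected total is finite: |\<eta>| <= 1 + \<eta>^2 has expectation at most
    2, so it is at most twice the sum of \<open>G\<close>.\<close>
  have "AE w in M. (\<Sum>n. ennreal (\<bar>\<eta> n w\<bar> * G n)) \<noteq> \<infinity>"
  proof (rule nn_integral_PInf_AE)
    have ab: "(\<integral>\<^sup>+ w. ennreal (\<bar>\<eta> n w\<bar> * G n) \<partial>M) \<le> ennreal (2 * G n)" for n
    proof -
      have i: "integrable M (\<lambda>w. \<bar>\<eta> n w\<bar> * G n)"
        using normalized_iid_moments(2)[OF \<eta>, of n] by simp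
      have "(LINT w|M. \<bar>\<eta> n w\<bar>) \<le> (LINT w|M. 1 + (\<eta> n w)\<^sup>2)"
      proof (rule integral_mono)
        show "integrable M (\<lambda>w. \<bar>\<eta> n w\<bar>)" using normalized_iid_moments(2)[OF \<eta>, of n] by simp
        show "integrable M (\<lambda>w. 1 + (\<eta> n w)\<^sup>2)" using normalized_iid_moments(3)[OF \<eta>, of n] by simp
        show "\<bar>\<eta> n w\<bar> \<le> 1 + (\<eta> n w)\<^sup>2" for w
          using sum_squares_bound[of "\<bar>\<eta> n w\<bar>" 1] by simp
      qed
      also have "\<dots> = 2" using normalized_iid_moments(3,5)[OF \<eta>, of n] by (simp add: prob_space)
      finally have "(LINT w|M. \<bar>\<eta> n w\<bar>) * G n \<le> 2 * G n" using G0 by (rule mult_right_mono)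
      then have "(LINT w|M. \<bar>\<eta> n w\<bar> * G n) \<le> 2 * G n" by simp
      then show ?thesis using G0 by (subst nn_integral_eq_integral[OF i]) (auto intro: ennreal_leI)
    qed
    have "(\<integral>\<^sup>+ w. (\<Sum>n. ennreal (\<bar>\<eta> n w\<bar> * G n)) \<partial>M) = (\<Sum>n. \<integral>\<^sup>+ w. ennreal (\<bar>\<eta> n w\<bar> * G n) \<partial>M)"
      by (rule nn_integral_suminf) measurable
    also have "\<dots> \<le> (\<Sum>n. ennreal (2 * G n))" by (intro suminf_le ab) auto
    also have "\<dots> = ennreal (\<Sum>n. 2 * G n)" using G G0 by (intro suminf_ennreal2 summable_mult) auto
    finally show "(\<integral>\<^sup>+ w. (\<Sum>n. ennreal (\<bar>\<eta> n w\<bar> * G n)) \<partial>M) \<noteq> \<infinity>"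
      by (metis ennreal_neq_top infinity_ennreal_def top_unique)
  qed measurable
  then have lim: "AE w in M. ennreal ((cmod (?c w))\<^sup>2) =
      liminf (\<lambda>N. ennreal (X N w))"
  proof eventually_elim
    case (elim w)
    have sm: "summable (\<lambda>n. \<bar>\<eta> n w\<bar> * G n)"
      using elim G0 by (intro summable_suminf_not_top) (auto simp: infinity_ennreal_def)
    have "(\<lambda>n. fourier_coeff (\<lambda>x. complex_of_real (\<eta> n w) * g n x) k) sums
        ?c w"
    proof (rule fourier_coeff_L2_suminf[OF _ _ sm])
      show "continuous_on UNIV (\<lambda>x. complex_of_real (\<eta> n w) * g n x)" for n
        by (intro continuous_intros g)
      show "cmod (complex_of_real (\<eta> n w) * g n x) \<le> \<bar>\<eta> n w\<bar> * G n" for n x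
        by (simp add: norm_mult mult_left_mono g)
    qed
    moreover have "fourier_coeff (\<lambda>x. complex_of_real (\<eta> n w) * g n x) k = complex_of_real (\<eta> n w) * fourier_coeff (g n) k" for n
      by (simp add: fourier_coeff_def mult.assoc)
    ultimately have "(\<lambda>N. ennreal (X N w)) \<longlonglongrightarrow>
        ennreal ((cmod (?c w))\<^sup>2)"
      unfolding X_def by (intro tendsto_ennrealI tendsto_power tendsto_norm) (simp add: sums_def)
    then show ?case by (intro lim_imp_Liminf[symmetric]) simp_all
  qed
  have "(\<integral>\<^sup>+ w. ennreal ((cmod (?c w))\<^sup>2) \<partial>M) =
     (\<integral>\<^sup>+ w. liminf (\<lambda>N. ennreal (X N w)) \<partial>M)"
    by (rule nn_integral_cong_AE[OF lim])
  also have "\<dots> \<le> liminf (\<lambda>N. \<integral>\<^sup>+ w. ennreal (X N w) \<partial>M)"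
    by (rule nn_integral_liminf) (simp add: X_def)
  also have "\<dots> \<le> liminf (\<lambda>N::nat. ennreal S)"
    unfolding X_def second_moment_sum[OF \<eta>] by (intro Liminf_mono always_eventually allI ennreal_leI S)
  also have "\<dots> = ennreal S" by (simp add: Liminf_const)
  finally show ?thesis .
qed

subsection \<open>Pulsed diffusion\<close>

lemma cmod_transfer_coeff_le_1: "volume_homeo f \<Longrightarrow> cmod (transfer_coeff f k j) \<le> 1"
  unfolding transfer_coeff_def
  by (intro cmod_fourier_coeff_le continuous_transfer_op continuous_torus_char) (simp_all add: transfer_op_def)

lemma int_vec_0 [simp]: "int_vec 0 = 0"
  by (simp add: int_vec_def vec_eq_iff)

lemma torus_char_0 [simp]: "torus_char 0 x = 1"
  using proj_torus_surj[of x] by (auto simp: torus_char_proj)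

lemma fourier_coeff_0: "fourier_coeff h 0 = (LINT x|torus_measure. h x)"
  by (simp add: fourier_coeff_def)

lemma fourier_coeff_transfer_0:
  assumes "volume_homeo f" "continuous_on UNIV h"
  shows "fourier_coeff (transfer_op f h) 0 = fourier_coeff h 0"
  unfolding fourier_coeff_transfer[OF assms] by (simp add: fourier_coeff_0)

text \<open>The induction runs on the coefficients \<open>T\<close> before diffusion: heat does not
  increase the weighted norm, and the transfer matrix then divides its square by 4.
  \<open>M1\<close> is given from outside, whereas \<open>K\<close> in the third claim is built from
  \<open>heat_factor_decay\<close> and depends on \<kappa>.\<close>

lemma pulsed_iterates_decay:
  fixes w :: "int^2 \<Rightarrow> real"
  assumes f: "volume_homeo f" and \<kappa>: "\<kappa> > 0"
    and b: "continuous_on UNIV b" "(LINT x|torus_measure. b x) = 0"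
    and w: "\<And>k. 0 \<le> w k" "\<And>k. k \<noteq> 0 \<Longrightarrow> 1 \<le> w k * (C * (1 + freq k) ^ r)" and C: "C > 0"
    and \<epsilon>: "0 \<le> \<epsilon>" "\<epsilon> * (infsum decay UNIV)\<^sup>2 \<le> 1 / 16"
    and far: "\<And>k j. w j < 64 * w k \<Longrightarrow> (cmod (transfer_coeff f k j))\<^sup>2 * w k \<le> w j * (\<epsilon> * decay k * decay j)"
    and first: "(\<lambda>k. w k * (cmod (fourier_coeff (transfer_op f b) k))\<^sup>2) summable_on UNIV"
      "(\<Sum>\<^sub>\<infinity>k. w k * (cmod (fourier_coeff (transfer_op f b) k))\<^sup>2) \<le> M1"
  defines "g \<equiv> \<lambda>n. (pulsed_op f \<kappa> ^^ n) b"
  shows "continuous_on UNIV (g n)"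
    and "w k * (cmod (fourier_coeff (g (Suc n)) k))\<^sup>2 \<le> M1 * (1 / 4) ^ n"
    and "\<exists>K. \<forall>n x. cmod (g n x) \<le> K * (1 / 2) ^ n"
proof -
  have gS: "g (Suc n) = heat \<kappa> (transfer_op f (g n))" for n by (simp add: g_def pulsed_op_def)
  have cont: "continuous_on UNIV (g n)" for n
  proof (induction n)
    case (Suc n)
    then show ?case unfolding gS by (intro heat_continuous(1)[OF \<kappa>] continuous_transfer_op[OF f])
  qed (simp add: g_def b)
  then show "continuous_on UNIV (g n)" .
  define T where "T n k = fourier_coeff (transfer_op f (g n)) k" for n k
  define c where "c n k = fourier_coeff (g n) k" for n k
  have cT: "continuous_on UNIV (transfer_op f (g n))" for n by (intro continuous_transfer_op f cont)
  have cS: "c (Suc n) k = heat_factor \<kappa> k * T n k" for n k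
    unfolding c_def T_def gS by (rule heat_continuous(2)[OF \<kappa> cT])
  have abs: "(\<lambda>k. cmod (c (Suc n) k)) summable_on UNIV" for n
    unfolding c_def gS by (rule heat_continuous(3)[OF \<kappa> cT])
  have TS: "T (Suc n) k = (\<Sum>\<^sub>\<infinity>j. c (Suc n) j * transfer_coeff f k j)" for n k
    unfolding T_def c_def gS by (rule fourier_coeff_transfer_heat[OF f \<kappa> cT])
  \<comment> \<open>Frequency 0 has no lower bound on its weight, so the sup bound below relies on
    the mean being exactly 0.\<close>
  have c0: "c n 0 = 0" for n
  proof (induction n)
    case 0
    then show ?case using b(2) by (simp add: c_def g_def fourier_coeff_0)
  next
    case (Suc n)
    then have "T n 0 = 0"
      using fourier_coeff_transfer_0[OF f cont[of n]] by (simp add: T_def c_def)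
    then show ?case by (simp add: cS)
  qed
  have cle: "w k * (cmod (c (Suc n) k))\<^sup>2 \<le> w k * (cmod (T n k))\<^sup>2" for n k
  proof (intro mult_left_mono power_mono w)
    show "cmod (c (Suc n) k) \<le> cmod (T n k)"
      using mult_right_mono[OF heat_factor_le_1[OF \<kappa>, of k], of "cmod (T n k)"] heat_factor_nonneg[of \<kappa> k]
      by (simp add: cS norm_mult)
  qed simp
  have Q: "(\<lambda>k. w k * (cmod (T n k))\<^sup>2) summable_on UNIV \<and> (\<Sum>\<^sub>\<infinity>k. w k * (cmod (T n k))\<^sup>2) \<le> M1 * (1 / 4) ^ n" for n
  proof (induction n)
    case 0
    then show ?case using first by (simp add: T_def g_def)
  next
    case (Suc n)
    have s: "(\<lambda>k. w k * (cmod (c (Suc n) k))\<^sup>2) summable_on UNIV"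
      by (rule summable_on_comparison_test[OF conjunct1[OF Suc.IH] cle]) (simp add: w)
    have "(\<Sum>\<^sub>\<infinity>k. w k * (cmod (c (Suc n) k))\<^sup>2) \<le> (\<Sum>\<^sub>\<infinity>k. w k * (cmod (T n k))\<^sup>2)"
      by (intro infsum_mono s conjunct1[OF Suc.IH] cle)
    then have le: "(\<Sum>\<^sub>\<infinity>k. w k * (cmod (c (Suc n) k))\<^sup>2) \<le> M1 * (1 / 4) ^ n" using Suc.IH by linarith
    obtain B where B: "\<And>x. cmod (g (Suc n) x) \<le> B" using torus_continuous_bounded[OF cont] by blast
    have cB: "cmod (c (Suc n) k) \<le> B" for k unfolding c_def by (rule cmod_fourier_coeff_le[OF cont B])
    have s2: "(\<lambda>j. (cmod (c (Suc n) j))\<^sup>2) summable_on UNIV"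
    proof (rule summable_on_comparison_test)
      show "(\<lambda>j. B * cmod (c (Suc n) j)) summable_on UNIV" by (rule summable_on_cmult_right[OF abs])
      show "(cmod (c (Suc n) j))\<^sup>2 \<le> B * cmod (c (Suc n) j)" for j
        unfolding power2_eq_square by (intro mult_right_mono cB) simp
    qed simp
    have sm: "(\<lambda>j. norm (c (Suc n) j * transfer_coeff f k j)) summable_on UNIV" for k
    proof (rule summable_on_comparison_test[OF abs])
      show "norm (c (Suc n) j * transfer_coeff f k j) \<le> cmod (c (Suc n) j)" for j
        unfolding norm_mult by (intro mult_left_le cmod_transfer_coeff_le_1 f) simp
    qed simp
    have bessel: "(\<Sum>k\<in>K. (cmod (\<Sum>\<^sub>\<infinity>j\<in>S. c (Suc n) j * transfer_coeff f k j))\<^sup>2) \<le> (\<Sum>\<^sub>\<infinity>j\<in>S. (cmod (c (Suc n) j))\<^sup>2)"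
      if "finite K" for K S
      by (rule transfer_coeff_bessel[OF f abs summable_on_subset_banach[OF s2] that]) simp
    note wc = weighted_contraction[of "c (Suc n)" "transfer_coeff f" w decay \<epsilon>,
        OF bessel sm s2 w(1) s less_imp_le[OF decay_pos] summable_decay \<epsilon> far]
    from wc(1) wc(2) le show ?case by (simp add: TS)
  qed
  have wT: "w k * (cmod (T n k))\<^sup>2 \<le> M1 * (1 / 4) ^ n" for n k
    using finite_sum_le_infsum[OF conjunct1[OF Q[of n]], of "{k}"] conjunct2[OF Q[of n]] w(1) by simp
  then show "w k * (cmod (fourier_coeff (g (Suc n)) k))\<^sup>2 \<le> M1 * (1 / 4) ^ n"
    using order_trans[OF cle] by (simp add: c_def)
  have M1: "0 \<le> M1" using first(2) infsum_nonneg[of UNIV "\<lambda>k. w k * (cmod (fourier_coeff (transfer_op f b) k))\<^sup>2"] w(1)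
    by (meson order_trans mult_nonneg_nonneg zero_le_power2)
  obtain H where H: "0 \<le> H" "\<And>k. heat_factor \<kappa> k * (1 + freq k) ^ r \<le> H * decay k"
    using heat_factor_decay[OF \<kappa>, of r] by blast
  define K1 where "K1 = sqrt M1 * (1 + C) * H * infsum decay UNIV"
  have gbound: "cmod (g (Suc n) x) \<le> K1 * (1 / 2) ^ n" for n x
  proof -
    have ck: "cmod (c (Suc n) k) \<le> sqrt M1 * (1 / 2) ^ n * (1 + C) * H * decay k" for k
    proof (cases "k = 0")
      case True
      then show ?thesis using M1 C H(1) decay_pos[of k] by (simp add: c0)
    next
      case False
      let ?z = "1 + freq k"
      have z1: "1 \<le> ?z ^ r" by (intro one_le_power) simp
      have "(cmod (T n k))\<^sup>2 \<le> (cmod (T n k))\<^sup>2 * (w k * (C * ?z ^ r))"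
        using mult_left_mono[OF w(2)[OF False], of "(cmod (T n k))\<^sup>2"] by simp
      also have "\<dots> = (w k * (cmod (T n k))\<^sup>2) * (C * ?z ^ r)" by (simp add: mult_ac)
      also have "\<dots> \<le> (M1 * (1 / 4) ^ n) * (C * ?z ^ r)" using C by (intro mult_right_mono wT) auto
      \<comment> \<open>Enlarged to a square so that the root can be taken; the loss in the exponent
        is covered by the heat factor.\<close>
      also have "C * ?z ^ r \<le> ((1 + C) * ?z ^ r)\<^sup>2"
      proof -
        have cc: "C \<le> (1 + C) * (1 + C)" using C by (simp add: algebra_simps)
        have zz: "?z ^ r \<le> ?z ^ r * ?z ^ r" using mult_left_mono[OF z1, of "?z ^ r"] z1 by linarith
        have "C * ?z ^ r \<le> ((1 + C) * (1 + C)) * (?z ^ r * ?z ^ r)"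
          by (rule mult_mono[OF cc zz]) (use C in auto)
        then show ?thesis by (simp add: power2_eq_square mult_ac)
      qed
      finally have "(cmod (T n k))\<^sup>2 \<le> M1 * (1 / 4) ^ n * ((1 + C) * ?z ^ r)\<^sup>2"
        using M1 by (simp add: mult_left_mono)
      also have "\<dots> = (sqrt M1 * (1 / 2) ^ n * ((1 + C) * ?z ^ r))\<^sup>2"
      proof -
        have "((1 / 2 :: real) ^ n)\<^sup>2 = (1 / 4) ^ n" by (simp add: power2_eq_square power_mult_distrib[symmetric])
        then show ?thesis unfolding power_mult_distrib[of "sqrt M1 * (1 / 2) ^ n"] power_mult_distrib[of "sqrt M1"]
          by (simp only: real_sqrt_pow2[OF M1])
      qed
      finally have Tk: "cmod (T n k) \<le> sqrt M1 * (1 / 2) ^ n * ((1 + C) * ?z ^ r)"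
        by (rule power2_le_imp_le) (intro mult_nonneg_nonneg zero_le_power real_sqrt_ge_zero M1; use C in simp)
      have "cmod (c (Suc n) k) = heat_factor \<kappa> k * cmod (T n k)"
        by (simp add: cS norm_mult heat_factor_nonneg)
      also have "\<dots> \<le> heat_factor \<kappa> k * (sqrt M1 * (1 / 2) ^ n * ((1 + C) * ?z ^ r))"
        by (intro mult_left_mono Tk heat_factor_nonneg)
      also have "\<dots> = sqrt M1 * (1 / 2) ^ n * (1 + C) * (heat_factor \<kappa> k * ?z ^ r)" by (simp add: mult_ac)
      also have "\<dots> \<le> sqrt M1 * (1 / 2) ^ n * (1 + C) * (H * decay k)"
        using M1 C by (intro mult_left_mono H(2)) auto
      finally show ?thesis by (simp add: mult_ac)
    qed
    have "cmod (g (Suc n) x) \<le> (\<Sum>\<^sub>\<infinity>k. cmod (c (Suc n) k))"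
      unfolding c_def gS by (rule heat_continuous(4)[OF \<kappa> cT])
    also have "\<dots> \<le> (\<Sum>\<^sub>\<infinity>k. sqrt M1 * (1 / 2) ^ n * (1 + C) * H * decay k)"
      by (intro infsum_mono abs summable_on_cmult_right summable_decay ck)
    also have "\<dots> = K1 * (1 / 2) ^ n" by (subst infsum_cmult_right') (simp add: K1_def mult_ac)
    finally show ?thesis .
  qed
  obtain K0 where K0: "\<And>x. cmod (b x) \<le> K0" using torus_continuous_bounded[OF b(1)] by blast
  show "\<exists>K. \<forall>n x. cmod (g n x) \<le> K * (1 / 2) ^ n"
  \<comment> \<open>\<open>K0\<close> serves n = 0; the factor 2 makes up for the index shift, since
    \<open>g (Suc m)\<close> is bounded by K1 (1/2)^m.\<close>
  proof (intro exI[of _ "max K0 (2 * K1)"] allI)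
    fix n x
    show "cmod (g n x) \<le> max K0 (2 * K1) * (1 / 2) ^ n"
    proof (cases n)
      case 0
      then show ?thesis using K0[of x] by (simp add: g_def)
    next
      case (Suc m)
      have "cmod (g n x) \<le> 2 * K1 * (1 / 2) ^ n" using gbound[of m x] by (simp add: Suc)
      also have "\<dots> \<le> max K0 (2 * K1) * (1 / 2) ^ n" by (intro mult_right_mono) auto
      finally show ?thesis .
    qed
  qed
qed

section \<open>Coefficient bounds uniform over maps close to the linear one\<close>

abbreviation (input) dual_matrix :: "int^2^2 \<Rightarrow> real^2^2" where
  "dual_matrix A \<equiv> transpose (map_matrix real_of_int A)"

lemma int_vec_transpose_mult:
  "int_vec (transpose A *v k) = dual_matrix A *v int_vec k"
  by (simp add: int_vec_def map_matrix_def matrix_vector_mult_def transpose_def vec_eq_iff)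

lemma deriv_close_mono: "deriv_close A n \<delta> F \<Longrightarrow> m \<le> n \<Longrightarrow> \<delta> \<le> \<delta>' \<Longrightarrow> deriv_close A m \<delta>' F"
  unfolding deriv_close_def by (meson order_trans)

lemma smooth_scalar_const: "smooth_scalar (\<lambda>_. a)"
proof -
  have "iter_deriv (\<lambda>_. a) vs = (\<lambda>_. if vs = [] then a else 0)" for vs :: "(real^2) list"
  proof (induction vs)
    case (Cons v vs)
    show ?case by (rule ext) (simp add: Cons)
  qed (simp add: fun_eq_iff)
  then have "smooth (\<lambda>_ :: real^2. a)" by (simp add: smooth_def)
  then show ?thesis by (simp add: smooth_scalar_def o_def)
qed

lemma transfer_coeff_eq:
  "volume_homeo f \<Longrightarrow> transfer_coeff f k j = (LINT x|torus_measure. torus_char j x * cnj (torus_char k (f x)))"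
  unfolding transfer_coeff_def by (rule fourier_coeff_transfer[OF _ continuous_torus_char])

text \<open>Constants are invariant under composition. Exact vanishing matters because frequency 0
  will have weight 0, which leaves no room for an error.\<close>

lemma transfer_coeff_0: "volume_homeo f \<Longrightarrow> k \<noteq> 0 \<Longrightarrow> transfer_coeff f k 0 = 0"
proof -
  assume f: "volume_homeo f" and k: "k \<noteq> 0"
  have "transfer_op f (torus_char 0) = torus_char 0" by (simp add: transfer_op_def fun_eq_iff)
  then show "transfer_coeff f k 0 = 0" using k by (simp add: transfer_coeff_def fourier_coeff_torus_char)
qed

text \<open>The square of an entry is at most the product of its two bounds, 2 \<delta> / c and a
  multiple of |l|^(-N) with l = A^T k - j.\<close>

lemma transfer_coeff_far_decay:
  fixes A :: "int^2^2"
  assumes c: "c > 0"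
  shows "\<exists>B\<ge>0. \<forall>\<delta> f F k j. 0 \<le> \<delta> \<and> \<delta> \<le> c / 4 \<and> volume_homeo f \<and> smooth_lift f F \<and>
      deriv_close A (Suc (2 * r + 8)) \<delta> F \<and> k \<noteq> 0 \<and>
      c * freq k < norm (int_vec (transpose A *v k) - int_vec j) \<longrightarrow>
      (cmod (transfer_coeff f k j))\<^sup>2 * ((1 + freq k) ^ r * (1 + freq j) ^ r) \<le> \<delta> * B * decay k * decay j"
proof -
  let ?m2 = "\<lambda>f k j. (cmod (transfer_coeff f k j))\<^sup>2"
  \<comment> \<open>An exponent r for each of the two polynomial weights and 4 for each of the two
    factors \<open>decay\<close>.\<close>
  define N where "N = 2 * r + 8"
  obtain B0 where B0: "0 \<le> B0" "\<And>f F k j. continuous_on UNIV f \<Longrightarrow> smooth_lift f F \<Longrightarrow> deriv_close A (Suc N) (c / 4) F \<Longrightarrow>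
      transpose A *v k \<noteq> j \<Longrightarrow> c * freq k \<le> norm (int_vec (transpose A *v k - j)) \<Longrightarrow>
      cmod (LINT x|torus_measure. 1 * (torus_char j x * cnj (torus_char k (f x))))
        \<le> B0 / norm (int_vec (transpose A *v k - j)) ^ N"
    using oscillatory_integral_decay[OF c smooth_scalar_const[of 1], of A N] by blast
  have lin: "linear ((*v) (dual_matrix A))" by (rule matrix_vector_mul_linear)
  obtain \<beta> where \<beta>: "0 < \<beta>" "\<And>x. norm (dual_matrix A *v x) \<le> \<beta> * norm x"
    using linear_bounded_pos[OF lin] by blast
  \<comment> \<open>A far pair has |k| < l / c and |j| <= \<beta> |k| + l for l = |A^T k - j|. As l
    >= 1, both 1 + |k| and 1 + |j| are at most K l.\<close>
  define K where "K = 2 + (1 + \<beta>) / c"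
  have K: "K > 0" using \<beta> c by (simp add: K_def add_pos_pos)
  show ?thesis
  proof (intro exI[of _ "2 / c * B0 * K ^ N"] conjI allI impI)
    show "0 \<le> 2 / c * B0 * K ^ N" using c B0 K by simp
    fix \<delta> f F and k j :: "int^2"
    assume h: "0 \<le> \<delta> \<and> \<delta> \<le> c / 4 \<and> volume_homeo f \<and> smooth_lift f F \<and>
      deriv_close A (Suc (2 * r + 8)) \<delta> F \<and> k \<noteq> 0 \<and>
      c * freq k < norm (int_vec (transpose A *v k) - int_vec j)"
    define l where "l = norm (int_vec (transpose A *v k - j))"
    have ld: "int_vec (transpose A *v k - j) = int_vec (transpose A *v k) - int_vec j"
      by (simp add: int_vec_def vec_eq_iff)
    have cl: "c * freq k < l" using h unfolding l_def ld by blast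
    have f: "volume_homeo f" "continuous_on UNIV f" "smooth_lift f F" and \<delta>: "0 \<le> \<delta>"
      using h by (auto simp: volume_homeo_def)
    have ne: "transpose A *v k \<noteq> j"
    proof
      assume "transpose A *v k = j"
      then have "l = 0" by (simp add: l_def)
      then show False using cl c norm_int_vec_ge_1[of k] h by (simp add: mult_less_0_iff)
    qed
    then have l1: "1 \<le> l" unfolding l_def by (intro norm_int_vec_ge_1) simp
    have lower: "c * freq k \<le> norm (int_vec (transpose A *v k - j))" using cl by (simp add: l_def)
    have d1: "deriv_close A (Suc N) (c / 4) F" "deriv_close A 1 \<delta> F"
      using h by (auto simp: N_def intro: deriv_close_mono)
    have m1: "cmod (transfer_coeff f k j) \<le> B0 / l ^ N"
      using B0(2)[OF f(2,3) d1(1) ne lower] by (simp add: transfer_coeff_eq[OF f(1)] l_def)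
    have m2: "cmod (transfer_coeff f k j) \<le> 2 * \<delta> / c"
      unfolding transfer_coeff_eq[OF f(1)] by (rule oscillatory_integral_small[OF c f(2,3) d1(2) \<delta> ne lower])
    have kK: "1 + freq k \<le> K * l"
    proof -
      have "freq k \<le> l / c" using cl c by (simp add: field_simps)
      moreover have "0 \<le> \<beta> * l / c" using \<beta> c l1 by simp
      moreover have "K * l = 2 * l + l / c + \<beta> * l / c" using c
        by (simp add: K_def distrib_right add_divide_distrib)
      ultimately show ?thesis using l1 by linarith
    qed
    have jK: "1 + freq j \<le> K * l"
    proof -
      have "int_vec j = dual_matrix A *v int_vec k - int_vec (transpose A *v k - j)"
        unfolding ld int_vec_transpose_mult by (simp only: diff_diff_eq2 add_diff_cancel_left')
      then have "freq j \<le> norm (dual_matrix A *v int_vec k) + l"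
        unfolding l_def by (metis norm_triangle_ineq4)
      also have "norm (dual_matrix A *v int_vec k) \<le> \<beta> * freq k" by (rule \<beta>)
      also have "\<beta> * freq k \<le> \<beta> * (l / c)" using cl c \<beta> by (intro mult_left_mono) (auto simp: field_simps)
      finally have "freq j \<le> \<beta> * l / c + l" by simp
      moreover have "0 \<le> l / c" using c l1 by simp
      moreover have "K * l = 2 * l + l / c + \<beta> * l / c" using c
        by (simp add: K_def distrib_right add_divide_distrib)
      ultimately show ?thesis using l1 by linarith
    qed
    have "((1 + freq k) ^ r * (1 + freq j) ^ r) * ((1 + freq k) ^ 4 * (1 + freq j) ^ 4)
        = (1 + freq k) ^ (r + 4) * (1 + freq j) ^ (r + 4)" by (simp add: power_add mult_ac)
    also have "\<dots> \<le> (K * l) ^ (r + 4) * (K * l) ^ (r + 4)"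
      using kK jK K l1 by (intro mult_mono power_mono) auto
    also have "\<dots> = (K * l) ^ N"
    proof -
      have "r + 4 + (r + 4) = N" by (simp add: N_def)
      then show ?thesis by (simp only: power_add[symmetric])
    qed
    also have "\<dots> = K ^ N * l ^ N" by (rule power_mult_distrib)
    finally have P0: "((1 + freq k) ^ r * (1 + freq j) ^ r) * ((1 + freq k) ^ 4 * (1 + freq j) ^ 4) \<le> K ^ N * l ^ N" .
    have pos: "0 < (1 + freq k) ^ 4 * (1 + freq j) ^ 4"
      by (intro mult_pos_pos zero_less_power add_pos_nonneg) auto
    have P: "((1 + freq k) ^ r * (1 + freq j) ^ r) \<le> K ^ N * l ^ N * (decay k * decay j)"
      using iffD2[OF pos_le_divide_eq[OF pos] P0] by (simp add: decay_def)
    have "?m2 f k j \<le> (2 * \<delta> / c) * (B0 / l ^ N)"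
      unfolding power2_eq_square using m1 m2 c \<delta> by (intro mult_mono) auto
    from mult_mono[OF this P]
    have "?m2 f k j * ((1 + freq k) ^ r * (1 + freq j) ^ r) \<le>
        (2 * \<delta> / c) * (B0 / l ^ N) * (K ^ N * l ^ N * (decay k * decay j))"
      using c \<delta> B0(1) l1 by simp
    also have "\<dots> = \<delta> * (2 / c * B0 * K ^ N) * decay k * decay j" using l1 by (simp add: field_simps)
    finally show "?m2 f k j * ((1 + freq k) ^ r * (1 + freq j) ^ r)
        \<le> \<delta> * (2 / c * B0 * K ^ N) * decay k * decay j" .
  qed
qed

text \<open>The oscillatory estimate with amplitude \<open>b\<close> and j = 0: the lower bound on
  A^T k puts every nonzero \<open>k\<close> in the far region. This makes the weighted norm of the
  first iterate finite, uniformly in the map.\<close>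

lemma fourier_coeff_transfer_smooth_decay:
  fixes A :: "int^2^2"
  assumes c: "0 < c" and b: "smooth_scalar b"
    and lower: "\<And>k. c * freq k \<le> norm (int_vec (transpose A *v k))"
  shows "\<exists>B\<ge>0. \<forall>f F k. volume_homeo f \<and> smooth_lift f F \<and> deriv_close A (Suc (r + 4)) (c / 4) F \<and> k \<noteq> 0 \<longrightarrow>
      (cmod (fourier_coeff (transfer_op f b) k))\<^sup>2 * (1 + freq k) ^ r \<le> B * decay k"
proof -
  let ?T2 = "\<lambda>f k. (cmod (fourier_coeff (transfer_op f b) k))\<^sup>2"
  let ?N = "r + 4"
  obtain B0 where B0: "0 \<le> B0" "\<And>f F k j. continuous_on UNIV f \<Longrightarrow> smooth_lift f F \<Longrightarrow> deriv_close A (Suc ?N) (c / 4) F \<Longrightarrow>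
      transpose A *v k \<noteq> j \<Longrightarrow> c * freq k \<le> norm (int_vec (transpose A *v k - j)) \<Longrightarrow>
      cmod (LINT x|torus_measure. b x * (torus_char j x * cnj (torus_char k (f x))))
        \<le> B0 / norm (int_vec (transpose A *v k - j)) ^ ?N"
    using oscillatory_integral_decay[OF c b, of A ?N] by blast
  show ?thesis
  proof (intro exI[of _ "(B0 / c ^ ?N)\<^sup>2 * 2 ^ ?N"] conjI allI impI)
    fix f F and k :: "int^2"
    assume h: "volume_homeo f \<and> smooth_lift f F \<and> deriv_close A (Suc ?N) (c / 4) F \<and> k \<noteq> 0"
    have f: "volume_homeo f" "continuous_on UNIV f" "smooth_lift f F" "deriv_close A (Suc ?N) (c / 4) F"
      using h by (auto simp: volume_homeo_def)
    let ?s = "freq k"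
    have s1: "1 \<le> ?s" using norm_int_vec_ge_1 h by blast
    have cs: "0 < c * ?s" using c s1 by (intro mult_pos_pos) auto
    have "transpose A *v k \<noteq> 0" using lower[of k] cs by auto
    from B0(2)[OF f(2,3,4) this] lower
    have "cmod (fourier_coeff (transfer_op f b) k) \<le> B0 / norm (int_vec (transpose A *v k)) ^ ?N"
      by (simp add: fourier_coeff_transfer[OF f(1) smooth_scalar_continuous[OF b]])
    also have "\<dots> \<le> B0 / (c * ?s) ^ ?N"
    proof -
      have "(c * ?s) ^ ?N \<le> norm (int_vec (transpose A *v k)) ^ ?N"
        using lower[of k] cs by (intro power_mono) auto
      then show ?thesis using B0(1) cs c s1 by (intro divide_left_mono mult_pos_pos zero_less_power less_le_trans[OF cs lower]) auto
    qed
    finally have "?T2 f k \<le> (B0 / (c * ?s) ^ ?N)\<^sup>2"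
      by (intro power_mono) auto
    also have "\<dots> \<le> (B0 / c ^ ?N)\<^sup>2 * (1 / ?s ^ ?N)"
    proof -
      \<comment> \<open>Squaring yields twice the decay that is needed; half of it is given up to
        keep a plain power.\<close>
      have "(1 / ?s ^ ?N)\<^sup>2 \<le> 1 / ?s ^ ?N"
      proof -
        have "1 \<le> ?s ^ ?N" using s1 by (rule one_le_power)
        then show ?thesis unfolding power2_eq_square by (intro mult_left_le) auto
      qed
      then have "(B0 / c ^ ?N)\<^sup>2 * (1 / ?s ^ ?N)\<^sup>2 \<le> (B0 / c ^ ?N)\<^sup>2 * (1 / ?s ^ ?N)"
        by (intro mult_left_mono) auto
      then show ?thesis by (simp add: power_mult_distrib power_divide)
    qed
    finally have "?T2 f k * (1 + ?s) ^ ?N \<le> (B0 / c ^ ?N)\<^sup>2 * (1 / ?s ^ ?N) * (1 + ?s) ^ ?N"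
      by (intro mult_right_mono) auto
    also have "\<dots> \<le> (B0 / c ^ ?N)\<^sup>2 * (1 / ?s ^ ?N) * (2 * ?s) ^ ?N"
      using s1 by (intro mult_left_mono power_mono) auto
    also have "\<dots> = (B0 / c ^ ?N)\<^sup>2 * 2 ^ ?N" 
    proof -
      have "?s ^ ?N \<noteq> 0" using s1 by (intro power_not_zero) linarith
      then show ?thesis unfolding power_mult_distrib[of 2 ?s] by (simp del: power_add)
    qed
    finally have "?T2 f k * (1 + ?s) ^ r * (1 + ?s) ^ 4 \<le> (B0 / c ^ ?N)\<^sup>2 * 2 ^ ?N"
      by (simp add: power_add mult.assoc)
    moreover have "0 < (1 + ?s) ^ 4" by (intro zero_less_power add_pos_nonneg) auto
    ultimately show "?T2 f k * (1 + ?s) ^ r \<le> (B0 / c ^ ?N)\<^sup>2 * 2 ^ ?N * decay k"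
      unfolding decay_def by (simp add: pos_le_divide_eq)
  qed (use B0 c in simp)
qed

lemma deriv_close_near_linear:
  assumes "0 < \<delta>"
  shows "\<exists>\<epsilon>>0. \<forall>f. smooth_torus_map f \<and> dist_C_inf f (linear_torus_map A) < \<epsilon> \<longrightarrow> deriv_close A n \<delta> (the_lift f)"
  using iter_deriv_perturbation[OF assms, where A = A and n = n] unfolding deriv_close_def by blast

lemma smooth_lift_id: "smooth_lift id id"
  using iter_deriv_linear(2)[OF linear_id] by (simp add: smooth_lift_def)

lemma deriv_close_id: "deriv_close (mat 1) n 0 id"
proof -
  have "map_matrix real_of_int (mat 1) = (mat 1 :: real^2^2)"
    by (simp add: map_matrix_def mat_def vec_eq_iff)
  then show ?thesis by (auto simp: deriv_close_def iter_deriv_linear(1)[OF linear_id])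
qed

lemma volume_homeo_id: "volume_homeo id"
proof -
  have "distr torus_measure torus_measure id = torus_measure" unfolding id_def by (rule distr_id)
  then show ?thesis by (simp add: volume_homeo_def volume_preserving_def)
qed

text \<open>The identity is the map of the identity matrix with error 0, and c = 1 is a lower bound
  for that matrix, so the preceding estimate contains the decay of the coefficients of
  \<open>b\<close> itself.\<close>

lemma fourier_coeff_smooth_decay:
  assumes b: "smooth_scalar b"
  shows "\<exists>B\<ge>0. \<forall>k. k \<noteq> 0 \<longrightarrow> (cmod (fourier_coeff b k))\<^sup>2 * (1 + freq k) ^ r \<le> B * decay k"
proof -
  have t: "transfer_op id b = b" by (simp add: transfer_op_def)
  have "deriv_close (mat 1) (Suc (r + 4)) (1 / 4) id"
    by (rule deriv_close_mono[OF deriv_close_id order_refl]) simp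
  moreover have "1 * freq k \<le> norm (int_vec (transpose (mat 1) *v k))" for k
    by (simp add: transpose_mat)
  from fourier_coeff_transfer_smooth_decay[OF zero_less_one b this, of r]
  obtain B where "0 \<le> B" "\<And>f F k. volume_homeo f \<Longrightarrow> smooth_lift f F \<Longrightarrow>
      deriv_close (mat 1) (Suc (r + 4)) (1 / 4) F \<Longrightarrow> k \<noteq> 0 \<Longrightarrow>
      (cmod (fourier_coeff (transfer_op f b) k))\<^sup>2 * (1 + freq k) ^ r \<le> B * decay k"
    by blast
  ultimately show ?thesis
    using smooth_lift_id volume_homeo_id t by metis
qed

text \<open>The determinant enters here: a nonzero stable eigenvalue gives A^T a positive lower
  bound, which keeps its nonzero frequencies away from 0.\<close>

lemma transpose_eigenvalue_nonzero:
  fixes A :: "int^2^2"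
  assumes "det A = 1 \<or> det A = - 1" "is_eigenvector (dual_matrix A) ls vs"
  shows "ls \<noteq> 0"
proof
  assume "ls = 0"
  then have "dual_matrix A *v vs = 0" "vs \<noteq> 0"
    using assms(2) by (auto simp: is_eigenvector_def)
  moreover have "det (dual_matrix A) \<noteq> 0"
  proof -
    have "det (map_matrix real_of_int A) = real_of_int (det A)" by (simp add: det_2 map_matrix_def)
    then show ?thesis using assms(1) by (auto simp: det_transpose)
  qed
  ultimately show False
    by (metis invertible_det_nz invertible_def matrix_left_invertible_ker)
qed

theorem theorem3p7:
  fixes A :: "int^2^2" and vu vs :: "real^2" and lu ls :: real
    and b :: "torus \<Rightarrow> complex" and p :: real
    and M :: "'w measure" and \<eta> :: "nat \<Rightarrow> 'w \<Rightarrow> real"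
  assumes "det A = 1 \<or> det A = - 1"
    and "\<And>l :: complex. is_eigenvalue (map_matrix of_int A) l \<Longrightarrow> cmod l \<noteq> 1"
    and "is_eigenvector (transpose (map_matrix of_int A)) lu vu" "\<bar>lu\<bar> > 1" "norm vu = 1"
    and "is_eigenvector (transpose (map_matrix of_int A)) ls vs" "\<bar>ls\<bar> < 1" "norm vs = 1"
    and "smooth_scalar b" "(LINT x|torus_measure. b x) = 0" "L2_norm b = 1"
    and "normalized_iid M \<eta>"
    and "p > 0"
  shows "\<exists>\<epsilon>>0. \<exists>C>0. \<exists>\<kappa>\<^sub>0>0. \<forall>\<kappa> f k.
    0 < \<kappa> \<and> \<kappa> \<le> \<kappa>\<^sub>0 \<and>
    torus_diffeo f \<and> volume_preserving f \<and> dist_C_inf f (linear_torus_map A) < \<epsilon> \<and>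
    k \<noteq> 0 \<and> int_vec k \<in> unstable_cone vu vs \<longrightarrow>
      (\<integral>\<^sup>+ w. ennreal ((cmod (fourier_coeff (stationary_scalar f \<kappa> b (\<lambda>n. \<eta> n w)) k))\<^sup>2) \<partial>M)
        < ennreal (C / norm (int_vec k) powr (2 * p))"
proof -
  let ?T2 = "\<lambda>f k. (cmod (fourier_coeff (transfer_op f b) k))\<^sup>2"
  let ?m2 = "\<lambda>f k j. (cmod (transfer_coeff f k j))\<^sup>2"
  note b = \<open>smooth_scalar b\<close> and cb = smooth_scalar_continuous[OF \<open>smooth_scalar b\<close>]
  have ls: "ls \<noteq> 0" using transpose_eigenvalue_nonzero assms(1,6) by blast
  obtain w r c C where c: "0 < c" and C: "0 < C" and w0: "w 0 = 0" and w: "\<And>k. 0 \<le> w k"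
    and wu: "\<And>k. w k \<le> C * (1 + freq k) ^ r"
    and wl: "\<And>k. k \<noteq> 0 \<Longrightarrow> 1 \<le> w k * (C * (1 + freq k) ^ r)"
    and cone: "\<And>k. k \<noteq> 0 \<Longrightarrow> int_vec k \<in> unstable_cone vu vs \<Longrightarrow> freq k powr (2 * p) \<le> C * w k"
    and lower: "\<And>k. c * freq k \<le> norm (dual_matrix A *v int_vec k)"
    and near: "\<And>j k. j \<noteq> 0 \<Longrightarrow> k \<noteq> 0 \<Longrightarrow>
      norm (dual_matrix A *v int_vec k - int_vec j) \<le> c * freq k \<Longrightarrow> 64 * w k \<le> w j"
    using anisotropic_weight[OF assms(3-8) ls, of p] by metis
  obtain B1 where B1: "0 \<le> B1" "\<And>\<delta> f F k j. 0 \<le> \<delta> \<Longrightarrow> \<delta> \<le> c / 4 \<Longrightarrow> volume_homeo f \<Longrightarrow> smooth_lift f F \<Longrightarrow>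
      deriv_close A (Suc (2 * r + 8)) \<delta> F \<Longrightarrow> k \<noteq> 0 \<Longrightarrow>
      c * freq k < norm (int_vec (transpose A *v k) - int_vec j) \<Longrightarrow>
      ?m2 f k j * ((1 + freq k) ^ r * (1 + freq j) ^ r) \<le> \<delta> * B1 * decay k * decay j"
    using transfer_coeff_far_decay[OF c, of A r] by blast
  have lower': "c * freq k \<le> norm (int_vec (transpose A *v k))" for k
    unfolding int_vec_transpose_mult by (rule lower)
  obtain B2 where B2: "0 \<le> B2" "\<And>f F k. volume_homeo f \<Longrightarrow> smooth_lift f F \<Longrightarrow>
      deriv_close A (Suc (r + 4)) (c / 4) F \<Longrightarrow> k \<noteq> 0 \<Longrightarrow>
      ?T2 f k * (1 + freq k) ^ r \<le> B2 * decay k"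
    using fourier_coeff_transfer_smooth_decay[OF c b lower', of r] by blast
  obtain B3 where B3: "0 \<le> B3" "\<And>k. k \<noteq> 0 \<Longrightarrow> (cmod (fourier_coeff b k))\<^sup>2 * (1 + freq k) ^ r \<le> B3 * decay k"
    using fourier_coeff_smooth_decay[OF b, of r] by blast
  define D where "D = infsum decay UNIV"
  have D: "0 \<le> D" unfolding D_def by (intro infsum_nonneg less_imp_le decay_pos)
  \<comment> \<open>With \<delta> <= 1 / Z the far pairs stay within the budget 1/16 of the
    contraction; the summand 1 keeps \<open>Z\<close> positive.\<close>
  define Z where "Z = 16 * (C\<^sup>2 * B1 * D\<^sup>2 + 1)"
  have Z: "0 < Z" using B1(1) by (simp add: Z_def add_nonneg_pos)
  define \<delta> where "\<delta> = min (c / 4) (1 / Z)"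
  have \<delta>: "0 < \<delta>" "\<delta> \<le> c / 4" "\<delta> * Z \<le> 1"
    using c Z by (auto simp: \<delta>_def min_def field_simps)
  \<comment> \<open>One factor \<open>C\<close> comes from the upper bound on \<open>w k\<close>,
    the other from the lower bound on \<open>w j\<close>.\<close>
  define e where "e = C\<^sup>2 * (\<delta> * B1)"
  have e: "0 \<le> e" "e * D\<^sup>2 \<le> 1 / 16"
  proof -
    show "0 \<le> e" using \<delta> B1(1) by (simp add: e_def)
    have "16 * (e * D\<^sup>2) \<le> \<delta> * Z" using \<delta> by (simp add: e_def Z_def algebra_simps)
    then show "e * D\<^sup>2 \<le> 1 / 16" using \<delta>(3) by simp
  qed
  obtain \<epsilon> where \<epsilon>: "0 < \<epsilon>" "\<And>f. smooth_torus_map f \<Longrightarrow> dist_C_inf f (linear_torus_map A) < \<epsilon> \<Longrightarrow>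
      deriv_close A (Suc (2 * r + 8)) \<delta> (the_lift f)"
    using deriv_close_near_linear[OF \<delta>(1), of A "Suc (2 * r + 8)"] by blast
  define M1 where "M1 = C * B2 * D"
  \<comment> \<open>The summands are for the term n = 0, which is \<open>b\<close> itself and
    precedes the contraction, for the geometric series of the later terms, whose sum 4/3 is rounded
    up to 2, and for the strict inequality.\<close>
  define C' where "C' = C\<^sup>2 * B3 + 2 * (C * M1) + 1"
  have M1: "0 \<le> M1" using C B2 D by (simp add: M1_def)
  have dec1: "decay k \<le> 1" for k
  proof -
    have "1 \<le> (1 + freq k) ^ 4" by (intro one_le_power) simp
    moreover from this have "0 < (1 + freq k) ^ 4" by linarith
    ultimately show ?thesis unfolding decay_def by (simp only: divide_le_eq_1_pos)
  qed
  show ?thesis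
  proof (rule exI[of _ \<epsilon>], intro conjI \<epsilon>(1), rule exI[of _ C'], intro conjI, goal_cases)
    case 1
    show ?case using C B3(1) M1 by (simp add: C'_def add_nonneg_pos)
  next
    case 2
    show ?case
    \<comment> \<open>The bound 1 on \<kappa> is an arbitrary choice: none of the constants fixed so
      far depends on \<kappa>.\<close>
    proof (rule exI[of _ 1], intro conjI allI impI, simp)
      fix \<kappa> :: real and f :: "torus \<Rightarrow> torus" and k :: "int^2"
      assume h: "0 < \<kappa> \<and> \<kappa> \<le> 1 \<and> torus_diffeo f \<and> volume_preserving f \<and>
        dist_C_inf f (linear_torus_map A) < \<epsilon> \<and> k \<noteq> 0 \<and> int_vec k \<in> unstable_cone vu vs"
      have \<kappa>: "0 < \<kappa>" and k: "k \<noteq> 0" "int_vec k \<in> unstable_cone vu vs" and f: "volume_homeo f"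
        and sf: "smooth_torus_map f" and dist: "dist_C_inf f (linear_torus_map A) < \<epsilon>"
        using h torus_diffeo_volume_homeo by (auto simp: torus_diffeo_def)
      let ?F = "the_lift f"
      have F: "smooth_lift f ?F" by (rule the_lift_smooth[OF sf])
      have dc: "deriv_close A (Suc (2 * r + 8)) \<delta> ?F" by (rule \<epsilon>(2)[OF sf dist])
      \<comment> \<open>By contraposition of \<open>near\<close>, a nonzero column that is not heavy
        enough lies in the far region. Column 0 is settled by its exact vanishing, and row 0 cannot
        occur because its weight is 0.\<close>
      have far: "?m2 f k j * w k \<le> w j * (e * decay k * decay j)" if lt: "w j < 64 * w k" for k j
      proof -
        have k0: "k \<noteq> 0" using lt w[of j] w0 by auto
        show ?thesis
        proof (cases "j = 0")
          case True
          then show ?thesis using transfer_coeff_0[OF f k0] w0 by simp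
        next
          case False
          have "\<not> norm (dual_matrix A *v int_vec k - int_vec j) \<le> c * freq k"
            using near[OF False k0] lt by linarith
          then have "c * freq k < norm (int_vec (transpose A *v k) - int_vec j)"
            by (simp only: int_vec_transpose_mult not_le)
          from B1(2)[OF less_imp_le[OF \<delta>(1)] \<delta>(2) f F dc k0 this]
          have m: "?m2 f k j * ((1 + freq k) ^ r * (1 + freq j) ^ r) \<le> \<delta> * B1 * decay k * decay j" .
          let ?a = "(1 + freq k) ^ r" and ?b = "(1 + freq j) ^ r"
          have "?m2 f k j * w k \<le> ?m2 f k j * (C * ?a)"
            by (intro mult_left_mono wu) simp
          also have "\<dots> \<le> ?m2 f k j * (C * ?a) * (w j * (C * ?b))"
            using mult_left_mono[OF wl[OF False], of "?m2 f k j * (C * ?a)"] C by simp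
          also have "\<dots> = (w j * C\<^sup>2) * (?m2 f k j * (?a * ?b))"
            by (simp add: power2_eq_square mult_ac)
          also have "\<dots> \<le> (w j * C\<^sup>2) * (\<delta> * B1 * decay k * decay j)"
            using w[of j] by (intro mult_left_mono m) simp
          also have "\<dots> = w j * (e * decay k * decay j)" by (simp add: e_def mult_ac)
          finally show ?thesis .
        qed
      qed
      have dc': "deriv_close A (Suc (r + 4)) (c / 4) ?F" by (rule deriv_close_mono[OF dc _ \<delta>(2)]) simp
      have fle: "w k * ?T2 f k \<le> C * B2 * decay k" for k
      proof (cases "k = 0")
        case True
        then show ?thesis using w0 C B2(1) decay_pos[of k] by simp
      next
        case False
        have "w k * ?T2 f k \<le> (C * (1 + freq k) ^ r) * ?T2 f k"
          by (intro mult_right_mono wu) simp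
        also have "\<dots> = C * (?T2 f k * (1 + freq k) ^ r)" by (simp add: mult_ac)
        also have "\<dots> \<le> C * (B2 * decay k)" using C by (intro mult_left_mono B2(2)[OF f F dc' False]) simp
        finally show ?thesis by simp
      qed
      have sd: "(\<lambda>k. C * B2 * decay k) summable_on UNIV" by (intro summable_on_cmult_right summable_decay)
      have first: "(\<lambda>k. w k * ?T2 f k) summable_on UNIV"
        by (rule summable_on_comparison_test[OF sd fle]) (simp add: w)
      have first': "(\<Sum>\<^sub>\<infinity>k. w k * ?T2 f k) \<le> M1"
      proof -
        have "(\<Sum>\<^sub>\<infinity>k. w k * ?T2 f k) \<le> (\<Sum>\<^sub>\<infinity>k. C * B2 * decay k)"
          by (intro infsum_mono first sd fle)
        also have "\<dots> = M1" by (subst infsum_cmult_right') (simp add: M1_def D_def)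
        finally show ?thesis .
      qed
      define g where "g n = (pulsed_op f \<kappa> ^^ n) b" for n
      note it = pulsed_iterates_decay[OF f \<kappa> cb assms(10) w wl C e(1) e(2)[unfolded D_def] far first first', folded g_def]
      have gc: "continuous_on UNIV (g n)" for n by (rule it(1))
      obtain K where K: "\<And>n x. cmod (g n x) \<le> K * (1 / 2) ^ n" using it(3) by blast
      let ?s = "freq k"
      have s1: "1 \<le> ?s" by (rule norm_int_vec_ge_1[OF k(1)])
      define P where "P = ?s powr (2 * p)"
      have P: "0 < P" "P \<le> C * w k" using s1 cone[OF k] by (auto simp: P_def)
      have c0: "(cmod (fourier_coeff (g 0) k))\<^sup>2 * P \<le> C\<^sup>2 * B3"
      proof -
        have "(cmod (fourier_coeff (g 0) k))\<^sup>2 * P \<le> (cmod (fourier_coeff b k))\<^sup>2 * (C * (C * (1 + ?s) ^ r))"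
          unfolding g_def using P(2) wu[of k] C by (simp, intro mult_left_mono) (auto intro: order_trans)
        also have "\<dots> = C\<^sup>2 * ((cmod (fourier_coeff b k))\<^sup>2 * (1 + ?s) ^ r)" by (simp add: power2_eq_square mult_ac)
        also have "\<dots> \<le> C\<^sup>2 * (B3 * decay k)" by (intro mult_left_mono B3(2)[OF k(1)]) simp
        also have "\<dots> \<le> C\<^sup>2 * (B3 * 1)" using B3(1) by (intro mult_left_mono dec1) simp_all
        finally show ?thesis by simp
      qed
      have cS: "(cmod (fourier_coeff (g (Suc n)) k))\<^sup>2 * P \<le> C * M1 * (1 / 4) ^ n" for n
      proof -
        have "(cmod (fourier_coeff (g (Suc n)) k))\<^sup>2 * P \<le> (cmod (fourier_coeff (g (Suc n)) k))\<^sup>2 * (C * w k)"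
          using P(2) by (intro mult_left_mono) simp_all
        also have "\<dots> = C * (w k * (cmod (fourier_coeff (g (Suc n)) k))\<^sup>2)" by (simp add: mult_ac)
        also have "\<dots> \<le> C * (M1 * (1 / 4) ^ n)" by (intro mult_left_mono it(2) less_imp_le[OF C])
        finally show ?thesis by simp
      qed
      have sumS: "(\<Sum>n<N. (cmod (fourier_coeff (g n) k))\<^sup>2) \<le> (C' - 1) / P" for N
      proof -
        have q: "(\<Sum>n<N. (1 / 4 :: real) ^ n) \<le> 2" for N :: nat
        proof -
          have "(\<Sum>n<N. (1 / 4 :: real) ^ n) = (4 / 3) * (1 - (1 / 4) ^ N)" by (induction N) (simp_all add: algebra_simps)
          also have "\<dots> \<le> 2" 
          proof -
            define y where "y = (1 / 4 :: real) ^ N"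
            have "0 \<le> y" unfolding y_def by (rule zero_le_power) simp
            then show ?thesis unfolding y_def[symmetric] by simp
          qed
          finally show ?thesis .
        qed
        have "(\<Sum>n<N. (cmod (fourier_coeff (g n) k))\<^sup>2) * P \<le> (\<Sum>n<Suc N. (cmod (fourier_coeff (g n) k))\<^sup>2) * P"
          using P(1) by simp
        also have "\<dots> = (cmod (fourier_coeff (g 0) k))\<^sup>2 * P + (\<Sum>n<N. (cmod (fourier_coeff (g (Suc n)) k))\<^sup>2 * P)"
          by (simp only: sum.lessThan_Suc_shift distrib_right sum_distrib_right)
        also have "\<dots> \<le> C\<^sup>2 * B3 + (\<Sum>n<N. C * M1 * (1 / 4) ^ n)"
          by (intro add_mono c0 sum_mono cS)
        also have "\<dots> = C\<^sup>2 * B3 + C * M1 * (\<Sum>n<N. (1 / 4) ^ n)" by (simp only: sum_distrib_left)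
        also have "\<dots> \<le> C\<^sup>2 * B3 + C * M1 * 2" using C M1 q by (intro add_left_mono mult_left_mono) auto
        also have "\<dots> = C' - 1" by (simp add: C'_def)
        finally show ?thesis using P(1) by (simp add: pos_le_divide_eq)
      qed
      have "(\<integral>\<^sup>+ \<omega>. ennreal ((cmod (fourier_coeff (stationary_scalar f \<kappa> b (\<lambda>n. \<eta> n \<omega>)) k))\<^sup>2) \<partial>M) \<le> ennreal ((C' - 1) / P)"
        unfolding stationary_scalar_def g_def[symmetric]
        by (rule stationary_second_moment[OF assms(12) gc K _ sumS]) (intro summable_mult summable_geometric, simp)
      also have "\<dots> < ennreal (C' / P)"
        using P(1) C B3(1) M1 by (intro ennreal_lessI) (auto simp: C'_def divide_strict_right_mono add_nonneg_pos)
      finally show "(\<integral>\<^sup>+ \<omega>. ennreal ((cmod (fourier_coeff (stationary_scalar f \<kappa> b (\<lambda>n. \<eta> n \<omega>)) k))\<^sup>2) \<partial>M)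
        < ennreal (C' / ?s powr (2 * p))" by (simp only: P_def)
    qed
  qed
qed

end
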